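(* Let $\mathbb{G}$ be a compact quantum group described by a $C^*$-algebra $\mathrm{C}(\mathbb{G})$ (a completion of $\mathrm{Pol}(\mathbb{G})$ in a quantum group norm), let $\widehat{\mathbb{G}}$ be its discrete dual, and let $\widetilde{\mathbb{G}}$ be $\mathbb{G}$ with neutral element adjoined. (a) If $\mathbb{G}\neq\widetilde{\mathbb{G}}=\mathbb{G}_{\max}$, i.e. the canonical map $\mathrm{C}(\widetilde{\mathbb{G}})\to\mathrm{C}(\mathbb{G})$ is not an isomorphism while the canonical map $\mathrm{C}(\mathbb{G}_{\max})\to\mathrm{C}(\widetilde{\mathbb{G}})$ is an isomorphism, then $\widehat{\mathbb{G}}$ has property $(\mathrm{T})$. (b) Consequently, if $\mathbb{G}=\mathbb{G}_{\min}$ is the reduced version of a non-co-amenable compact quantum group whose dual does not have property $(\mathrm{T})$, then $\mathbb{G}\neq\widetilde{\mathbb{G}}\neq\mathbb{G}_{\max}$, in the sense that neither of the canonical morphisms $\mathrm{C}(\mathbb{G}_{\max})\to\mathrm{C}(\widetilde{\mathbb{G}})\to\mathrm{C}(\mathbb{G})$ is an isomorphism.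
   Context: Conventions: $C^*$-algebras (other than multiplier algebras) and Hilbert spaces are separable, tensor products of $C^*$-algebras are spatial, representations are $*$-representations. $\mathrm{Pol}(\mathbb{G})$ is the Hopf $*$-algebra spanned by matrix elements of finite-dimensional corepresentations of $\mathbb{G}$, with comultiplication $\Delta$ and counit $\varepsilon$; $\mathrm{Irr}(\mathbb{G})$ is the set of classes of irreducible corepresentations and $u^\alpha\in M_{n_\alpha}(\mathbb{C})\otimes\mathrm{Pol}(\mathbb{G})$ a fixed unitary representative of $\alpha$. A $C^*$-norm on $\mathrm{Pol}(\mathbb{G})$ is a quantum group norm if $\Delta$ extends to a $*$-homomorphism from the completion $A$ to $A\otimes A$. $\mathrm{C}(\mathbb{G}_{\max})$ is the completion in the maximal $C^*$-norm ($\varepsilon$ extends to it); $\mathrm{C}(\mathbb{G}_{\min})$ is the completion in the norm of the representation on $L^2(\mathbb{G})$, the GNS space of the Haar state. $\mathbb{G}$ is co-amenable if the canonical map $\mathrm{C}(\mathbb{G}_{\max})\to\mathrm{C}(\mathbb{G}_{\min})$ is an isomorphism. Adjoining the neutral element: $\mathrm{C}(\widetilde{\mathbb{G}})$ is the completion of $\mathrm{Pol}(\mathbb{G})$ in the (quantum group) norm $\max\{\|a\|_{\mathrm{C}(\mathbb{G})},|\varepsilon(a)|\}$. The canonical morphisms $\mathrm{C}(\mathbb{G}_{\max})\to\mathrm{C}(\widetilde{\mathbb{G}})\to\mathrm{C}(\mathbb{G})$ extend the identity of $\mathrm{Pol}(\mathbb{G})$. The dual $\widehat{\mathbb{G}}$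 is given by $\mathrm{c}_0(\widehat{\mathbb{G}})=\bigoplus_\alpha M_{n_\alpha}(\mathbb{C})$, acting on $L^2(\mathbb{G})=\bigoplus_\alpha H^\alpha$, $H^\alpha=\mathrm{span}\{u^\alpha_{i,j}\}$, by $e^\alpha_{i,j}u^\alpha_{r,l}=\delta_{j,l}u^\alpha_{r,i}$ (and $0$ on $H^\beta$, $\beta\ne\alpha$). Corepresentations of $\widehat{\mathbb{G}}$ on $H_V$ are the unitaries $V=(\mathrm{id}\otimes\pi_V)w$, $w=\bigoplus_\alpha u^\alpha$, for representations $\pi_V$ of $\mathrm{C}(\mathbb{G}_{\max})$ on $H_V$; put $V^\alpha=(\mathrm{id}\otimes\pi_V)u^\alpha$. Property $(\mathrm{T})$ (Fima): $\xi\in H_V$ is $(E,\delta)$-invariant ($E\subset\mathrm{Irr}(\mathbb{G})$ finite, $\delta>0$) if $\|V^\alpha(\eta\otimes\xi)-\eta\otimes\xi\|<\delta\|\eta\|\|\xi\|$ for all $\alpha\in E$ and non-zero $\eta\in H^\alpha$; $V$ has almost invariant vectors if such $\xi$ exists for all $E,\delta$; $\xi$ is invariant if $V^\alpha(\eta\otimes\xi)=\eta\otimes\xi$ for all $\alpha$, $\eta\in H^\alpha$; $\widehat{\mathbb{G}}$ has property $(\mathrm{T})$ if every corepresentation with almost invariant vectors has a non-zero invariant vector. Equivalently (a known fact): every representation $\pi$ of $\mathrm{C}(\mathbb{G}_{\max})$ admitting unit vectors $\xi_n$ with $\|\pi(a)\xi_n-\varepsilon(a)\xi_n\|\to0$ for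 all $a$ admits a unit vector $\xi$ with $\pi(a)\xi=\varepsilon(a)\xi$ for all $a$. *)

theory Defs
  imports "HOL-Analysis.Analysis"
begin

section \<open>Complex vector spaces and unital complex *-algebras\<close>

class complex_vector = ab_group_add +
  fixes scaleC :: "complex \<Rightarrow> 'a \<Rightarrow> 'a" (infixr "*\<^sub>C" 75)
  assumes scaleC_add_right: "c *\<^sub>C (x + y) = c *\<^sub>C x + c *\<^sub>C y"
    and scaleC_add_left: "(c + d) *\<^sub>C x = c *\<^sub>C x + d *\<^sub>C x"
    and scaleC_scaleC: "c *\<^sub>C d *\<^sub>C x = (c * d) *\<^sub>C x"
    and scaleC_one: "1 *\<^sub>C x = x"

class complex_star_algebra = complex_vector + ring_1 +
  fixes star :: "'a \<Rightarrow> 'a"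
  assumes mult_scaleC_left: "(c *\<^sub>C x) * y = c *\<^sub>C (x * y)"
    and mult_scaleC_right: "x * (c *\<^sub>C y) = c *\<^sub>C (x * y)"
    and star_star: "star (star x) = x"
    and star_add: "star (x + y) = star x + star y"
    and star_scaleC: "star (c *\<^sub>C x) = cnj c *\<^sub>C star x"
    and star_mult: "star (x * y) = star y * star x"

instantiation complex :: complex_star_algebra
begin
definition "scaleC (c::complex) (z::complex) = c * z"
definition "star (z::complex) = cnj z"
instance
  by standard (auto simp: scaleC_complex_def star_complex_def algebra_simps)
end

definition clinear :: "('a::complex_vector \<Rightarrow> 'b::complex_vector) \<Rightarrow> bool" where
  "clinear f \<longleftrightarrow> (\<forall>x y. f (x + y) = f x + f y) \<and> (\<forall>c x. f (c *\<^sub>C x) = c *\<^sub>C f x)"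

definition cbilinear ::
    "('a::complex_vector \<Rightarrow> 'b::complex_vector \<Rightarrow> 'c::complex_vector) \<Rightarrow> bool" where
  "cbilinear B \<longleftrightarrow> (\<forall>a. clinear (B a)) \<and> (\<forall>b. clinear (\<lambda>a. B a b))"

definition star_hom ::
    "('a::complex_star_algebra \<Rightarrow> 'b::complex_star_algebra) \<Rightarrow> bool" where
  "star_hom f \<longleftrightarrow> clinear f \<and> (\<forall>x y. f (x * y) = f x * f y) \<and> f 1 = 1 \<and>
    (\<forall>x. f (star x) = star (f x))"

lemma vector_space_scaleC: "vector_space (scaleC :: complex \<Rightarrow> 'a::complex_vector \<Rightarrow> 'a)"
  by unfold_locales (auto simp: scaleC_add_right scaleC_add_left scaleC_scaleC scaleC_one)

lemma ex_functional:
  fixes v :: "'a::complex_vector"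
  assumes "v \<noteq> 0"
  shows "\<exists>f::'a \<Rightarrow> complex. clinear f \<and> f v = 1"
proof -
  interpret V: vector_space_pair "scaleC :: complex \<Rightarrow> 'a \<Rightarrow> 'a" "scaleC :: complex \<Rightarrow> complex \<Rightarrow> complex"
    by (simp add: vector_space_pair_def vector_space_scaleC)
  have "V.vs1.independent {v}"
    using assms by (simp add: V.vs1.independent_insert V.vs1.independent_empty)
  from V.linear_independent_extend[OF this, of "\<lambda>_. 1"]
  obtain g :: "'a \<Rightarrow> complex"
    where g: "Vector_Spaces.linear scaleC scaleC g" and gv: "g v = 1" by auto
  have "clinear g"
    unfolding clinear_def
    using V.linear_add[OF g] V.linear_scale[OF g] by simp
  with gv show ?thesis by blast
qed

lemma clinear_0: "clinear f \<Longrightarrow> f 0 = 0"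
  unfolding clinear_def by (metis add_cancel_right_right)

lemma clinear_diff: "clinear f \<Longrightarrow> f (x - y) = f x - f y"
  unfolding clinear_def by (metis add_diff_cancel diff_add_cancel)

lemma clinear_minus: "clinear f \<Longrightarrow> f (- x) = - f x"
  using clinear_diff[of f 0 x] clinear_0[of f] by simp


section \<open>The algebraic tensor product\<close>

text \<open>A list \<open>[(a\<^sub>1,b\<^sub>1),\<dots>]\<close> represents \<open>\<Sum> a\<^sub>i \<otimes> b\<^sub>i\<close>; two such sums are identified iff no
  bilinear form separates them.\<close>

definition tsum :: "('a \<Rightarrow> 'b \<Rightarrow> 'c::comm_monoid_add) \<Rightarrow> ('a \<times> 'b) list \<Rightarrow> 'c" where
  "tsum B L = (\<Sum>(a, b)\<leftarrow>L. B a b)"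

definition tensor_eq ::
    "('a::complex_vector \<times> 'b::complex_vector) list \<Rightarrow> ('a \<times> 'b) list \<Rightarrow> bool" where
  "tensor_eq L M \<longleftrightarrow> (\<forall>B :: 'a \<Rightarrow> 'b \<Rightarrow> complex. cbilinear B \<longrightarrow> tsum B L = tsum B M)"

quotient_type (overloaded) ('a, 'b) tensor = "('a::complex_vector \<times> 'b::complex_vector) list" / tensor_eq
  by (rule equivpI) (auto simp: reflp_def symp_def transp_def tensor_eq_def)

lemma tsum_simps [simp]:
  "tsum B [] = 0"
  "tsum B (L @ M) = tsum B L + tsum B M"
  "tsum B (x # L) = B (fst x) (snd x) + tsum B L"
  "tsum B (map (\<lambda>(a, b). (f a, g b)) K) = tsum (\<lambda>a b. B (f a) (g b)) K"
  by (simp_all add: tsum_def case_prod_beta) (induction K, auto)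

lemma cbilinear_simps:
  assumes "cbilinear B"
  shows "B (x + y) b = B x b + B y b" "B a (z + w) = B a z + B a w"
    "B (c *\<^sub>C x) b = c *\<^sub>C B x b" "B a (c *\<^sub>C z) = c *\<^sub>C B a z"
    "B (- x) b = - B x b" "B a (- z) = - B a z"
  using assms clinear_minus[of "\<lambda>a. B a b" x] clinear_minus[of "B a" z]
  by (auto simp: cbilinear_def clinear_def)

lemma tsum_clinear: "clinear f \<Longrightarrow> f (tsum B L) = tsum (\<lambda>a b. f (B a b)) L"
  by (induction L) (auto simp: clinear_0 clinear_def)

lemma tsum_uminus: "tsum (\<lambda>a b. - B a b) L = - (tsum B L :: 'c::ab_group_add)"
  by (induction L) auto

lemma tsum_scaleC: "tsum (\<lambda>a b. c *\<^sub>C B a b) L = c *\<^sub>C (tsum B L :: 'c::complex_vector)"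
  by (rule sym, rule tsum_clinear) (simp add: clinear_def scaleC_add_right scaleC_scaleC mult.commute)

lemma tsum_add: "tsum (\<lambda>a b. B a b + C a b) L = tsum B L + tsum C L"
  by (induction L) (auto simp: algebra_simps)

lemma tsum_cong_eq:
  fixes B :: "'a::complex_vector \<Rightarrow> 'b::complex_vector \<Rightarrow> 'c::complex_vector"
  assumes "tensor_eq L M" "cbilinear B"
  shows "tsum B L = tsum B M"
proof (rule ccontr)
  assume "tsum B L \<noteq> tsum B M"
  then obtain f :: "'c \<Rightarrow> complex" where f: "clinear f" "f (tsum B L - tsum B M) = 1"
    using ex_functional[of "tsum B L - tsum B M"] by auto
  have "cbilinear (\<lambda>a b. f (B a b))"
    using assms(2) f(1) by (auto simp: cbilinear_def clinear_def)
  hence "tsum (\<lambda>a b. f (B a b)) L = tsum (\<lambda>a b. f (B a b)) M"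
    using assms(1) by (simp add: tensor_eq_def)
  thus False
    using f by (simp add: clinear_diff flip: tsum_clinear)
qed

lift_definition elem_tensor ::
    "'a::complex_vector \<Rightarrow> 'b::complex_vector \<Rightarrow> ('a, 'b) tensor" (infixr "\<otimes>\<^sub>C" 76)
  is "\<lambda>a b. [(a, b)]" .

definition tensor_lift ::
    "('a::complex_vector \<Rightarrow> 'b::complex_vector \<Rightarrow> 'c::comm_monoid_add) \<Rightarrow> ('a, 'b) tensor \<Rightarrow> 'c" where
  "tensor_lift B t = tsum B (rep_tensor t)"

instantiation tensor :: (complex_vector, complex_vector) complex_vector
begin

lift_definition zero_tensor :: "('a, 'b) tensor" is "[]" .

lift_definition plus_tensor :: "('a, 'b) tensor \<Rightarrow> ('a, 'b) tensor \<Rightarrow> ('a, 'b) tensor" is "(@)"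
  by (auto simp: tensor_eq_def)

lift_definition uminus_tensor :: "('a, 'b) tensor \<Rightarrow> ('a, 'b) tensor"
  is "map (\<lambda>(a, b). (- a, b))"
  by (simp add: tensor_eq_def cbilinear_simps tsum_uminus tsum_simps(4)[where g = "\<lambda>b. b"])

lift_definition minus_tensor :: "('a, 'b) tensor \<Rightarrow> ('a, 'b) tensor \<Rightarrow> ('a, 'b) tensor"
  is "\<lambda>L M. L @ map (\<lambda>(a, b). (- a, b)) M"
  by (simp add: tensor_eq_def cbilinear_simps tsum_uminus tsum_simps(4)[where g = "\<lambda>b. b"])

lift_definition scaleC_tensor :: "complex \<Rightarrow> ('a, 'b) tensor \<Rightarrow> ('a, 'b) tensor"
  is "\<lambda>c. map (\<lambda>(a, b). (c *\<^sub>C a, b))"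
  by (simp add: tensor_eq_def cbilinear_simps tsum_scaleC tsum_simps(4)[where g = "\<lambda>b. b"])

instance
proof
  fix x y z :: "('a, 'b) tensor" and c d :: complex
  note defs = tensor_eq_def cbilinear_simps tsum_scaleC tsum_uminus scaleC_add_right
    scaleC_add_left scaleC_scaleC scaleC_one tsum_simps(4)[where g = "\<lambda>b. b"]
  show "x + y + z = x + (y + z)" by transfer (simp add: defs)
  show "x + y = y + x" by transfer (simp add: defs)
  show "0 + x = x" by transfer (simp add: defs)
  show "- x + x = 0" by transfer (simp add: defs)
  show "x - y = x + - y" by transfer (simp add: defs)
  show "c *\<^sub>C (x + y) = c *\<^sub>C x + c *\<^sub>C y" by transfer (simp add: defs)
  show "(c + d) *\<^sub>C x = c *\<^sub>C x + d *\<^sub>C x" by transfer (simp add: defs tsum_add)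
  show "c *\<^sub>C d *\<^sub>C x = (c * d) *\<^sub>C x"
    by transfer (simp add: defs del: map_map)
  show "1 *\<^sub>C x = x" by transfer (simp add: defs)
qed

end

lemma tensor_eq_rep: "tensor_eq (rep_tensor (abs_tensor L)) L"
  using Quotient_rep_abs[OF Quotient_tensor] by (simp add: tensor_eq_def)

lemma tensor_lift_elem: "cbilinear B \<Longrightarrow> tensor_lift B (a \<otimes>\<^sub>C b) = B a b"
  unfolding tensor_lift_def elem_tensor.abs_eq
  using tsum_cong_eq[OF tensor_eq_rep, of B "[(a, b)]"] by simp

lemma tensor_lift_abs: "cbilinear B \<Longrightarrow> tensor_lift B (abs_tensor L) = tsum B L"
  unfolding tensor_lift_def using tsum_cong_eq[OF tensor_eq_rep] by blast

lemma tensor_lift_clinear: "cbilinear B \<Longrightarrow> clinear (tensor_lift B)"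
  unfolding clinear_def
proof (intro conjI allI)
  fix s t :: "('a, 'b) tensor" and c
  assume B: "cbilinear B"
  obtain L M where L: "s = abs_tensor L" "t = abs_tensor M"
    by (metis Quotient_abs_rep Quotient_tensor)
  show "tensor_lift B (s + t) = tensor_lift B s + tensor_lift B t"
    by (simp add: L plus_tensor.abs_eq tensor_lift_abs[OF B])
  show "tensor_lift B (c *\<^sub>C s) = c *\<^sub>C tensor_lift B s"
    by (simp add: L scaleC_tensor.abs_eq tensor_lift_abs[OF B] cbilinear_simps[OF B] tsum_scaleC
      tsum_simps(4)[where g = "\<lambda>b. b"])
qed

definition tmul :: "('a::times \<times> 'b::times) list \<Rightarrow> ('a \<times> 'b) list \<Rightarrow> ('a \<times> 'b) list" where
  "tmul L M = concat (map (\<lambda>(a, b). map (\<lambda>(c, d). (a * c, b * d)) M) L)"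

lemma tsum_tmul: "tsum B (tmul L M) = tsum (\<lambda>a b. tsum (\<lambda>c d. B (a * c) (b * d)) M) L"
  by (induction L) (auto simp: tmul_def case_prod_beta
    tsum_simps(4)[unfolded case_prod_beta])

lemma cbilinear_mult:
  fixes B :: "'a::complex_star_algebra \<Rightarrow> 'b::complex_star_algebra \<Rightarrow> 'c::complex_vector"
  assumes "cbilinear B"
  shows "cbilinear (\<lambda>c d. B (a * c) (b * d))" "cbilinear (\<lambda>c d. B (c * a) (d * b))"
  using assms by (auto simp: cbilinear_def clinear_def algebra_simps mult_scaleC_left mult_scaleC_right)

lemma cbilinear_tsum:
  assumes "\<And>c d. cbilinear (\<lambda>a b. B a b c d)"
  shows "cbilinear (\<lambda>a b. tsum (\<lambda>c d. B a b c d) M)"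
proof -
  have "B (x + y) b = (\<lambda>c d. B x b c d + B y b c d)" "B a (z + w) = (\<lambda>c d. B a z c d + B a w c d)"
    "B (k *\<^sub>C x) b = (\<lambda>c d. k *\<^sub>C B x b c d)" "B a (k *\<^sub>C z) = (\<lambda>c d. k *\<^sub>C B a z c d)"
    for x y a z w b k
    by (intro ext; rule cbilinear_simps[OF assms])+
  thus ?thesis
    by (simp add: cbilinear_def clinear_def tsum_add tsum_scaleC)
qed

lemma tsum_cnj: "tsum (\<lambda>a b. cnj (B a b)) L = cnj (tsum B L)"
  by (induction L) auto

lemma tsum_swap: "tsum (\<lambda>a b. tsum (\<lambda>c d. B a b c d) M) L = tsum (\<lambda>c d. tsum (\<lambda>a b. B a b c d) L) M"
  by (induction L) (auto simp: tsum_add, induction M, auto)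

instantiation tensor :: (complex_star_algebra, complex_star_algebra) complex_star_algebra
begin

lift_definition times_tensor :: "('a, 'b) tensor \<Rightarrow> ('a, 'b) tensor \<Rightarrow> ('a, 'b) tensor" is tmul
proof -
  fix L L' M M' :: "('a \<times> 'b) list"
  assume L: "tensor_eq L L'" and M: "tensor_eq M M'"
  show "tensor_eq (tmul L M) (tmul L' M')"
    unfolding tensor_eq_def
  proof (intro allI impI)
    fix B :: "'a \<Rightarrow> 'b \<Rightarrow> complex" assume B: "cbilinear B"
    have "tsum B (tmul L M) = tsum (\<lambda>a b. tsum (\<lambda>c d. B (a * c) (b * d)) M) L'"
      unfolding tsum_tmul
      by (rule tsum_cong_eq[OF L]) (rule cbilinear_tsum, rule cbilinear_mult[OF B])
    also have "\<dots> = tsum B (tmul L' M')"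
      unfolding tsum_tmul using tsum_cong_eq[OF M cbilinear_mult(1)[OF B]] by simp
    finally show "tsum B (tmul L M) = tsum B (tmul L' M')" .
  qed
qed

lift_definition one_tensor :: "('a, 'b) tensor" is "[(1, 1)]" .

lift_definition star_tensor :: "('a, 'b) tensor \<Rightarrow> ('a, 'b) tensor"
  is "map (\<lambda>(a, b). (star a, star b))"
proof -
  fix L M :: "('a \<times> 'b) list"
  assume L: "tensor_eq L M"
  show "tensor_eq (map (\<lambda>(a, b). (star a, star b)) L) (map (\<lambda>(a, b). (star a, star b)) M)"
    unfolding tensor_eq_def
  proof (intro allI impI)
    fix B :: "'a \<Rightarrow> 'b \<Rightarrow> complex" assume B: "cbilinear B"
    have "cbilinear (\<lambda>a b. cnj (B (star a) (star b)))"
      using B by (auto simp: cbilinear_def clinear_def star_add star_scaleC scaleC_complex_def)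
    from tsum_cong_eq[OF L this]
    show "tsum B (map (\<lambda>(a, b). (star a, star b)) L) = tsum B (map (\<lambda>(a, b). (star a, star b)) M)"
      by (simp add: tsum_cnj)
  qed
qed

instance
proof
  fix x y z :: "('a, 'b) tensor" and c :: complex
  note defs = tensor_eq_def cbilinear_simps tsum_scaleC tsum_uminus tsum_add tsum_tmul
    tsum_simps(4)[where g = "\<lambda>b. b"]
  show "x * y * z = x * (y * z)" by transfer (simp add: defs mult.assoc)
  show "1 * x = x" by transfer (simp add: defs)
  show "x * 1 = x" by transfer (simp add: defs)
  show "(x + y) * z = x * z + y * z" by transfer (simp add: defs)
  show "x * (y + z) = x * y + x * z" by transfer (simp add: defs)
  show "(c *\<^sub>C x) * y = c *\<^sub>C (x * y)" by transfer (simp add: defs mult_scaleC_left)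
  show "x * (c *\<^sub>C y) = c *\<^sub>C (x * y)" by transfer (simp add: defs mult_scaleC_right)
  show "star (star x) = x" by transfer (simp add: defs star_star del: map_map)
  show "star (x + y) = star x + star y" by transfer (simp add: defs)
  show "star (c *\<^sub>C x) = cnj c *\<^sub>C star x"
    by transfer (simp add: defs star_scaleC del: map_map)
  show "star (x * y) = star y * star x"
  proof (transfer, unfold tensor_eq_def, intro allI impI)
    fix L M :: "('a \<times> 'b) list" and B :: "'a \<Rightarrow> 'b \<Rightarrow> complex"
    show "tsum B (map (\<lambda>(a, b). (star a, star b)) (tmul L M)) =
        tsum B (tmul (map (\<lambda>(a, b). (star a, star b)) M) (map (\<lambda>(a, b). (star a, star b)) L))"
      unfolding tsum_tmul tsum_simps(4) star_mult by (rule tsum_swap)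
  qed
  obtain f :: "'a \<Rightarrow> complex" where f: "clinear f" "f 1 = 1"
    using ex_functional[of "1::'a"] by auto
  obtain g :: "'b \<Rightarrow> complex" where g: "clinear g" "g 1 = 1"
    using ex_functional[of "1::'b"] by auto
  have "cbilinear (\<lambda>a b. f a * g b)"
    using f g by (auto simp: cbilinear_def clinear_def algebra_simps scaleC_complex_def)
  moreover have "tsum (\<lambda>a b. f a * g b) [] \<noteq> tsum (\<lambda>a b. f a * g b) [(1, 1)]"
    using f g by simp
  ultimately show "(0::('a, 'b) tensor) \<noteq> 1"
    by transfer (unfold tensor_eq_def, blast)
qed

end


section \<open>C*-norms and completions\<close>

definition cstar_norm :: "('a::complex_star_algebra \<Rightarrow> real) \<Rightarrow> bool" where
  "cstar_norm N \<longleftrightarrow>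
     (\<forall>a. N a \<ge> 0) \<and> (\<forall>a. N a = 0 \<longleftrightarrow> a = 0) \<and>
     (\<forall>a b. N (a + b) \<le> N a + N b) \<and> (\<forall>c a. N (c *\<^sub>C a) = cmod c * N a) \<and>
     (\<forall>a b. N (a * b) \<le> N a * N b) \<and> (\<forall>a. N (star a * a) = (N a)\<^sup>2)"

definition max_norm :: "'a::complex_star_algebra \<Rightarrow> real" where
  "max_norm a = (SUP N \<in> {N. cstar_norm N}. N a)"

record 'x star_alg =
  sa_carrier :: "'x set"
  sa_add :: "'x \<Rightarrow> 'x \<Rightarrow> 'x"
  sa_scale :: "complex \<Rightarrow> 'x \<Rightarrow> 'x"
  sa_mult :: "'x \<Rightarrow> 'x \<Rightarrow> 'x"
  sa_one :: "'x"
  sa_star :: "'x \<Rightarrow> 'x"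
  sa_norm :: "'x \<Rightarrow> real"

definition sa_hom :: "'x star_alg \<Rightarrow> 'y star_alg \<Rightarrow> ('x \<Rightarrow> 'y) \<Rightarrow> bool" where
  "sa_hom A B f \<longleftrightarrow>
     (\<forall>X\<in>sa_carrier A. f X \<in> sa_carrier B) \<and>
     (\<forall>X\<in>sa_carrier A. \<forall>Y\<in>sa_carrier A. f (sa_add A X Y) = sa_add B (f X) (f Y)) \<and>
     (\<forall>c. \<forall>X\<in>sa_carrier A. f (sa_scale A c X) = sa_scale B c (f X)) \<and>
     (\<forall>X\<in>sa_carrier A. \<forall>Y\<in>sa_carrier A. f (sa_mult A X Y) = sa_mult B (f X) (f Y)) \<and>
     f (sa_one A) = sa_one B \<and>
     (\<forall>X\<in>sa_carrier A. f (sa_star A X) = sa_star B (f X))"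

definition sa_iso :: "'x star_alg \<Rightarrow> 'y star_alg \<Rightarrow> ('x \<Rightarrow> 'y) \<Rightarrow> bool" where
  "sa_iso A B f \<longleftrightarrow> sa_hom A B f \<and> bij_betw f (sa_carrier A) (sa_carrier B)"

definition sa_separable :: "'x star_alg \<Rightarrow> bool" where
  "sa_separable A \<longleftrightarrow> (\<exists>D. countable D \<and> D \<subseteq> sa_carrier A \<and>
     (\<forall>X\<in>sa_carrier A. \<forall>e>0. \<exists>Y\<in>D. sa_norm A (sa_add A X (sa_scale A (-1) Y)) < e))"

definition norm_Cauchy :: "('a::complex_vector \<Rightarrow> real) \<Rightarrow> (nat \<Rightarrow> 'a) \<Rightarrow> bool" where
  "norm_Cauchy N s \<longleftrightarrow> (\<forall>e>0. \<exists>M. \<forall>m\<ge>M. \<forall>n\<ge>M. N (s m - s n) < e)"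

definition cauchy_class :: "('a::complex_vector \<Rightarrow> real) \<Rightarrow> (nat \<Rightarrow> 'a) \<Rightarrow> (nat \<Rightarrow> 'a) set" where
  "cauchy_class N s = {t. norm_Cauchy N t \<and> (\<lambda>n. N (t n - s n)) \<longlonglongrightarrow> 0}"

text \<open>The completion consists of the classes of Cauchy sequences modulo null sequences. In the
  operations, all sets in the unions coincide: they are the class of the termwise operation.\<close>

definition cstar_completion ::
    "('a::complex_star_algebra \<Rightarrow> real) \<Rightarrow> (nat \<Rightarrow> 'a) set star_alg" where
  "cstar_completion N = \<lparr>
     sa_carrier = cauchy_class N ` {s. norm_Cauchy N s},
     sa_add = (\<lambda>X Y. \<Union>s\<in>X. \<Union>t\<in>Y. cauchy_class N (\<lambda>n. s n + t n)),
     sa_scale = (\<lambda>c X. \<Union>s\<in>X. cauchy_class N (\<lambda>n. c *\<^sub>C s n)),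
     sa_mult = (\<lambda>X Y. \<Union>s\<in>X. \<Union>t\<in>Y. cauchy_class N (\<lambda>n. s n * t n)),
     sa_one = cauchy_class N (\<lambda>_. 1),
     sa_star = (\<lambda>X. \<Union>s\<in>X. cauchy_class N (\<lambda>n. star (s n))),
     sa_norm = (\<lambda>X. THE r. \<exists>s\<in>X. (\<lambda>n. N (s n)) \<longlonglongrightarrow> r) \<rparr>"

definition emb :: "('a::complex_star_algebra \<Rightarrow> real) \<Rightarrow> 'a \<Rightarrow> (nat \<Rightarrow> 'a) set" where
  "emb N a = cauchy_class N (\<lambda>_. a)"

text \<open>For C*-norms \<open>N' \<le> N\<close>: the extension by continuity of the identity map to a map from the
  completion in \<open>N\<close> to the completion in \<open>N'\<close>.\<close>

definition canonical_map :: "('a::complex_star_algebra \<Rightarrow> real) \<Rightarrow> ('a \<Rightarrow> real) \<Rightarrow>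
    (nat \<Rightarrow> 'a) set \<Rightarrow> (nat \<Rightarrow> 'a) set" where
  "canonical_map N N' X = (\<Union>s\<in>X. cauchy_class N' s)"

definition canonical_iso :: "('a::complex_star_algebra \<Rightarrow> real) \<Rightarrow> ('a \<Rightarrow> real) \<Rightarrow> bool" where
  "canonical_iso N N' \<longleftrightarrow> sa_iso (cstar_completion N) (cstar_completion N') (canonical_map N N')"


section \<open>Representations on separable Hilbert spaces\<close>

text \<open>Every separable Hilbert space is unitarily equivalent to \<open>\<ell>\<^sup>2(I)\<close> for some set \<open>I\<close> of
  natural numbers. Elements of \<open>\<ell>\<^sup>2(I)\<close> are extended by \<open>0\<close> outside \<open>I\<close>.\<close>

definition ell2 :: "'k set \<Rightarrow> ('k \<Rightarrow> complex) set" where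
  "ell2 I = {x. (\<forall>i. i \<notin> I \<longrightarrow> x i = 0) \<and> (\<lambda>i. (cmod (x i))\<^sup>2) summable_on UNIV}"

definition l2_inner :: "('k \<Rightarrow> complex) \<Rightarrow> ('k \<Rightarrow> complex) \<Rightarrow> complex" where
  "l2_inner x y = (\<Sum>\<^sub>\<infinity>i. x i * cnj (y i))"

definition l2_norm :: "('k \<Rightarrow> complex) \<Rightarrow> real" where
  "l2_norm x = sqrt (\<Sum>\<^sub>\<infinity>i. (cmod (x i))\<^sup>2)"

definition bounded_op :: "'k set \<Rightarrow> (('k \<Rightarrow> complex) \<Rightarrow> 'k \<Rightarrow> complex) \<Rightarrow> bool" where
  "bounded_op I T \<longleftrightarrow>
     (\<forall>x\<in>ell2 I. T x \<in> ell2 I) \<and>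
     (\<forall>x\<in>ell2 I. \<forall>y\<in>ell2 I. T (\<lambda>i. x i + y i) = (\<lambda>i. T x i + T y i)) \<and>
     (\<forall>c. \<forall>x\<in>ell2 I. T (\<lambda>i. c * x i) = (\<lambda>i. c * T x i)) \<and>
     (\<exists>K. \<forall>x\<in>ell2 I. l2_norm (T x) \<le> K * l2_norm x)"

definition sa_rep ::
    "'x star_alg \<Rightarrow> 'k set \<Rightarrow> ('x \<Rightarrow> ('k \<Rightarrow> complex) \<Rightarrow> 'k \<Rightarrow> complex) \<Rightarrow> bool" where
  "sa_rep A I \<pi> \<longleftrightarrow>
     (\<forall>X\<in>sa_carrier A. bounded_op I (\<pi> X)) \<and>
     (\<forall>X\<in>sa_carrier A. \<forall>Y\<in>sa_carrier A. \<forall>x\<in>ell2 I. \<pi> (sa_add A X Y) x = (\<lambda>i. \<pi> X x i + \<pi> Y x i)) \<and>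
     (\<forall>c. \<forall>X\<in>sa_carrier A. \<forall>x\<in>ell2 I. \<pi> (sa_scale A c X) x = (\<lambda>i. c * \<pi> X x i)) \<and>
     (\<forall>X\<in>sa_carrier A. \<forall>Y\<in>sa_carrier A. \<forall>x\<in>ell2 I. \<pi> (sa_mult A X Y) x = \<pi> X (\<pi> Y x)) \<and>
     (\<forall>x\<in>ell2 I. \<pi> (sa_one A) x = x) \<and>
     (\<forall>X\<in>sa_carrier A. \<forall>x\<in>ell2 I. \<forall>y\<in>ell2 I. l2_inner (\<pi> X x) y = l2_inner x (\<pi> (sa_star A X) y))"

text \<open>Let \<open>A\<close> be the completion in \<open>N\<close>. The spatial norm on the algebraic tensor square of \<open>A\<close>,
  restricted to the tensor square of the dense subalgebra, is the supremum over pairs of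
  representations of \<open>A\<close> of the operator norm of \<open>(\<pi>\<^sub>1 \<otimes> \<pi>\<^sub>2)(t)\<close>. The latter acts on
  \<open>\<ell>\<^sup>2(I) \<otimes> \<ell>\<^sup>2(J) = \<ell>\<^sup>2(I \<times> J)\<close>, and its norm is computed on the dense subspace of vectors
  \<open>\<Sum> x\<^sub>k \<otimes> y\<^sub>k\<close>, represented by the list \<open>z\<close> of the pairs \<open>(x\<^sub>k, y\<^sub>k)\<close>. Since the algebraic tensor
  square of the dense subalgebra is dense in the spatial tensor product, completing it yields the
  latter.\<close>

definition spatial_norm ::
    "('a::complex_star_algebra \<Rightarrow> real) \<Rightarrow> ('a, 'a) tensor \<Rightarrow> real" where
  "spatial_norm N t = Sup {r. \<exists>(I::nat set) (J::nat set) \<pi>\<^sub>1 \<pi>\<^sub>2 z.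
     sa_rep (cstar_completion N) I \<pi>\<^sub>1 \<and> sa_rep (cstar_completion N) J \<pi>\<^sub>2 \<and>
     set z \<subseteq> ell2 I \<times> ell2 J \<and> l2_norm (\<lambda>(m, n). \<Sum>(x, y)\<leftarrow>z. x m * y n) \<le> 1 \<and>
     r = l2_norm (\<lambda>(m, n). tensor_lift
           (\<lambda>a b. \<Sum>(x, y)\<leftarrow>z. \<pi>\<^sub>1 (emb N a) x m * \<pi>\<^sub>2 (emb N b) y n) t)}"


section \<open>Compact quantum groups\<close>

text \<open>The type \<open>'a\<close> is the *-algebra \<open>Pol(\<bbbG>)\<close>; \<open>umat G \<alpha> i j\<close> (with \<open>i, j < irrdim G \<alpha>\<close>) are the
  matrix elements of the chosen unitary representative of \<open>\<alpha>\<close>. A representative is determined by its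
  entries, so \<open>irr\<close> is just an index set for the classes. The Haar state is determined by the rest of
  the structure.\<close>

record (overloaded) ('a::complex_star_algebra, 'i) cqg =
  comult :: "'a \<Rightarrow> ('a, 'a) tensor"
  counit :: "'a \<Rightarrow> complex"
  antipode :: "'a \<Rightarrow> 'a"
  haar :: "'a \<Rightarrow> complex"
  irr :: "'i set"
  irrdim :: "'i \<Rightarrow> nat"
  umat :: "'i \<Rightarrow> nat \<Rightarrow> nat \<Rightarrow> 'a"

text \<open>In the coassociativity axiom, \<open>(id \<otimes> \<Delta>)\<Delta>\<close> is composed with the canonical identification of
  \<open>V \<otimes> (V \<otimes> V)\<close> with \<open>(V \<otimes> V) \<otimes> V\<close>.\<close>

definition hopf_star_algebra :: "('a::complex_star_algebra, 'i) cqg \<Rightarrow> bool" where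
  "hopf_star_algebra G \<longleftrightarrow>
     star_hom (comult G) \<and> star_hom (counit G) \<and> clinear (antipode G) \<and>
     (\<forall>a. tensor_lift (\<lambda>x y. comult G x \<otimes>\<^sub>C y) (comult G a) =
          tensor_lift (\<lambda>x y. tensor_lift (\<lambda>y' y''. (x \<otimes>\<^sub>C y') \<otimes>\<^sub>C y'') (comult G y)) (comult G a)) \<and>
     (\<forall>a. tensor_lift (\<lambda>x y. counit G x *\<^sub>C y) (comult G a) = a) \<and>
     (\<forall>a. tensor_lift (\<lambda>x y. counit G y *\<^sub>C x) (comult G a) = a) \<and>
     (\<forall>a. tensor_lift (\<lambda>x y. antipode G x * y) (comult G a) = counit G a *\<^sub>C 1) \<and>
     (\<forall>a. tensor_lift (\<lambda>x y. x * antipode G y) (comult G a) = counit G a *\<^sub>C 1)"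

definition haar_state :: "('a::complex_star_algebra, 'i) cqg \<Rightarrow> ('a \<Rightarrow> complex) \<Rightarrow> bool" where
  "haar_state G h \<longleftrightarrow>
     clinear h \<and> h 1 = 1 \<and> (\<forall>a. h (star a * a) \<in> \<real>\<^sub>\<ge>\<^sub>0) \<and>
     (\<forall>a. tensor_lift (\<lambda>x y. h x *\<^sub>C y) (comult G a) = h a *\<^sub>C 1) \<and>
     (\<forall>a. tensor_lift (\<lambda>x y. h y *\<^sub>C x) (comult G a) = h a *\<^sub>C 1)"

definition unitary_corep ::
    "('a::complex_star_algebra, 'i) cqg \<Rightarrow> nat \<Rightarrow> (nat \<Rightarrow> nat \<Rightarrow> 'a) \<Rightarrow> bool" where
  "unitary_corep G n v \<longleftrightarrow>
     (\<forall>i<n. \<forall>j<n. comult G (v i j) = (\<Sum>k<n. v i k \<otimes>\<^sub>C v k j)) \<and>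
     (\<forall>i<n. \<forall>j<n. (\<Sum>k<n. star (v k i) * v k j) = (if i = j then 1 else 0)) \<and>
     (\<forall>i<n. \<forall>j<n. (\<Sum>k<n. v i k * star (v j k)) = (if i = j then 1 else 0))"

definition cvec :: "nat \<Rightarrow> (nat \<Rightarrow> complex) set" where
  "cvec n = {x. \<forall>i\<ge>n. x i = 0}"

definition cvec_subspace :: "nat \<Rightarrow> (nat \<Rightarrow> complex) set \<Rightarrow> bool" where
  "cvec_subspace n W \<longleftrightarrow> W \<subseteq> cvec n \<and> (\<lambda>_. 0) \<in> W \<and>
     (\<forall>x\<in>W. \<forall>y\<in>W. (\<lambda>i. x i + y i) \<in> W) \<and> (\<forall>c. \<forall>x\<in>W. (\<lambda>i. c * x i) \<in> W)"

text \<open>\<open>v(W \<otimes> 1) \<subseteq> W \<otimes> Pol(\<bbbG>)\<close>, tested by slicing the second leg with linear functionals.\<close>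

definition corep_invariant ::
    "nat \<Rightarrow> (nat \<Rightarrow> nat \<Rightarrow> 'a::complex_star_algebra) \<Rightarrow> (nat \<Rightarrow> complex) set \<Rightarrow> bool" where
  "corep_invariant n v W \<longleftrightarrow> (\<forall>f :: 'a \<Rightarrow> complex. clinear f \<longrightarrow>
     (\<forall>x\<in>W. (\<lambda>i. if i < n then \<Sum>j<n. f (v i j) * x j else 0) \<in> W))"

definition irreducible_corep :: "nat \<Rightarrow> (nat \<Rightarrow> nat \<Rightarrow> 'a::complex_star_algebra) \<Rightarrow> bool" where
  "irreducible_corep n v \<longleftrightarrow> n > 0 \<and>
     (\<forall>W. cvec_subspace n W \<and> corep_invariant n v W \<longrightarrow> W = {\<lambda>_. 0} \<or> W = cvec n)"

definition equivalent_corep :: "nat \<Rightarrow> (nat \<Rightarrow> nat \<Rightarrow> 'a::complex_star_algebra) \<Rightarrow>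
    nat \<Rightarrow> (nat \<Rightarrow> nat \<Rightarrow> 'a) \<Rightarrow> bool" where
  "equivalent_corep n v m w \<longleftrightarrow> n = m \<and> (\<exists>T T' :: nat \<Rightarrow> nat \<Rightarrow> complex.
     (\<forall>i<n. \<forall>j<n. (\<Sum>k<n. T i k * T' k j) = (if i = j then 1 else 0)) \<and>
     (\<forall>i<n. \<forall>j<n. (\<Sum>k<n. T' i k * T k j) = (if i = j then 1 else 0)) \<and>
     (\<forall>i<n. \<forall>j<n. (\<Sum>k<n. T i k *\<^sub>C v k j) = (\<Sum>k<n. T k j *\<^sub>C w i k)))"

text \<open>Finite-dimensional corepresentations of a compact quantum group are unitarizable, so
  unitary ones suffice in the spanning condition.\<close>

definition compact_quantum_group :: "('a::complex_star_algebra, 'i) cqg \<Rightarrow> bool" where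
  "compact_quantum_group G \<longleftrightarrow>
     hopf_star_algebra G \<and> haar_state G (haar G) \<and>
     (\<forall>a. a \<in> module.span scaleC {v i j | n v i j. unitary_corep G n v \<and> i < n \<and> j < n}) \<and>
     (\<forall>\<alpha>\<in>irr G. unitary_corep G (irrdim G \<alpha>) (umat G \<alpha>) \<and>
                irreducible_corep (irrdim G \<alpha>) (umat G \<alpha>)) \<and>
     (\<forall>\<alpha>\<in>irr G. \<forall>\<beta>\<in>irr G.
        equivalent_corep (irrdim G \<alpha>) (umat G \<alpha>) (irrdim G \<beta>) (umat G \<beta>) \<longrightarrow> \<alpha> = \<beta>) \<and>
     (\<forall>n v. unitary_corep G n v \<and> irreducible_corep n v \<longrightarrow>
        (\<exists>\<alpha>\<in>irr G. equivalent_corep n v (irrdim G \<alpha>) (umat G \<alpha>)))"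

definition quantum_group_norm ::
    "('a::complex_star_algebra, 'i) cqg \<Rightarrow> ('a \<Rightarrow> real) \<Rightarrow> bool" where
  "quantum_group_norm G N \<longleftrightarrow> cstar_norm N \<and>
     (\<exists>\<Phi>. sa_hom (cstar_completion N) (cstar_completion (spatial_norm N)) \<Phi> \<and>
          (\<forall>a. \<Phi> (emb N a) = emb (spatial_norm N) (comult G a)))"

definition L2_norm :: "('a::complex_star_algebra, 'i) cqg \<Rightarrow> 'a \<Rightarrow> real" where
  "L2_norm G a = sqrt (Re (haar G (star a * a)))"

text \<open>The operator norm of left multiplication on \<open>L\<^sup>2(\<bbbG>)\<close>, in which \<open>Pol(\<bbbG>)\<close> is dense.\<close>

definition red_norm :: "('a::complex_star_algebra, 'i) cqg \<Rightarrow> 'a \<Rightarrow> real" where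
  "red_norm G a = (SUP b \<in> {b. L2_norm G b \<le> 1}. L2_norm G (a * b))"

definition coamenable :: "('a::complex_star_algebra, 'i) cqg \<Rightarrow> bool" where
  "coamenable G \<longleftrightarrow> canonical_iso (max_norm :: 'a \<Rightarrow> real) (red_norm G)"

text \<open>Adjoining the neutral element to the completion in \<open>N\<close>.\<close>

definition tilde_norm ::
    "('a::complex_star_algebra, 'i) cqg \<Rightarrow> ('a \<Rightarrow> real) \<Rightarrow> 'a \<Rightarrow> real" where
  "tilde_norm G N a = max (N a) (cmod (counit G a))"


section \<open>Property (T) of the discrete dual\<close>

text \<open>The norm of \<open>\<Sum> \<eta>\<^sub>k \<otimes> \<xi>\<^sub>k\<close> in \<open>L\<^sup>2(\<bbbG>) \<otimes> \<ell>\<^sup>2\<close>, the sum being represented by the list of the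
  pairs \<open>(\<eta>\<^sub>k, \<xi>\<^sub>k)\<close>.\<close>

definition L2_tensor_norm ::
    "('a::complex_star_algebra, 'i) cqg \<Rightarrow> ('a \<times> ('k \<Rightarrow> complex)) list \<Rightarrow> real" where
  "L2_tensor_norm G L =
     sqrt (Re (\<Sum>(a, x)\<leftarrow>L. \<Sum>(b, y)\<leftarrow>L. haar G (star b * a) * l2_inner x y))"

text \<open>Elements of \<open>H\<^sup>\<alpha>\<close> are given by their coefficients \<open>c\<close> with respect to \<open>u\<^sup>\<alpha>\<^sub>r\<^sub>,\<^sub>l\<close>.\<close>

definition H_elem ::
    "('a::complex_star_algebra, 'i) cqg \<Rightarrow> 'i \<Rightarrow> (nat \<Rightarrow> nat \<Rightarrow> complex) \<Rightarrow> 'a" where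
  "H_elem G \<alpha> c = (\<Sum>r<irrdim G \<alpha>. \<Sum>l<irrdim G \<alpha>. c r l *\<^sub>C umat G \<alpha> r l)"

text \<open>\<open>e\<^sup>\<alpha>\<^sub>i\<^sub>,\<^sub>j \<eta>\<close> for \<open>\<eta> = H_elem G \<alpha> c\<close>, by the rule \<open>e\<^sup>\<alpha>\<^sub>i\<^sub>,\<^sub>j u\<^sup>\<alpha>\<^sub>r\<^sub>,\<^sub>l = \<delta>\<^sub>j\<^sub>,\<^sub>l u\<^sup>\<alpha>\<^sub>r\<^sub>,\<^sub>i\<close>.\<close>

definition matrix_unit_act ::
    "('a::complex_star_algebra, 'i) cqg \<Rightarrow> 'i \<Rightarrow> nat \<Rightarrow> nat \<Rightarrow> (nat \<Rightarrow> nat \<Rightarrow> complex) \<Rightarrow> 'a" where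
  "matrix_unit_act G \<alpha> i j c = (\<Sum>r<irrdim G \<alpha>. c r j *\<^sub>C umat G \<alpha> r i)"

text \<open>\<open>V\<^sup>\<alpha>(\<eta> \<otimes> \<xi>) - \<eta> \<otimes> \<xi>\<close> for \<open>\<eta> = H_elem G \<alpha> c\<close>, where
  \<open>V\<^sup>\<alpha> = \<Sum>\<^sub>i\<^sub>,\<^sub>j e\<^sup>\<alpha>\<^sub>i\<^sub>,\<^sub>j \<otimes> \<pi>(u\<^sup>\<alpha>\<^sub>i\<^sub>,\<^sub>j)\<close>.\<close>

definition displacement ::
    "('a::complex_star_algebra, 'i) cqg \<Rightarrow> ((nat \<Rightarrow> 'a) set \<Rightarrow> ('k \<Rightarrow> complex) \<Rightarrow> 'k \<Rightarrow> complex) \<Rightarrow>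
     'i \<Rightarrow> (nat \<Rightarrow> nat \<Rightarrow> complex) \<Rightarrow> ('k \<Rightarrow> complex) \<Rightarrow> ('a \<times> ('k \<Rightarrow> complex)) list" where
  "displacement G \<pi> \<alpha> c \<xi> =
     [(matrix_unit_act G \<alpha> i j c, \<pi> (emb max_norm (umat G \<alpha> i j)) \<xi>).
        i \<leftarrow> [0..<irrdim G \<alpha>], j \<leftarrow> [0..<irrdim G \<alpha>]] @ [(- H_elem G \<alpha> c, \<xi>)]"

definition almost_invariant_vectors ::
    "('a::complex_star_algebra, 'i) cqg \<Rightarrow> 'k set \<Rightarrow>
     ((nat \<Rightarrow> 'a) set \<Rightarrow> ('k \<Rightarrow> complex) \<Rightarrow> 'k \<Rightarrow> complex) \<Rightarrow> bool" where
  "almost_invariant_vectors G I \<pi> \<longleftrightarrow>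
     (\<forall>E \<delta>. finite E \<and> E \<subseteq> irr G \<and> \<delta> > 0 \<longrightarrow>
        (\<exists>\<xi>\<in>ell2 I. \<forall>\<alpha>\<in>E. \<forall>c. H_elem G \<alpha> c \<noteq> 0 \<longrightarrow>
           L2_tensor_norm G (displacement G \<pi> \<alpha> c \<xi>) < \<delta> * L2_norm G (H_elem G \<alpha> c) * l2_norm \<xi>))"

definition invariant_vector ::
    "('a::complex_star_algebra, 'i) cqg \<Rightarrow> ((nat \<Rightarrow> 'a) set \<Rightarrow> ('k \<Rightarrow> complex) \<Rightarrow> 'k \<Rightarrow> complex) \<Rightarrow>
     ('k \<Rightarrow> complex) \<Rightarrow> bool" where
  "invariant_vector G \<pi> \<xi> \<longleftrightarrow>
     (\<forall>\<alpha>\<in>irr G. \<forall>c. L2_tensor_norm G (displacement G \<pi> \<alpha> c \<xi>) = 0)"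

definition dual_property_T :: "('a::complex_star_algebra, 'i) cqg \<Rightarrow> bool" where
  "dual_property_T G \<longleftrightarrow>
     (\<forall>(I::nat set) \<pi>. sa_rep (cstar_completion max_norm) I \<pi> \<and> almost_invariant_vectors G I \<pi> \<longrightarrow>
        (\<exists>\<xi>\<in>ell2 I. \<xi> \<noteq> (\<lambda>_. 0) \<and> invariant_vector G \<pi> \<xi>))"

end

theory Submission
  imports Defs "HOL-Library.Function_Algebras"
begin

text \<open>
  Let \<open>\<epsilon>\<close> be the counit and \<open>N\<close> a C*-norm on \<open>Pol(\<bbbG>)\<close>. The canonical map from the completion in
  \<open>max N |\<epsilon>|\<close> to the completion in \<open>N\<close> is an isomorphism exactly when \<open>\<epsilon>\<close> is \<open>N\<close>-bounded
  (\<open>tilde_iso_of_bounded_counit\<close>, \<open>bounded_counit_of_tilde_iso\<close>). If \<open>\<epsilon>\<close> is unbounded, some \<open>a\<^sub>n\<close>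
  satisfy \<open>\<epsilon>(a\<^sub>n) = 1\<close> and \<open>N(a\<^sub>n) \<rightarrow> 0\<close>; they converge in the completion in \<open>max N |\<epsilon>|\<close> to an element
  \<open>p\<close> with \<open>a p = \<epsilon>(a) p\<close> and \<open>\<epsilon>(p) = 1\<close>, the projection onto the summand of that completion on
  which \<open>\<epsilon>\<close> lives. If this completion is the maximal one, then \<open>p\<close> is a Kazhdan projection
  (\<open>kazhdan_sequence\<close>): in a representation \<open>\<pi>\<close> with almost invariant vectors \<open>\<xi>\<close>, the vector \<open>\<pi>(p)\<xi>\<close>
  is invariant, and it is close to \<open>\<epsilon>(p)\<xi> = \<xi>\<close>, hence non-zero. This is property (T)
  (\<open>property_T_of_unbounded_counit\<close>), and it gives the first statement.

  For the second statement let \<open>N\<close> be the reduced norm. What is needed besides is that a bounded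
  counit forces co-amenability (\<open>coamenable_of_bounded_counit\<close>); then the counit is unbounded, the
  second canonical map is no isomorphism, and neither is the first one, by the argument above. If
  \<open>\<epsilon>\<close> is bounded on the reduced algebra, there are unit vectors \<open>\<xi>\<close> in \<open>Pol(\<bbbG>) \<subseteq> L\<^sup>2(\<bbbG>)\<close> with
  \<open>a \<xi> \<approx> \<epsilon>(a) \<xi>\<close> for finitely many \<open>a\<close> (\<open>almost_invariant_in_L2\<close>). The completely positive map
  \<open>E(c) = \<Sum> h(\<xi>\<^sup>* c\<^sub>1 \<xi>) c\<^sub>2\<close> then nearly fixes \<open>c\<close>, and by Fell absorption it is bounded from the reduced norm
  to any C*-norm, a priori with a constant that depends on \<open>\<xi>\<close>. This is enough to transport
  positivity, and a positive unital map has norm at most \<open>2\<close>. So every C*-norm is at most twice the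
  reduced one.

  The C*-theory behind this is developed on the dense *-algebra itself, without passing to the
  completion: the order is described by \<open>\<parallel>t - h\<parallel> \<le> t\<close>, square roots are truncated binomial series,
  and the central fact is \<open>pos_star_mult\<close>, the positivity of \<open>a\<^sup>* a\<close>. It is used for the finiteness
  of the maximal norm, too. On the side of the quantum group, the spanning of \<open>Pol(\<bbbG>)\<close> by the matrix
  elements of irreducible corepresentations (\<open>Pol_span\<close>) links almost invariance, which speaks of
  irreducible corepresentations only, with elements of \<open>Pol(\<bbbG>)\<close>, and the faithfulness of the Haar
  state (\<open>haar_faithful\<close>) makes the reduced norm a norm.
\<close>

section \<open>Positivity in *-algebras with a C*-norm\<close>

interpretation CV: vector_space "scaleC :: complex \<Rightarrow> 'a::complex_vector \<Rightarrow> 'a"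
  by (rule vector_space_scaleC)

lemmas alg_simps = algebra_simps mult_scaleC_left mult_scaleC_right scaleC_scaleC
  scaleC_add_right scaleC_add_left CV.scale_right_diff_distrib CV.scale_left_diff_distrib

lemma star_one [simp]: "star 1 = (1::'a::complex_star_algebra)"
  by (metis mult_1_left mult_1_right star_mult star_star)

lemma star_zero [simp]: "star 0 = (0::'a::complex_star_algebra)"
  by (metis add_cancel_right_right star_add)

lemma star_minus: "star (- x) = - star (x::'a::complex_star_algebra)"
  by (metis add.right_inverse add_eq_0_iff star_add star_zero)

lemma star_diff: "star (x - y) = star x - star (y::'a::complex_star_algebra)"
  using star_add[of x "- y"] by (simp add: star_minus)

lemma star_sum: "star (sum f A) = (\<Sum>i\<in>A. star (f i :: 'a::complex_star_algebra))"
  by (induction A rule: infinite_finite_induct) (auto simp: star_add)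

lemma star_power: "star (x ^ n) = star (x::'a::complex_star_algebra) ^ n"
  by (induction n) (auto simp: star_mult power_commutes)

lemmas star_simps = star_add star_diff star_minus star_mult star_scaleC star_star star_power

text \<open>The Taylor coefficients of \<open>\<surd>(1 - x)\<close> at \<open>0\<close>.\<close>

definition sqrt_coeff :: "nat \<Rightarrow> real" where
  "sqrt_coeff k = (- 1) ^ k * ((1 / 2) gchoose k)"

lemma sqrt_coeff_le_1: "\<bar>sqrt_coeff k\<bar> \<le> 1"
proof -
  have "\<bar>(1 / 2 :: real) gchoose k\<bar> \<le> 1"
  proof (induction k)
    case (Suc k)
    have "\<bar>(1 / 2 - real k) / real (Suc k)\<bar> \<le> 1"
      by (simp add: field_simps abs_if)
    from mult_mono[OF Suc this] have
      "\<bar>(1 / 2 :: real) gchoose k\<bar> * \<bar>(1 / 2 - real k) / real (Suc k)\<bar> \<le> 1" by simp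
    moreover have "(1 / 2 :: real) gchoose (Suc k) = ((1 / 2) gchoose k) * ((1 / 2 - real k) / real (Suc k))"
    proof -
      have "real (Suc k) * ((1 / 2 :: real) gchoose (Suc k)) = (1 / 2 - real k) * ((1 / 2) gchoose k)"
        by (simp only: gbinomial_absorb_comp gbinomial_absorption)
      hence "(1 / 2 :: real) gchoose (Suc k) = (1 / 2 - real k) * ((1 / 2) gchoose k) / real (Suc k)"
        by (simp only: nonzero_eq_divide_eq of_nat_eq_0_iff nat.simps mult.commute not_False_eq_True)
      thus ?thesis by (simp add: mult.commute)
    qed
    ultimately show ?case by (simp add: abs_mult)
  qed simp
  thus ?thesis by (simp add: sqrt_coeff_def abs_mult power_abs)
qed

lemma sqrt_coeff_conv:
  "(\<Sum>i\<le>k. sqrt_coeff i * sqrt_coeff (k - i)) = (if k = 0 then 1 else if k = 1 then - 1 else 0)"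
proof -
  have "(\<Sum>i\<le>k. sqrt_coeff i * sqrt_coeff (k - i)) =
      (- 1) ^ k * (\<Sum>i\<le>k. ((1 / 2) gchoose i) * ((1 / 2) gchoose (k - i)))"
    unfolding sum_distrib_left
  proof (rule sum.cong[OF refl])
    fix i assume "i \<in> {..k}"
    hence "(- 1 :: real) ^ i * (- 1) ^ (k - i) = (- 1) ^ k" by (simp flip: power_add)
    thus "sqrt_coeff i * sqrt_coeff (k - i) = (- 1) ^ k * ((1 / 2 gchoose i) * (1 / 2 gchoose (k - i)))"
      by (simp add: sqrt_coeff_def mult.assoc mult.left_commute)
  qed
  also have "(\<Sum>i\<le>k. ((1 / 2 :: real) gchoose i) * ((1 / 2) gchoose (k - i))) = 1 gchoose k"
    using gbinomial_Vandermonde[of "1 / 2 :: real" "1 / 2" k] by (simp add: atMost_atLeast0)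
  also have "\<dots> = of_nat (1 choose k)"
    using binomial_gbinomial[of 1 k, where ?'a = real] by simp
  also have "(- 1) ^ k * real (1 choose k) = (if k = 0 then 1 else if k = 1 then - 1 else 0)"
    by (cases k; cases "k - 1") (auto simp: binomial_eq_0)
  finally show ?thesis .
qed

definition sqrt_poly :: "nat \<Rightarrow> 'a::complex_star_algebra \<Rightarrow> 'a" where
  "sqrt_poly m g = (\<Sum>k\<le>m. of_real (sqrt_coeff k) *\<^sub>C g ^ k)"

lemma star_sqrt_poly: "star (sqrt_poly m g) = sqrt_poly m (star g)"
  by (simp add: sqrt_poly_def star_sum star_simps)

lemma sqrt_poly_commute:
  assumes "z * g = g * z"
  shows "z * sqrt_poly m g = sqrt_poly m g * z"
proof -
  have "z * g ^ k = g ^ k * z" for k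
    by (metis assms power_commuting_commutes)
  thus ?thesis
    by (simp add: sqrt_poly_def sum_distrib_left sum_distrib_right mult_scaleC_left mult_scaleC_right)
qed

text \<open>The coefficients convolve to those of \<open>1 - x\<close>, so only the products of total degree above \<open>m\<close>
  remain. Their number is polynomial in \<open>m\<close>, which makes the error small when \<open>\<parallel>g\<parallel> < 1\<close>.\<close>

lemma sqrt_poly_square:
  assumes "m \<ge> 1"
  shows "sqrt_poly m g * sqrt_poly m g - (1 - g) =
    (\<Sum>(i, j)\<in>{(i, j). i \<le> m \<and> j \<le> m \<and> m < i + j}.
      of_real (sqrt_coeff i * sqrt_coeff j) *\<^sub>C g ^ (i + j))"
    (is "_ = sum ?f ?R")
proof -
  have fin: "finite ?R" "finite {(i, j). i + j \<le> m}"
    by (rule finite_subset[of _ "{..m} \<times> {..m}"]; auto)+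
  have "sqrt_poly m g * sqrt_poly m g = (\<Sum>i\<le>m. \<Sum>j\<le>m. ?f (i, j))"
    by (simp add: sqrt_poly_def sum_product mult_scaleC_left mult_scaleC_right scaleC_scaleC power_add
      mult.commute[of "of_real _ :: complex" "of_real _"])
  also have "\<dots> = sum ?f ({..m} \<times> {..m})"
    by (simp add: sum.cartesian_product)
  also have "{..m} \<times> {..m} = ?R \<union> {(i, j). i + j \<le> m}" by auto
  also have "sum ?f \<dots> = sum ?f ?R + sum ?f {(i, j). i + j \<le> m}"
    by (rule sum.union_disjoint) (use fin in auto)
  also have "sum ?f {(i, j). i + j \<le> m} =
      (\<Sum>k\<le>m. \<Sum>i\<le>k. of_real (sqrt_coeff i * sqrt_coeff (k - i)) *\<^sub>C g ^ (i + (k - i)))"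
    by (rule sum.triangle_reindex_eq)
  also have "\<dots> = (\<Sum>k\<le>m. of_real (\<Sum>i\<le>k. sqrt_coeff i * sqrt_coeff (k - i)) *\<^sub>C g ^ k)"
    by (simp add: of_real_sum CV.scale_sum_left)
  also have "\<dots> = (\<Sum>k\<le>m. (if k = 0 then 1 else if k = 1 then - g else 0))"
    by (intro sum.cong) (auto simp: sqrt_coeff_conv scaleC_one)
  also have "\<dots> = (\<Sum>k\<in>{0, 1::nat}. (if k = 0 then 1 else if k = 1 then - g else 0))"
    by (rule sum.mono_neutral_right) (use assms in auto)
  also have "\<dots> = 1 - g" by simp
  finally show ?thesis by simp
qed

lemma power_sandwich: "y ^ m * (1 - y) * y ^ m = y ^ (2 * m) - y ^ (2 * m + 1)"
  for y :: "'a::ring_1"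
proof -
  have "y ^ m * (y * y ^ m) = y ^ (2 * m + 1)" "y ^ m * y ^ m = y ^ (2 * m)"
    by (simp_all flip: power_add power_Suc add: mult_2)
  thus ?thesis by (simp add: left_diff_distrib right_diff_distrib mult.assoc)
qed

locale cstar_normed =
  fixes N :: "'a::complex_star_algebra \<Rightarrow> real"
  assumes cstar: "cstar_norm N"
begin

lemma N_nonneg [simp]: "N a \<ge> 0"
  and N_eq_0 [simp]: "N a = 0 \<longleftrightarrow> a = 0"
  and N_add: "N (a + b) \<le> N a + N b"
  and N_scaleC: "N (c *\<^sub>C a) = cmod c * N a"
  and N_mult: "N (a * b) \<le> N a * N b"
  and N_star_mult: "N (star a * a) = (N a)\<^sup>2"
  using cstar by (simp_all add: cstar_norm_def)

lemma N_zero [simp]: "N 0 = 0" by simp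

lemma N_minus: "N (- a) = N a"
  using N_scaleC[of "- 1" a] by (simp add: scaleC_one)

lemma N_minus_commute: "N (a - b) = N (b - a)"
  using N_minus[of "a - b"] by simp

lemma N_diff: "N (a - b) \<le> N a + N b"
  using N_add[of a "- b"] by (simp add: N_minus)

lemma N_diff_triangle: "N (a - c) \<le> N (a - b) + N (b - c)"
  using N_add[of "a - b" "b - c"] by simp

lemma N_diff_le: "N a \<le> N b + N (a - b)"
  using N_add[of b "a - b"] by simp

lemma N_star [simp]: "N (star a) = N a"
proof -
  have le: "N a \<le> N (star a)" for a
  proof (cases "N a = 0")
    case False
    have "N a * N a \<le> N (star a) * N a"
      using N_star_mult[of a] N_mult[of "star a" a] by (simp add: power2_eq_square)
    with False show ?thesis
      by (metis N_nonneg mult_le_cancel_right order_le_less not_less)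
  qed (metis N_nonneg)
  show ?thesis using le[of a] le[of "star a"] by (simp add: star_star)
qed

lemma N_one [simp]: "N 1 = 1"
  using N_star_mult[of 1] N_eq_0[of 1] by (simp add: power2_eq_square)

lemma N_sum: "N (sum f A) \<le> (\<Sum>i\<in>A. N (f i))"
proof (induction A rule: infinite_finite_induct)
  case (insert x F)
  thus ?case using N_add[of "f x" "sum f F"] by simp
qed auto

lemma N_power: "N (a ^ n) \<le> N a ^ n"
proof (induction n)
  case (Suc n)
  have "N (a ^ Suc n) \<le> N a * N (a ^ n)" using N_mult[of a "a ^ n"] by simp
  also have "\<dots> \<le> N a * N a ^ n" by (rule mult_left_mono[OF Suc]) simp
  finally show ?case by simp
qed simp

lemma N_sa_square: "star h = h \<Longrightarrow> N (h * h) = (N h)\<^sup>2"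
  using N_star_mult[of h] by simp

lemma N_sqrt_poly_square:
  assumes "m \<ge> 1" "N g \<le> r" "r \<le> 1"
  shows "N (sqrt_poly m g * sqrt_poly m g - (1 - g)) \<le> (real m + 1)\<^sup>2 * r ^ m"
proof -
  have r0: "0 \<le> r" using assms(2) N_nonneg order_trans by blast
  let ?R = "{(i, j). i \<le> m \<and> j \<le> m \<and> m < i + j}"
  have sub: "?R \<subseteq> {..m} \<times> {..m}" by auto
  have "N (sqrt_poly m g * sqrt_poly m g - (1 - g)) \<le>
      (\<Sum>p\<in>?R. N ((\<lambda>(i, j). of_real (sqrt_coeff i * sqrt_coeff j) *\<^sub>C g ^ (i + j)) p))"
    unfolding sqrt_poly_square[OF assms(1)] by (rule N_sum)
  also have "\<dots> \<le> (\<Sum>p\<in>?R. r ^ m)"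
  proof (rule sum_mono, clarify)
    fix i j assume ij: "i \<le> m" "j \<le> m" "m < i + j"
    have "N (of_real (sqrt_coeff i * sqrt_coeff j) *\<^sub>C g ^ (i + j)) =
        \<bar>sqrt_coeff i\<bar> * \<bar>sqrt_coeff j\<bar> * N (g ^ (i + j))"
      by (simp only: N_scaleC norm_of_real abs_mult)
    also have "\<dots> \<le> 1 * N (g ^ (i + j))"
      by (intro mult_right_mono mult_le_one sqrt_coeff_le_1) auto
    also have "\<dots> \<le> r ^ (i + j)"
      using N_power[of g "i + j"] power_mono[OF assms(2) N_nonneg, of "i + j"] by simp
    also have "\<dots> \<le> r ^ m" using ij r0 assms(3) by (intro power_decreasing) auto
    finally show "N (of_real (sqrt_coeff i * sqrt_coeff j) *\<^sub>C g ^ (i + j)) \<le> r ^ m" .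
  qed
  also have "\<dots> = real (card ?R) * r ^ m" by simp
  also have "\<dots> \<le> real (card ({..m} \<times> {..m})) * r ^ m"
    using card_mono[OF _ sub] r0 by (intro mult_right_mono of_nat_mono) auto
  also have "\<dots> = (real m + 1)\<^sup>2 * r ^ m"
    by (simp add: power2_eq_square card_cartesian_product algebra_simps)
  finally show ?thesis .
qed

lemma poly_geometric_tendsto_0:
  assumes "0 \<le> r" "r < (1::real)"
  shows "(\<lambda>m. (real m + 1)\<^sup>2 * r ^ m) \<longlonglongrightarrow> 0"
proof -
  have s: "norm (sqrt r) < 1" "0 \<le> sqrt r" using assms by (auto simp: real_sqrt_lt_1_iff)
  have "(\<lambda>m. real m * sqrt r ^ m + sqrt r ^ m) \<longlonglongrightarrow> 0 + 0"
    by (intro tendsto_add powser_times_n_limit_0 LIMSEQ_power_zero s(1))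
  hence "(\<lambda>m. (real m * sqrt r ^ m + sqrt r ^ m)\<^sup>2) \<longlonglongrightarrow> 0\<^sup>2"
    by (intro tendsto_power) simp
  moreover have "(real m * sqrt r ^ m + sqrt r ^ m)\<^sup>2 = (real m + 1)\<^sup>2 * r ^ m" for m
  proof -
    have "(sqrt r ^ m)\<^sup>2 = r ^ m"
      using assms(1) by (simp flip: power_mult) (simp add: power_mult mult.commute[of m 2] del: power_mult_distrib)
    moreover have "real m * sqrt r ^ m + sqrt r ^ m = (real m + 1) * sqrt r ^ m"
      by (simp add: algebra_simps)
    ultimately show ?thesis by (simp add: power_mult_distrib)
  qed
  ultimately show ?thesis by simp
qed


text \<open>The square root commutes with whatever commutes with \<open>g\<close>; this is what keeps later products of
  positive elements under control.\<close>

lemma sqrt_approx: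
  assumes "star g = g" "N g < 1" "e > 0"
  obtains y where "star y = y" "N (y * y - (1 - g)) < e" "\<forall>z. z * g = g * z \<longrightarrow> z * y = y * z"
proof -
  have "eventually (\<lambda>m. (real m + 1)\<^sup>2 * N g ^ m < e) sequentially"
    using poly_geometric_tendsto_0[OF N_nonneg assms(2)] assms(3)
    by (rule order_tendstoD(2))
  then obtain M where M: "\<And>m. m \<ge> M \<Longrightarrow> (real m + 1)\<^sup>2 * N g ^ m < e"
    by (auto simp: eventually_sequentially)
  define y where "y = sqrt_poly (max M 1) g"
  have "N (y * y - (1 - g)) < e"
    using N_sqrt_poly_square[of "max M 1" g "N g"] M[of "max M 1"] assms(2) by (simp add: y_def)
  thus ?thesis
    using that[of y] assms(1) sqrt_poly_commute by (auto simp: y_def star_sqrt_poly)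
qed

text \<open>For commuting self-adjoint \<open>g\<close>, \<open>y\<close>, the element \<open>u = g + \<i>y\<close> satisfies \<open>u\<^sup>* u = g\<^sup>2 + y\<^sup>2\<close>, and \<open>g\<close>
  is its real part. With an approximate square root of \<open>1 - g\<^sup>2\<close> as \<open>y\<close> this replaces the
  functional calculus below.\<close>

lemma N_le_sum_squares:
  assumes "star g = g" "star y = y" "g * y = y * g"
  shows "(N g)\<^sup>2 \<le> N (g * g + y * y)"
proof -
  define u where "u = g + \<i> *\<^sub>C y"
  have su: "star u = g - \<i> *\<^sub>C y" using assms by (simp add: u_def star_simps)
  have "star u * u = g * g + y * y"
    unfolding su unfolding u_def by (simp add: alg_simps assms(3) scaleC_one)
  hence u2: "(N u)\<^sup>2 = N (g * g + y * y)" using N_star_mult[of u] by simp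
  have "u + star u = 2 *\<^sub>C g"
    using scaleC_add_left[of 1 1 g] unfolding su unfolding u_def by (simp add: scaleC_one)
  hence "2 * N g \<le> N u + N (star u)"
    using N_add[of u "star u"] by (simp add: N_scaleC)
  hence "N g \<le> N u" by simp
  thus ?thesis using u2 power_mono[OF _ N_nonneg, of g "N u" 2] by simp
qed

lemma N_one_minus_square:
  assumes "star h = h" "N h \<le> 1"
  shows "N (1 - h * h) \<le> 1"
proof (rule field_le_epsilon)
  fix e :: real assume e: "e > 0"
  define d where "d = min (e / 4) (1 / 2)"
  have d: "0 < d" "d < 1" "d \<le> e / 4" using e by (auto simp: d_def)
  define g where "g = of_real (1 - d) *\<^sub>C (h * h)"
  define k where "k = of_real (sqrt (1 - d)) *\<^sub>C h"
  have hh: "N (h * h) \<le> 1"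
    using assms by (simp add: N_sa_square power_le_one)
  have kk: "k * k = g"
    using d by (simp add: k_def g_def alg_simps flip: of_real_mult)
  have sg: "star g = g" "star k = k" using assms(1) by (simp_all add: g_def k_def star_simps)
  have "N g = (1 - d) * N (h * h)"
    unfolding g_def N_scaleC norm_of_real using d by simp
  also have "\<dots> \<le> 1 - d" using mult_left_mono[OF hh, of "1 - d"] d by simp
  finally have "N g < 1" using d by simp
  then obtain y where
    y: "star y = y" "N (y * y - (1 - g)) < d" "\<forall>z. z * g = g * z \<longrightarrow> z * y = y * z"
    by (rule sqrt_approx[OF sg(1) _ d(1)])
  have "k * y = y * k" by (rule y(3)[rule_format]) (simp add: mult.assoc flip: kk)
  hence "(N y)\<^sup>2 \<le> N (y * y + k * k)" by (intro N_le_sum_squares y sg) simp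
  also have "y * y + k * k = (y * y - (1 - g)) + 1" by (simp add: kk)
  also have "N \<dots> \<le> d + 1" using N_add[of "y * y - (1 - g)" 1] y(2) by simp
  finally have yy: "N (y * y) \<le> 1 + d" using y(1) by (simp add: N_sa_square)
  have "N (1 - h * h) \<le> N (y * y) + N ((1 - h * h) - y * y)" by (rule N_diff_le)
  also have "(1 - h * h) - y * y = ((1 - g) - y * y) - of_real d *\<^sub>C (h * h)"
    by (simp add: g_def alg_simps scaleC_one)
  also have "N \<dots> \<le> d + d"
  proof -
    have "N (of_real d *\<^sub>C (h * h)) \<le> d"
      unfolding N_scaleC norm_of_real using mult_left_mono[OF hh, of d] d by simp
    thus ?thesis
      using N_diff[of "(1 - g) - y * y" "of_real d *\<^sub>C (h * h)"] y(2)
        N_minus_commute[of "1 - g" "y * y"] by simp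
  qed
  finally show "N (1 - h * h) \<le> 1 + e" using yy d by simp
qed

text \<open>For a self-adjoint \<open>h\<close> in a C*-algebra, \<open>\<parallel>t - h\<parallel> \<le> t\<close> says that the spectrum of \<open>h\<close> lies in \<open>[0, 2t]\<close>. The
  condition makes sense without a spectrum, and sums visibly preserve it.\<close>

definition pos :: "'a \<Rightarrow> bool" where
  "pos h \<longleftrightarrow> star h = h \<and> (\<exists>t\<ge>0. N (of_real t *\<^sub>C 1 - h) \<le> t)"

lemma pos_sa: "pos h \<Longrightarrow> star h = h"
  by (simp add: pos_def)

lemma pos_square:
  assumes "star h = h"
  shows "pos (h * h)"
proof (cases "h = 0")
  case False
  define t where "t = N h"
  have t: "t > 0" using False by (simp add: t_def less_le)
  define k where "k = of_real (1 / t) *\<^sub>C h"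
  have k: "star k = k" "N k \<le> 1"
    using assms t unfolding k_def N_scaleC norm_of_real by (simp_all add: star_simps t_def)
  have "N (of_real (t\<^sup>2) *\<^sub>C (1 - k * k)) \<le> t\<^sup>2"
    unfolding N_scaleC norm_of_real using mult_left_mono[OF N_one_minus_square[OF k], of "t\<^sup>2"] by simp
  also have "of_real (t\<^sup>2) *\<^sub>C (1 - k * k) = of_real (t\<^sup>2) *\<^sub>C 1 - h * h"
    using t by (simp add: k_def alg_simps power2_eq_square scaleC_one)
  finally show ?thesis
    unfolding pos_def using assms by (auto simp: star_simps intro!: exI[of _ "t\<^sup>2"])
qed (auto simp: pos_def intro!: exI[of _ 0])

text \<open>Here \<open>h = t(1 - k)\<close> with \<open>\<parallel>k\<parallel> \<le> 1\<close>, whereas the error bound for the binomial series needs \<open>\<parallel>k\<parallel> < 1\<close>.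
  Shrinking \<open>k\<close> by the factor \<open>1 - d\<close> costs an error of order \<open>d\<close>.\<close>

lemma pos_sqrt_approx:
  assumes "pos h" "e > 0"
  obtains y where "star y = y" "N (y * y - h) < e" "\<forall>z. z * h = h * z \<longrightarrow> z * y = y * z"
proof -
  from assms(1) obtain s where s: "s \<ge> 0" "N (of_real s *\<^sub>C 1 - h) \<le> s" and sh: "star h = h"
    by (auto simp: pos_def)
  define t where "t = s + 1"
  have t: "t > 0" "N (of_real t *\<^sub>C 1 - h) \<le> t"
    using s N_add[of "of_real s *\<^sub>C 1 - h" 1] by (simp_all add: t_def alg_simps scaleC_one)
  define X where "X = t + N h + 1"
  define d where "d = min (1 / 2) (e / (4 * X))"
  have tp: "X > 0" using t(1) N_nonneg[of h] unfolding X_def by linarith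
  have d: "0 < d" "d < 1" using assms(2) tp by (auto simp: d_def)
  have "d * X \<le> e / (4 * X) * X"
    by (rule mult_right_mono) (use tp in \<open>auto simp: d_def\<close>)
  also have "\<dots> = e / 4" using tp by simp
  finally have d': "d * (t + N h + 1) \<le> e / 4" by (simp add: X_def)
  define g where "g = of_real ((1 - d) / t) *\<^sub>C (of_real t *\<^sub>C 1 - h)"
  have sg: "star g = g" using sh by (simp add: g_def star_simps)
  have "N g = (1 - d) / t * N (of_real t *\<^sub>C 1 - h)"
    unfolding g_def N_scaleC norm_of_real using d t by simp
  also have "\<dots> \<le> (1 - d) / t * t" using d t by (intro mult_left_mono) auto
  finally have ng: "N g < 1" using d t by simp
  have et: "e / (2 * t) > 0" using assms(2) t by simp
  obtain y where
    y: "star y = y" "N (y * y - (1 - g)) < e / (2 * t)" "\<forall>z. z * g = g * z \<longrightarrow> z * y = y * z"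
    by (rule sqrt_approx[OF sg ng et])
  define x where "x = of_real (sqrt t) *\<^sub>C y"
  have "of_real t * of_real ((1 - d) / t) = (of_real (1 - d) :: complex)"
    using t by (simp flip: of_real_mult)
  hence "of_real t *\<^sub>C g = of_real (1 - d) *\<^sub>C (of_real t *\<^sub>C 1 - h)"
    unfolding g_def scaleC_scaleC by simp
  hence "of_real t *\<^sub>C (1 - g) = of_real (t * d) *\<^sub>C 1 + h - of_real d *\<^sub>C h"
    by (simp add: alg_simps scaleC_one)
  moreover have "x * x = of_real t *\<^sub>C (y * y)"
    using t by (simp add: x_def alg_simps flip: of_real_mult)
  ultimately have "x * x - h = of_real t *\<^sub>C (y * y - (1 - g)) + (of_real (t * d) *\<^sub>C 1 - of_real d *\<^sub>C h)"
    by (simp add: CV.scale_right_diff_distrib[of _ "y * y"])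
  hence "N (x * x - h) \<le> N (of_real t *\<^sub>C (y * y - (1 - g))) + N (of_real (t * d) *\<^sub>C 1 - of_real d *\<^sub>C h)"
    by (simp only: N_add)
  also have "\<dots> \<le> t * N (y * y - (1 - g)) + (t * d + d * N h)"
    using N_diff[of "of_real (t * d) *\<^sub>C 1" "of_real d *\<^sub>C h"] t d
    unfolding N_scaleC norm_of_real by simp
  also have "t * N (y * y - (1 - g)) < e / 2"
    using y(2) t by (simp add: field_simps)
  also have "t * d + d * N h \<le> d * (t + N h + 1)"
    using d by (simp add: algebra_simps)
  finally have "N (x * x - h) < e" using d' assms(2) by linarith
  moreover have "star x = x" by (simp add: x_def star_simps y(1))
  moreover have "z * x = x * z" if "z * h = h * z" for z
  proof -
    have "z * y = y * z" by (rule y(3)[rule_format]) (simp add: g_def alg_simps that)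
    thus ?thesis by (simp add: x_def alg_simps)
  qed
  ultimately show ?thesis using that[of x] by blast
qed

text \<open>The bound \<open>t\<close> in the definition of positivity may be lowered to \<open>\<parallel>h\<parallel>\<close>, since \<open>h\<close> is a limit of
  squares and \<open>N_one_minus_square\<close> handles these. Hence the positive cone is closed.\<close>

lemma pos_N_diff_le:
  assumes "pos h" "N h \<le> s"
  shows "N (of_real s *\<^sub>C 1 - h) \<le> s"
proof (rule field_le_epsilon)
  fix e :: real assume e: "e > 0"
  have e3: "e / 3 > 0" using e by simp
  obtain y where y: "star y = y" "N (y * y - h) < e / 3" "\<forall>z. z * h = h * z \<longrightarrow> z * y = y * z"
    by (rule pos_sqrt_approx[OF assms(1) e3])
  define t where "t = s + e / 3"
  have t: "t > 0" using assms(2) N_nonneg[of h] e unfolding t_def by linarith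
  have "N (y * y) \<le> t"
    using N_diff_le[of "y * y" h] y(2) assms(2) by (simp add: t_def)
  hence ny: "N y \<le> sqrt t" using y(1) by (simp add: N_sa_square real_le_rsqrt)
  define k where "k = of_real (1 / sqrt t) *\<^sub>C y"
  have k: "star k = k" "N k \<le> 1"
    using ny t unfolding k_def N_scaleC norm_of_real by (simp_all add: star_simps y(1))
  have "N (of_real t *\<^sub>C (1 - k * k)) \<le> t"
    unfolding N_scaleC norm_of_real using mult_left_mono[OF N_one_minus_square[OF k], of t] t by simp
  also have "of_real t *\<^sub>C (1 - k * k) = of_real t *\<^sub>C 1 - y * y"
    using t by (simp add: k_def alg_simps scaleC_one flip: of_real_mult)
  finally have 1: "N (of_real t *\<^sub>C 1 - y * y) \<le> t" .
  have eq: "of_real s *\<^sub>C 1 - h = (of_real t *\<^sub>C 1 - y * y) + (y * y - h) - of_real (e / 3) *\<^sub>C 1"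
    by (simp add: t_def alg_simps)
  have "N (of_real s *\<^sub>C 1 - h) \<le> N (of_real t *\<^sub>C 1 - y * y) + N (y * y - h) + N (of_real (e / 3) *\<^sub>C 1)"
    unfolding eq
    using N_diff[of "(of_real t *\<^sub>C 1 - y * y) + (y * y - h)" "of_real (e / 3) *\<^sub>C 1"]
      N_add[of "of_real t *\<^sub>C 1 - y * y" "y * y - h"] by linarith
  also have "N (of_real (e / 3) *\<^sub>C 1) = e / 3"
    unfolding N_scaleC norm_of_real using e by simp
  finally show "N (of_real s *\<^sub>C 1 - h) \<le> s + e" using 1 y(2) by (simp add: t_def)
qed

lemma pos_closed:
  assumes "star h = h" "\<And>e. e > 0 \<Longrightarrow> \<exists>p. pos p \<and> N (h - p) < e"
  shows "pos h"
proof -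
  have "N (of_real (N h) *\<^sub>C 1 - h) \<le> N h"
  proof (rule field_le_epsilon)
    fix e :: real assume e: "e > 0"
    then obtain p where p: "pos p" "N (h - p) < e / 3" using assms(2)[of "e / 3"] by auto
    have "N p \<le> N h + e / 3" using N_diff_le[of p h] N_minus_commute[of p h] p(2) by simp
    from pos_N_diff_le[OF p(1) this]
    have 1: "N (of_real (N h + e / 3) *\<^sub>C 1 - p) \<le> N h + e / 3" .
    have eq: "of_real (N h) *\<^sub>C 1 - h =
        (of_real (N h + e / 3) *\<^sub>C 1 - p) - (h - p) - of_real (e / 3) *\<^sub>C 1"
      by (simp add: alg_simps)
    have "N (of_real (N h) *\<^sub>C 1 - h) \<le>
        N (of_real (N h + e / 3) *\<^sub>C 1 - p) + N (h - p) + N (of_real (e / 3) *\<^sub>C 1)"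
      unfolding eq
      using N_diff[of "(of_real (N h + e / 3) *\<^sub>C 1 - p) - (h - p)" "of_real (e / 3) *\<^sub>C 1"]
        N_diff[of "of_real (N h + e / 3) *\<^sub>C 1 - p" "h - p"] by linarith
    also have "N (of_real (e / 3) *\<^sub>C 1) = e / 3"
      unfolding N_scaleC norm_of_real using e by simp
    finally show "N (of_real (N h) *\<^sub>C 1 - h) \<le> N h + e" using 1 p(2) by simp
  qed
  thus ?thesis using assms(1) N_nonneg[of h] unfolding pos_def by blast
qed

lemma pos_add:
  assumes "pos a" "pos b"
  shows "pos (a + b)"
proof -
  from assms obtain s t where st: "s \<ge> 0" "N (of_real s *\<^sub>C 1 - a) \<le> s" "t \<ge> 0" "N (of_real t *\<^sub>C 1 - b) \<le> t"
    by (auto simp: pos_def)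
  have "N (of_real (s + t) *\<^sub>C 1 - (a + b)) \<le> s + t"
    using N_add[of "of_real s *\<^sub>C 1 - a" "of_real t *\<^sub>C 1 - b"] st by (simp add: alg_simps)
  thus ?thesis using st(1,3) assms unfolding pos_def by (auto simp: star_simps intro!: exI[of _ "s + t"])
qed

lemma pos_zero: "pos 0"
  unfolding pos_def by (auto intro!: exI[of _ 0])

lemma pos_sum: "(\<And>i. i \<in> A \<Longrightarrow> pos (f i)) \<Longrightarrow> pos (sum f A)"
  by (induction A rule: infinite_finite_induct) (auto simp: pos_zero pos_add)

lemma pos_scale:
  assumes "pos a" "c \<ge> 0"
  shows "pos (of_real c *\<^sub>C a)"
proof -
  from assms(1) obtain s where s: "s \<ge> 0" "N (of_real s *\<^sub>C 1 - a) \<le> s" by (auto simp: pos_def)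
  have "N (of_real c *\<^sub>C (of_real s *\<^sub>C 1 - a)) \<le> c * s"
    unfolding N_scaleC norm_of_real using mult_left_mono[OF s(2) assms(2)] assms(2) by simp
  hence "N (of_real (c * s) *\<^sub>C 1 - of_real c *\<^sub>C a) \<le> c * s" by (simp add: alg_simps)
  thus ?thesis using s(1) assms by (auto simp: pos_def star_simps intro!: exI[of _ "c * s"])
qed

lemma pos_conj:
  assumes "pos h" "star b = b" "b * h = h * b"
  shows "pos (b * h * b)"
proof (rule pos_closed)
  show "star (b * h * b) = b * h * b"
    using assms(2) pos_sa[OF assms(1)] by (simp add: star_mult mult.assoc)
  fix e :: real assume e: "e > 0"
  define d where "d = e / ((N b)\<^sup>2 + 1)"
  have d: "d > 0" using e by (simp add: d_def add_nonneg_pos)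
  obtain y where y: "star y = y" "N (y * y - h) < d" "\<forall>z. z * h = h * z \<longrightarrow> z * y = y * z"
    by (rule pos_sqrt_approx[OF assms(1) d])
  have bcy: "b * y = y * b" by (rule y(3)[rule_format]) (fact assms(3))
  have "pos ((b * y) * (b * y))"
    by (rule pos_square) (simp add: star_simps assms y(1) bcy)
  moreover have "N (b * h * b - (b * y) * (b * y)) < e"
  proof -
    have "b * h * b - (b * y) * (b * y) = b * ((h - y * y) * b)"
    proof -
      have "b * y * (b * y) = b * (y * y) * b" by (metis bcy mult.assoc)
      thus ?thesis by (simp add: algebra_simps)
    qed
    hence "N (b * h * b - (b * y) * (b * y)) \<le> N b * (N (h - y * y) * N b)"
      using N_mult[of b "(h - y * y) * b"] mult_left_mono[OF N_mult[of "h - y * y" b], of "N b"] by simp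
    also have "\<dots> = (N b)\<^sup>2 * N (y * y - h)"
      by (simp add: power2_eq_square N_minus_commute[of h])
    also have "\<dots> \<le> (N b)\<^sup>2 * d" using y(2) by (intro mult_left_mono) auto
    also have "\<dots> < ((N b)\<^sup>2 + 1) * d" using d by simp
    also have "\<dots> = e" unfolding d_def by (simp add: add_nonneg_pos less_imp_neq[symmetric])
    finally show ?thesis .
  qed
  ultimately show "\<exists>p. pos p \<and> N (b * h * b - p) < e" by blast
qed

lemma pos_power:
  assumes "pos z"
  shows "pos (z ^ n)"
proof (cases "even n")
  case True
  then obtain m where m: "n = m + m" by (metis evenE mult_2)
  have "star (z ^ m) = z ^ m" using assms by (simp add: star_simps pos_sa)
  thus ?thesis using pos_square[of "z ^ m"] by (simp add: m power_add)
next
  case False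
  then obtain m where m: "n = m + 1 + m" by (metis oddE mult_2 add.assoc add.commute)
  have "star (z ^ m) = z ^ m" using assms by (simp add: star_simps pos_sa)
  from pos_conj[OF assms this] show ?thesis by (simp add: m power_add power_commutes mult.assoc)
qed

text \<open>If \<open>0 \<le> x \<le> \<lambda>\<close>, then \<open>\<lambda>\<^sup>2 - (2x - \<lambda>)\<^sup>2 = 4x(\<lambda> - x)\<close> is approximately a square of an element commuting
  with \<open>x\<close>.\<close>

lemma N_centered_le:
  assumes "pos x" "pos (of_real l *\<^sub>C 1 - x)" "l \<ge> 0"
  shows "N (2 *\<^sub>C x - of_real l *\<^sub>C 1) \<le> l"
proof -
  define g where "g = 2 *\<^sub>C x - of_real l *\<^sub>C 1"
  define w where "w = of_real l *\<^sub>C 1 - x"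
  have sx: "star x = x" "star w = w" "star g = g"
    using pos_sa[OF assms(1)] by (simp_all add: w_def g_def star_simps)
  have "(N g)\<^sup>2 \<le> l\<^sup>2"
  proof (rule field_le_epsilon)
    fix e :: real assume e: "e > 0"
    define X where "X = N w + N x + 1"
    define d where "d = e / (4 * X)"
    have np: "X > 0" using N_nonneg[of w] N_nonneg[of x] unfolding X_def by linarith
    have d: "d > 0" using e np by (simp add: d_def)
    obtain a where a: "star a = a" "N (a * a - x) < d" "\<forall>z. z * x = x * z \<longrightarrow> z * a = a * z"
      by (rule pos_sqrt_approx[OF assms(1) d])
    define d2 where "d2 = min d 1 / (1 + N (a * a))"
    have d2: "d2 > 0" using d N_nonneg[of "a * a"] by (simp add: d2_def add_pos_nonneg)
    obtain b where b: "star b = b" "N (b * b - w) < d2" "\<forall>z. z * w = w * z \<longrightarrow> z * b = b * z"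
      by (rule pos_sqrt_approx[OF assms(2)[folded w_def] d2])
    have "x * w = w * x" by (simp add: w_def alg_simps)
    hence xb: "x * b = b * x" by (rule b(3)[rule_format])
    hence ba: "b * a = a * b" by (intro a(3)[rule_format]) simp
    have "x * g = g * x" "w * g = g * w" by (simp_all add: w_def g_def alg_simps)
    hence ga: "g * a = a * g" and gb: "g * b = b * g" by (simp_all add: a(3)[rule_format] b(3)[rule_format])
    define y where "y = 2 *\<^sub>C (a * b)"
    have "(N g)\<^sup>2 \<le> N (g * g + y * y)"
    proof (rule N_le_sum_squares)
      show "star y = y" by (simp add: y_def star_simps a b ba)
      show "g * y = y * g" by (simp add: y_def alg_simps) (metis ga gb mult.assoc)
    qed (fact sx)
    also have "g * g + y * y = of_real (l\<^sup>2) *\<^sub>C 1 + 4 *\<^sub>C (a * a * (b * b - w) + (a * a - x) * w)"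
    proof -
      have "a * b * (a * b) = a * a * (b * b)" by (metis ba mult.assoc)
      hence yy: "y * y = 4 *\<^sub>C (a * a * (b * b))" by (simp add: y_def alg_simps)
      have gg: "g * g = of_real (l\<^sup>2) *\<^sub>C 1 - 4 *\<^sub>C (x * w)"
        using scaleC_add_left[of "2 * of_real l" "2 * of_real l" x]
        by (simp add: g_def w_def alg_simps power2_eq_square)
      show ?thesis unfolding gg yy by (simp add: alg_simps)
    qed
    also have "N \<dots> \<le> l\<^sup>2 + 4 * (N (a * a) * d2 + d * N w)"
    proof -
      have "N (a * a * (b * b - w) + (a * a - x) * w) \<le> N (a * a) * d2 + d * N w"
        using N_add[of "a * a * (b * b - w)" "(a * a - x) * w"]
          N_mult[of "a * a" "b * b - w"] N_mult[of "a * a - x" w]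
          mult_left_mono[of "N (b * b - w)" d2 "N (a * a)"] mult_right_mono[of "N (a * a - x)" d "N w"]
          a(2) b(2) N_nonneg[of "a*a"] N_nonneg[of w] by linarith
      hence "N (4 *\<^sub>C (a * a * (b * b - w) + (a * a - x) * w)) \<le> 4 * (N (a * a) * d2 + d * N w)"
        by (simp add: N_scaleC)
      moreover have "N (of_real (l\<^sup>2) *\<^sub>C 1) = l\<^sup>2" unfolding N_scaleC norm_of_real by simp
      ultimately show ?thesis
        using N_add[of "of_real (l\<^sup>2) *\<^sub>C 1" "4 *\<^sub>C (a * a * (b * b - w) + (a * a - x) * w)"] by linarith
    qed
    also have "N (a * a) * d2 \<le> d"
    proof -
      have "N (a * a) * d2 \<le> (1 + N (a * a)) * d2" using d2 by simp
      also have "\<dots> = min d 1" unfolding d2_def using N_nonneg[of "a*a"]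
        by (simp add: add_nonneg_pos less_imp_neq[symmetric] del: N_nonneg)
      finally show ?thesis by simp
    qed
    also have "4 * (d + d * N w) \<le> 4 * (d * X)"
      using d by (simp add: X_def algebra_simps)
    also have "\<dots> = e" using np by (simp add: d_def)
    finally show "(N g)\<^sup>2 \<le> l\<^sup>2 + e" by simp
  qed
  thus ?thesis using assms(3) abs_le_square_iff[of "N g" l] by (simp add: g_def)
qed

lemma N_le_of_pos:
  assumes "pos x" "pos (of_real l *\<^sub>C 1 - x)" "l \<ge> 0"
  shows "N x \<le> l"
proof -
  have "N (2 *\<^sub>C x) \<le> N (of_real l *\<^sub>C 1) + N (2 *\<^sub>C x - of_real l *\<^sub>C 1)"
    by (rule N_diff_le)
  also have "N (of_real l *\<^sub>C 1) = l" unfolding N_scaleC norm_of_real using assms(3) by simp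
  also note N_centered_le[OF assms]
  finally show ?thesis by (simp add: N_scaleC)
qed

lemma pos_N_minus:
  assumes "star y = y"
  shows "pos (of_real (N y) *\<^sub>C 1 - y)"
  unfolding pos_def using assms by (auto simp: star_simps intro!: exI[of _ "N y"])

lemma N_mono:
  assumes "pos x" "pos (y - x)"
  shows "N x \<le> N y"
proof (rule N_le_of_pos[OF assms(1)])
  have "star y = y" using pos_sa[OF assms(1)] pos_sa[OF assms(2)] by (simp add: star_simps)
  from pos_add[OF pos_N_minus[OF this] assms(2)]
  show "pos (of_real (N y) *\<^sub>C 1 - x)" by simp
qed simp


lemma N_power_sa:
  assumes "star w = w"
  shows "N (w ^ n) = N w ^ n"
proof (cases "N w = 0")
  case False
  have sq: "N (w ^ (2 ^ k)) = N w ^ (2 ^ k)" for k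
  proof (induction k)
    case (Suc k)
    have "star (w ^ 2 ^ k) = w ^ 2 ^ k" using assms by (simp add: star_power)
    from N_sa_square[OF this] show ?case
      using Suc by (simp add: power_mult power_mult[of _ _ 2] mult.commute[of 2] power2_eq_square)
  qed simp
  have n: "n \<le> 2 ^ n" using less_exp[of n] by simp
  have "N w ^ n * N w ^ (2 ^ n - n) = N (w ^ n * w ^ (2 ^ n - n))"
    using n by (simp add: sq flip: power_add)
  also have "\<dots> \<le> N (w ^ n) * N w ^ (2 ^ n - n)"
    using N_mult[of "w ^ n" "w ^ (2 ^ n - n)"] mult_left_mono[OF N_power[of w "2 ^ n - n"], of "N (w ^ n)"]
    by simp
  finally have "N w ^ n \<le> N (w ^ n)"
    using False by (simp add: mult_le_cancel_right zero_less_power_eq less_le)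
  thus ?thesis using N_power[of w n] by simp
qed (cases n, auto)

text \<open>With \<open>w = 1 - a\<^sup>* a\<close>, \<open>z = 1 - a a\<^sup>*\<close> and \<open>x = a w\<^sup>m\<close> one has \<open>x\<^sup>* x = w\<^sup>2\<^sup>m - w\<^sup>2\<^sup>m\<^sup>+\<^sup>1\<close> and
  \<open>x x\<^sup>* = z\<^sup>2\<^sup>m - z\<^sup>2\<^sup>m\<^sup>+\<^sup>1 \<le> 1\<close>. Since \<open>x\<^sup>* x + x x\<^sup>*\<close> is a sum of two self-adjoint squares, it follows
  that \<open>w\<^sup>2\<^sup>m\<^sup>+\<^sup>1 \<le> 1 + w\<^sup>2\<^sup>m\<close> for all \<open>m\<close>, and hence \<open>\<parallel>w\<parallel> \<le> 1\<close>.\<close>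

lemma N_one_minus_star_mult:
  assumes "N a \<le> 1"
  shows "N (1 - star a * a) \<le> 1"
proof -
  define w where "w = 1 - star a * a"
  define z where "z = 1 - a * star a"
  have sw: "star w = w" and sz: "star z = z" by (simp_all add: w_def z_def star_simps)
  have "N (star a * a) \<le> 1" "N (a * star a) \<le> 1"
    using assms N_star_mult[of a] N_star_mult[of "star a"] by (simp_all add: power_le_one star_star)
  hence pw: "pos w" and pz: "pos z"
    using sw sz unfolding pos_def by (auto simp: w_def z_def scaleC_one intro!: exI[of _ 1])
  have awm: "a * w ^ m = z ^ m * a" for m
  proof (induction m)
    case (Suc m)
    have "a * w = z * a" by (simp add: w_def z_def algebra_simps)
    thus ?case using Suc by (simp add: power_commutes flip: mult.assoc) (simp add: mult.assoc)
  qed simp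
  have key: "N w ^ (2 * m) * (N w - 1) \<le> 1" for m
  proof -
    define x where "x = a * w ^ m"
    have sx: "star x = w ^ m * star a" by (simp add: x_def star_mult star_power sw)
    have "star x * x = w ^ m * (star a * a) * w ^ m" by (simp add: sx) (simp add: x_def mult.assoc)
    also have "star a * a = 1 - w" by (simp add: w_def)
    also have "w ^ m * (1 - w) * w ^ m = w ^ (2 * m) - w ^ (2 * m + 1)"
      by (rule power_sandwich)
    finally have 1: "star x * x = w ^ (2 * m) - w ^ (2 * m + 1)" .
    have "x * star x = z ^ m * (a * star a) * z ^ m"
    proof -
      have "star x = star a * z ^ m" unfolding x_def awm by (simp add: star_mult star_power sz)
      thus ?thesis by (simp add: x_def awm mult.assoc)
    qed
    also have "a * star a = 1 - z" by (simp add: z_def)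
    also have "z ^ m * (1 - z) * z ^ m = z ^ (2 * m) - z ^ (2 * m + 1)"
      by (rule power_sandwich)
    finally have 2: "x * star x = z ^ (2 * m) - z ^ (2 * m + 1)" .
    define p where "p = (1 / 2) *\<^sub>C (x + star x)"
    define q where "q = (\<i> / 2) *\<^sub>C (star x - x)"
    have pq: "star p = p" "star q = q" by (simp_all add: p_def q_def star_simps alg_simps)
    have half: "(1 / 2) *\<^sub>C y + (1 / 2) *\<^sub>C y = y" for y :: 'a
      by (simp add: scaleC_one flip: scaleC_add_left)
    have "star x * x + x * star x = 2 *\<^sub>C (p * p + q * q)"
    proof -
      define S where "S = x * x + star x * star x"
      define T where "T = star x * x + x * star x"
      have "p * p = (1 / 4) *\<^sub>C (T + S)"
        by (simp add: p_def S_def T_def alg_simps)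
      moreover have "q * q = (1 / 4) *\<^sub>C (T - S)"
        by (simp add: q_def S_def T_def alg_simps)
      ultimately have "p * p + q * q = (1 / 4) *\<^sub>C (T + T)"
        by (simp flip: scaleC_add_right)
      hence "2 *\<^sub>C (p * p + q * q) = (1 / 2) *\<^sub>C T + (1 / 2) *\<^sub>C T"
        by (simp add: scaleC_scaleC scaleC_add_right)
      also have "\<dots> = T" by (rule half)
      finally show ?thesis by (simp add: T_def)
    qed
    moreover have "pos (2 *\<^sub>C (p * p + q * q))"
      using pos_scale[OF pos_add[OF pos_square[OF pq(1)] pos_square[OF pq(2)]], of 2] by simp
    ultimately have 3: "pos (star x * x + x * star x)" by simp
    have zpow: "1 - z ^ n + z ^ (n + 1) = (1 - z) * (\<Sum>i<n. z ^ i) * (1 - z) + z" for n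
    proof -
      have "(1 - z) * (\<Sum>i<n. z ^ i) = 1 - z ^ n"
      proof (induction n)
        case (Suc n)
        have "(1 - z) * z ^ n = z ^ n - z ^ Suc n" by (simp add: left_diff_distrib)
        thus ?case using Suc by (simp add: distrib_left)
      qed simp
      hence "(1 - z) * (\<Sum>i<n. z ^ i) * (1 - z) + z = (1 - z ^ n) * (1 - z) + z" by simp
      thus ?thesis by (simp add: algebra_simps power_commutes)
    qed
    have "pos ((1 - z) * (\<Sum>i<2 * m. z ^ i) * (1 - z))"
    proof (rule pos_conj[OF pos_sum])
      show "(1 - z) * (\<Sum>i<2 * m. z ^ i) = (\<Sum>i<2 * m. z ^ i) * (1 - z)"
        unfolding sum_distrib_left sum_distrib_right
        by (simp add: left_diff_distrib right_diff_distrib power_commutes)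
    qed (simp_all add: pos_power pz star_simps sz)
    from pos_add[OF pos_add[OF this pz] 3]
    have "pos ((1 + w ^ (2 * m)) - w ^ (2 * m + 1))"
      unfolding 1 2 zpow[symmetric] by (simp add: algebra_simps)
    from N_mono[OF pos_power[OF pw] this]
    have "N w ^ (2 * m + 1) \<le> 1 + N w ^ (2 * m)"
      using N_add[of 1 "w ^ (2 * m)"] unfolding N_power_sa[OF sw] by simp
    thus ?thesis by (simp add: algebra_simps)
  qed
  have "N w \<le> 1"
  proof (rule ccontr)
    assume "\<not> N w \<le> 1"
    hence w1: "N w > 1" by simp
    obtain n where n: "1 / (N w - 1) < N w ^ n" using real_arch_pow[OF w1] by blast
    also have "N w ^ n \<le> N w ^ (2 * n)" using w1 by (intro power_increasing) auto
    finally show False using key[of n] w1 by (simp add: field_simps)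
  qed
  thus ?thesis by (simp add: w_def)
qed

lemma pos_star_mult: "pos (star a * a)"
proof (cases "a = 0")
  case False
  define t where "t = N a"
  have t: "t > 0" using False by (simp add: t_def less_le)
  define b where "b = of_real (1 / t) *\<^sub>C a"
  have b: "N b \<le> 1" using t unfolding b_def N_scaleC norm_of_real by (simp add: t_def)
  have "pos (star b * b)"
    unfolding pos_def using N_one_minus_star_mult[OF b]
    by (auto simp: star_simps scaleC_one intro!: exI[of _ 1])
  from pos_scale[OF this, of "t\<^sup>2"] show ?thesis
    using t by (simp add: b_def alg_simps star_simps power2_eq_square scaleC_one)
qed (simp add: pos_zero)

lemma N_le_one_of_sum:
  assumes "(\<Sum>k\<in>K. star (v k) * v k) = 1" "finite K" "k \<in> K"
  shows "N (v k) \<le> 1"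
proof -
  have "1 - star (v k) * v k = (\<Sum>j\<in>K - {k}. star (v j) * v j)"
    using assms by (simp add: sum_diff1)
  hence "pos (1 - star (v k) * v k)" by (simp add: pos_sum pos_star_mult)
  from N_mono[OF pos_star_mult this] show ?thesis
    by (simp add: N_star_mult power_le_one_iff abs_le_square_iff abs_square_le_1)
qed

lemma N_le_of_pos_pm:
  assumes "pos (of_real l *\<^sub>C 1 - g)" "pos (of_real l *\<^sub>C 1 + g)" "l \<ge> 0"
  shows "N g \<le> l"
proof -
  have eq: "of_real (2 * l) *\<^sub>C 1 - (of_real l *\<^sub>C 1 + g) = of_real l *\<^sub>C 1 - g"
    by (simp add: alg_simps) (simp flip: scaleC_add_left)
  have "2 *\<^sub>C (of_real l *\<^sub>C 1 + g) - of_real (2 * l) *\<^sub>C 1 = 2 *\<^sub>C g"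
    by (simp add: alg_simps)
  with N_centered_le[OF assms(2), of "2 * l"] assms(1,3) have "N (2 *\<^sub>C g) \<le> 2 * l"
    unfolding eq by simp
  thus ?thesis by (simp add: N_scaleC)
qed

end

section \<open>Completions and canonical maps\<close>

lemma cstar_completion_simps:
  "sa_carrier (cstar_completion N) = cauchy_class N ` {s. norm_Cauchy N s}"
  "sa_one (cstar_completion N) = cauchy_class N (\<lambda>_. 1)"
  by (simp_all add: cstar_completion_def)

lemma UN_const: "s \<in> X \<Longrightarrow> (\<And>s'. s' \<in> X \<Longrightarrow> f s' = c) \<Longrightarrow> (\<Union>s\<in>X. f s) = c"
  by auto

context cstar_normed
begin

lemma null_add:
  assumes "(\<lambda>n. N (s n)) \<longlonglongrightarrow> 0" "(\<lambda>n. N (t n)) \<longlonglongrightarrow> 0"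
  shows "(\<lambda>n. N (s n + t n)) \<longlonglongrightarrow> 0"
proof (rule Lim_null_comparison)
  show "\<forall>\<^sub>F n in sequentially. norm (N (s n + t n)) \<le> N (s n) + N (t n)"
    by (simp add: N_add)
  show "(\<lambda>n. N (s n) + N (t n)) \<longlonglongrightarrow> 0"
    using tendsto_add[OF assms] by simp
qed

lemma null_scaleC:
  assumes "(\<lambda>n. N (s n)) \<longlonglongrightarrow> 0"
  shows "(\<lambda>n. N (c *\<^sub>C s n)) \<longlonglongrightarrow> 0"
  using tendsto_mult_right_zero[OF assms] by (simp add: N_scaleC)

lemma null_mult_right:
  assumes "(\<lambda>n. N (s n)) \<longlonglongrightarrow> 0" "\<And>n. N (b n) \<le> B"
  shows "(\<lambda>n. N (s n * b n)) \<longlonglongrightarrow> 0"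
proof (rule Lim_null_comparison)
  show "\<forall>\<^sub>F n in sequentially. norm (N (s n * b n)) \<le> N (s n) * B"
    using order_trans[OF N_mult mult_left_mono[OF assms(2)]] by simp
  show "(\<lambda>n. N (s n) * B) \<longlonglongrightarrow> 0" using tendsto_mult_left_zero[OF assms(1)] .
qed

lemma null_mult_left:
  assumes "(\<lambda>n. N (s n)) \<longlonglongrightarrow> 0" "\<And>n. N (b n) \<le> B"
  shows "(\<lambda>n. N (b n * s n)) \<longlonglongrightarrow> 0"
proof (rule Lim_null_comparison)
  show "\<forall>\<^sub>F n in sequentially. norm (N (b n * s n)) \<le> B * N (s n)"
    using order_trans[OF N_mult mult_right_mono[OF assms(2)]] by simp
  show "(\<lambda>n. B * N (s n)) \<longlonglongrightarrow> 0" using tendsto_mult_right_zero[OF assms(1)] .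
qed

lemma null_diff_swap: "(\<lambda>n. N (s n - t n)) \<longlonglongrightarrow> 0 \<Longrightarrow> (\<lambda>n. N (t n - s n)) \<longlonglongrightarrow> 0"
  by (simp add: N_minus_commute)

lemma null_trans:
  "(\<lambda>n. N (s n - t n)) \<longlonglongrightarrow> 0 \<Longrightarrow> (\<lambda>n. N (t n - u n)) \<longlonglongrightarrow> 0 \<Longrightarrow> (\<lambda>n. N (s n - u n)) \<longlonglongrightarrow> 0"
  using null_add[of "\<lambda>n. s n - t n" "\<lambda>n. t n - u n"] by simp

lemma norm_CauchyD: "norm_Cauchy N s \<Longrightarrow> e > 0 \<Longrightarrow> \<exists>M. \<forall>m\<ge>M. \<forall>n\<ge>M. N (s m - s n) < e"
  by (simp add: norm_Cauchy_def)

lemma norm_Cauchy_bounded: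
  assumes "norm_Cauchy N s"
  shows "\<exists>B>0. \<forall>n. N (s n) \<le> B"
proof -
  obtain M where M: "\<And>m n. m \<ge> M \<Longrightarrow> n \<ge> M \<Longrightarrow> N (s m - s n) < 1"
    using norm_CauchyD[OF assms, of 1] by auto
  define B where "B = Max ((\<lambda>n. N (s n)) ` {..M}) + 1"
  have le: "N (s n) \<le> B - 1" if "n \<le> M" for n
  proof -
    have "N (s n) \<le> Max ((\<lambda>n. N (s n)) ` {..M})" using that by (intro Max_ge) auto
    thus ?thesis by (simp add: B_def)
  qed
  have "N (s n) \<le> B" for n
  proof (cases "n \<le> M")
    case False
    thus ?thesis using N_diff_le[of "s n" "s M"] M[of n M] le[of M] by simp
  qed (use le in fastforce)
  moreover have "B > 0" using le[of 0] N_nonneg[of "s 0"] by linarith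
  ultimately show ?thesis by blast
qed

lemma norm_Cauchy_const: "norm_Cauchy N (\<lambda>_. a)"
  by (simp add: norm_Cauchy_def)

lemma norm_Cauchy_add:
  assumes "norm_Cauchy N s" "norm_Cauchy N t"
  shows "norm_Cauchy N (\<lambda>n. s n + t n)"
  unfolding norm_Cauchy_def
proof (intro allI impI)
  fix e :: real assume e: "e > 0"
  obtain M where M: "\<And>m n. m \<ge> M \<Longrightarrow> n \<ge> M \<Longrightarrow> N (s m - s n) < e / 2"
    using norm_CauchyD[OF assms(1), of "e / 2"] e by auto
  obtain K where K: "\<And>m n. m \<ge> K \<Longrightarrow> n \<ge> K \<Longrightarrow> N (t m - t n) < e / 2"
    using norm_CauchyD[OF assms(2), of "e / 2"] e by auto
  have "N ((s m + t m) - (s n + t n)) < e" if "m \<ge> max M K" "n \<ge> max M K" for m n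
  proof -
    have "(s m + t m) - (s n + t n) = (s m - s n) + (t m - t n)" by simp
    hence "N ((s m + t m) - (s n + t n)) \<le> N (s m - s n) + N (t m - t n)" by (simp only: N_add)
    thus ?thesis using M[of m n] K[of m n] that by simp
  qed
  thus "\<exists>M. \<forall>m\<ge>M. \<forall>n\<ge>M. N ((s m + t m) - (s n + t n)) < e" by blast
qed

lemma norm_Cauchy_mult:
  assumes "norm_Cauchy N s" "norm_Cauchy N t"
  shows "norm_Cauchy N (\<lambda>n. s n * t n)"
  unfolding norm_Cauchy_def
proof (intro allI impI)
  fix e :: real assume e: "e > 0"
  obtain B where B: "\<And>n. N (s n) \<le> B" "B > 0" using norm_Cauchy_bounded[OF assms(1)] by blast
  obtain D where D: "\<And>n. N (t n) \<le> D" "D > 0" using norm_Cauchy_bounded[OF assms(2)] by blast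
  obtain M where M: "\<And>m n. m \<ge> M \<Longrightarrow> n \<ge> M \<Longrightarrow> N (s m - s n) < e / (2 * D)"
    using norm_CauchyD[OF assms(1), of "e / (2 * D)"] e D by auto
  obtain K where K: "\<And>m n. m \<ge> K \<Longrightarrow> n \<ge> K \<Longrightarrow> N (t m - t n) < e / (2 * B)"
    using norm_CauchyD[OF assms(2), of "e / (2 * B)"] e B by auto
  have "N (s m * t m - s n * t n) < e" if "m \<ge> max M K" "n \<ge> max M K" for m n
  proof -
    have "s m * t m - s n * t n = (s m - s n) * t m + s n * (t m - t n)"
      by (simp add: algebra_simps)
    hence "N (s m * t m - s n * t n) \<le> N ((s m - s n) * t m) + N (s n * (t m - t n))"
      by (simp only: N_add)
    also have "\<dots> \<le> N (s m - s n) * D + B * N (t m - t n)"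
      using N_mult[of "s m - s n" "t m"] N_mult[of "s n" "t m - t n"]
        mult_left_mono[OF D(1)[of m], of "N (s m - s n)"] mult_right_mono[OF B(1)[of n], of "N (t m - t n)"]
      by simp
    also have "N (s m - s n) * D < e / 2" using M[of m n] that D by (simp add: field_simps)
    also have "B * N (t m - t n) < e / 2" using K[of m n] that B by (simp add: field_simps)
    finally show ?thesis by simp
  qed
  thus "\<exists>M. \<forall>m\<ge>M. \<forall>n\<ge>M. N (s m * t m - s n * t n) < e" by blast
qed

lemma norm_Cauchy_scaleC: "norm_Cauchy N s \<Longrightarrow> norm_Cauchy N (\<lambda>n. c *\<^sub>C s n)"
  using norm_Cauchy_mult[OF norm_Cauchy_const[of "c *\<^sub>C 1"], of s] by (simp add: mult_scaleC_left)

lemma norm_Cauchy_star: "norm_Cauchy N s \<Longrightarrow> norm_Cauchy N (\<lambda>n. star (s n))"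
  by (simp add: norm_Cauchy_def flip: star_diff)

lemma norm_Cauchy_minus: "norm_Cauchy N s \<Longrightarrow> norm_Cauchy N (\<lambda>n. - s n)"
  using norm_Cauchy_scaleC[of s "- 1"] by (simp add: scaleC_one)

lemma norm_Cauchy_diff: "norm_Cauchy N s \<Longrightarrow> norm_Cauchy N t \<Longrightarrow> norm_Cauchy N (\<lambda>n. s n - t n)"
  using norm_Cauchy_add[OF _ norm_Cauchy_minus, of s t] by simp

lemma norm_Cauchy_power: "norm_Cauchy N s \<Longrightarrow> norm_Cauchy N (\<lambda>n. s n ^ k)"
  by (induction k) (auto simp: norm_Cauchy_const norm_Cauchy_mult)

lemma norm_Cauchy_sum:
  "(\<And>i. i \<in> A \<Longrightarrow> norm_Cauchy N (f i)) \<Longrightarrow> norm_Cauchy N (\<lambda>n. \<Sum>i\<in>A. f i n)"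
  by (induction A rule: infinite_finite_induct) (auto simp: norm_Cauchy_const norm_Cauchy_add)

lemma norm_Cauchy_close:
  assumes "norm_Cauchy N s" "(\<lambda>n. N (t n - s n)) \<longlonglongrightarrow> 0"
  shows "norm_Cauchy N t"
  unfolding norm_Cauchy_def
proof (intro allI impI)
  fix e :: real assume e: "e > 0"
  obtain M where M: "\<And>m n. m \<ge> M \<Longrightarrow> n \<ge> M \<Longrightarrow> N (s m - s n) < e / 3"
    using norm_CauchyD[OF assms(1), of "e / 3"] e by auto
  have "\<forall>\<^sub>F n in sequentially. N (t n - s n) < e / 3"
    using assms(2) e by (intro order_tendstoD) auto
  then obtain K where K: "\<And>n. n \<ge> K \<Longrightarrow> N (t n - s n) < e / 3"
    by (auto simp: eventually_sequentially)
  have "N (t m - t n) < e" if "m \<ge> max M K" "n \<ge> max M K" for m n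
    using M[of m n] K[of m] K[of n] that N_diff_triangle[of "t m" "t n" "s m"]
      N_diff_triangle[of "s m" "t n" "s n"] N_minus_commute[of "t n" "s n"] by simp
  thus "\<exists>M. \<forall>m\<ge>M. \<forall>n\<ge>M. N (t m - t n) < e" by blast
qed

lemma cauchy_class_eqI:
  assumes "(\<lambda>n. N (s n - t n)) \<longlonglongrightarrow> 0"
  shows "cauchy_class N s = cauchy_class N t"
  unfolding cauchy_class_def using null_trans[OF _ assms] null_trans[OF _ null_diff_swap[OF assms]] by blast

lemma cauchy_class_self: "norm_Cauchy N s \<Longrightarrow> s \<in> cauchy_class N s"
  by (simp add: cauchy_class_def)

lemma cauchy_class_memD: "t \<in> cauchy_class N s \<Longrightarrow> norm_Cauchy N t \<and> (\<lambda>n. N (t n - s n)) \<longlonglongrightarrow> 0"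
  by (simp add: cauchy_class_def)

lemma cauchy_class_eqD:
  "norm_Cauchy N s \<Longrightarrow> cauchy_class N s = cauchy_class N t \<Longrightarrow> (\<lambda>n. N (s n - t n)) \<longlonglongrightarrow> 0"
  using cauchy_class_self[of s] cauchy_class_memD[of s t] by simp

lemma completion_add:
  assumes "norm_Cauchy N s" "norm_Cauchy N t"
  shows "sa_add (cstar_completion N) (cauchy_class N s) (cauchy_class N t) = cauchy_class N (\<lambda>n. s n + t n)"
proof -
  have "cauchy_class N (\<lambda>n. s' n + t' n) = cauchy_class N (\<lambda>n. s n + t n)"
    if "s' \<in> cauchy_class N s" "t' \<in> cauchy_class N t" for s' t'
  proof (rule cauchy_class_eqI)
    show "(\<lambda>n. N (s' n + t' n - (s n + t n))) \<longlonglongrightarrow> 0"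
      using null_add[of "\<lambda>n. s' n - s n" "\<lambda>n. t' n - t n"] cauchy_class_memD[OF that(1)]
        cauchy_class_memD[OF that(2)] by (simp add: algebra_simps)
  qed
  note c = this
  show ?thesis
    unfolding cstar_completion_def star_alg.simps
    by (intro UN_const[OF cauchy_class_self] assms c)
qed

lemma completion_mult:
  assumes "norm_Cauchy N s" "norm_Cauchy N t"
  shows "sa_mult (cstar_completion N) (cauchy_class N s) (cauchy_class N t) = cauchy_class N (\<lambda>n. s n * t n)"
proof -
  have "cauchy_class N (\<lambda>n. s' n * t' n) = cauchy_class N (\<lambda>n. s n * t n)"
    if "s' \<in> cauchy_class N s" "t' \<in> cauchy_class N t" for s' t'
  proof (rule cauchy_class_eqI)
    note s' = cauchy_class_memD[OF that(1)] and t' = cauchy_class_memD[OF that(2)]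
    obtain B where B: "\<And>n. N (s n) \<le> B" using norm_Cauchy_bounded[OF assms(1)] by blast
    obtain D where D: "\<And>n. N (t' n) \<le> D" using norm_Cauchy_bounded[OF conjunct1[OF t']] by blast
    have "(\<lambda>n. N ((s' n - s n) * t' n + s n * (t' n - t n))) \<longlonglongrightarrow> 0"
      using s' t' B D by (intro null_add null_mult_left[of _ _ B] null_mult_right[of _ _ D]) auto
    thus "(\<lambda>n. N (s' n * t' n - s n * t n)) \<longlonglongrightarrow> 0"
      by (simp add: algebra_simps)
  qed
  note c = this
  show ?thesis
    unfolding cstar_completion_def star_alg.simps
    by (intro UN_const[OF cauchy_class_self] assms c)
qed

lemma completion_scale:
  assumes "norm_Cauchy N s"
  shows "sa_scale (cstar_completion N) c (cauchy_class N s) = cauchy_class N (\<lambda>n. c *\<^sub>C s n)"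
proof -
  have "cauchy_class N (\<lambda>n. c *\<^sub>C s' n) = cauchy_class N (\<lambda>n. c *\<^sub>C s n)"
    if "s' \<in> cauchy_class N s" for s'
  proof (rule cauchy_class_eqI)
    show "(\<lambda>n. N (c *\<^sub>C s' n - c *\<^sub>C s n)) \<longlonglongrightarrow> 0"
      using null_scaleC[of "\<lambda>n. s' n - s n" c] cauchy_class_memD[OF that]
      by (simp add: CV.scale_right_diff_distrib)
  qed
  note c = this
  show ?thesis
    unfolding cstar_completion_def star_alg.simps
    by (intro UN_const[OF cauchy_class_self] assms c)
qed

lemma completion_star:
  assumes "norm_Cauchy N s"
  shows "sa_star (cstar_completion N) (cauchy_class N s) = cauchy_class N (\<lambda>n. star (s n))"
proof -
  have "cauchy_class N (\<lambda>n. star (s' n)) = cauchy_class N (\<lambda>n. star (s n))"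
    if "s' \<in> cauchy_class N s" for s'
  proof (rule cauchy_class_eqI)
    show "(\<lambda>n. N (star (s' n) - star (s n))) \<longlonglongrightarrow> 0"
      using cauchy_class_memD[OF that] by (simp flip: star_diff)
  qed
  note c = this
  show ?thesis
    unfolding cstar_completion_def star_alg.simps
    by (intro UN_const[OF cauchy_class_self] assms c)
qed

lemma class_in_carrier: "norm_Cauchy N s \<Longrightarrow> cauchy_class N s \<in> sa_carrier (cstar_completion N)"
  by (auto simp: cstar_completion_simps)

lemma emb_in_carrier: "emb N a \<in> sa_carrier (cstar_completion N)"
  by (simp add: emb_def class_in_carrier norm_Cauchy_const)

end

lemma norm_Cauchy_dominated:
  assumes "norm_Cauchy N s" "\<And>a. N' a \<le> C * N a" "C > 0"
  shows "norm_Cauchy N' s"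
  unfolding norm_Cauchy_def
proof (intro allI impI)
  fix e :: real assume e: "e > 0"
  then obtain M where M: "\<And>m n. m \<ge> M \<Longrightarrow> n \<ge> M \<Longrightarrow> N (s m - s n) < e / C"
    using assms(1,3) unfolding norm_Cauchy_def by (meson divide_pos_pos)
  have "N' (s m - s n) < e" if "m \<ge> M" "n \<ge> M" for m n
    using M[OF that] assms(2)[of "s m - s n"] assms(3) by (simp add: field_simps)
  thus "\<exists>M. \<forall>m\<ge>M. \<forall>n\<ge>M. N' (s m - s n) < e" by blast
qed

text \<open>A larger norm \<open>N\<close> and a smaller one \<open>N'\<close>, up to a constant. Bijectivity of the canonical map is
  used through two statements about sequences: a Cauchy sequence for \<open>N\<close> that is null for \<open>N'\<close> is null for
  \<open>N\<close>, and a Cauchy sequence for \<open>N'\<close> is equivalent to one that is Cauchy for \<open>N\<close>.\<close>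

locale cstar_dominated =
  A: cstar_normed N + B: cstar_normed N' for N N' :: "'a::complex_star_algebra \<Rightarrow> real" +
  fixes C :: real
  assumes dominated: "N' a \<le> C * N a" and C_pos: "C > 0"
begin

lemma null_dominated: "(\<lambda>n. N (s n)) \<longlonglongrightarrow> 0 \<Longrightarrow> (\<lambda>n. N' (s n)) \<longlonglongrightarrow> 0"
  by (rule Lim_null_comparison[of _ "\<lambda>n. C * N (s n)"])
    (auto simp: dominated intro!: always_eventually tendsto_mult_right_zero)

lemma Cauchy_dominated: "norm_Cauchy N s \<Longrightarrow> norm_Cauchy N' s"
  using norm_Cauchy_dominated dominated C_pos by blast

lemma canonical_map_class:
  assumes "norm_Cauchy N s"
  shows "canonical_map N N' (cauchy_class N s) = cauchy_class N' s"
proof -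
  have "cauchy_class N' t = cauchy_class N' s" if "t \<in> cauchy_class N s" for t
    using A.cauchy_class_memD[OF that] null_dominated by (intro B.cauchy_class_eqI) auto
  note c = this
  show ?thesis
    unfolding canonical_map_def by (intro UN_const[OF A.cauchy_class_self] assms c)
qed

lemma canonical_hom: "sa_hom (cstar_completion N) (cstar_completion N') (canonical_map N N')"
  unfolding sa_hom_def cstar_completion_simps
  by (auto simp: canonical_map_class Cauchy_dominated A.completion_add B.completion_add
      A.completion_scale B.completion_scale A.completion_mult B.completion_mult
      A.completion_star B.completion_star A.norm_Cauchy_add A.norm_Cauchy_scaleC
      A.norm_Cauchy_mult A.norm_Cauchy_star A.norm_Cauchy_const)

lemma canonical_iso_null:
  assumes "canonical_iso N N'" "norm_Cauchy N s" "(\<lambda>n. N' (s n)) \<longlonglongrightarrow> 0"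
  shows "(\<lambda>n. N (s n)) \<longlonglongrightarrow> 0"
proof -
  have "cauchy_class N' s = cauchy_class N' (\<lambda>_. 0)"
    using assms(3) by (intro B.cauchy_class_eqI) simp
  hence "canonical_map N N' (cauchy_class N s) = canonical_map N N' (cauchy_class N (\<lambda>_. 0))"
    by (simp add: canonical_map_class assms(2) A.norm_Cauchy_const)
  hence "cauchy_class N s = cauchy_class N (\<lambda>_. 0)"
    using assms(1,2) A.class_in_carrier A.norm_Cauchy_const[of 0]
    unfolding canonical_iso_def sa_iso_def bij_betw_def by (meson inj_onD)
  from A.cauchy_class_eqD[OF assms(2) this] show ?thesis by simp
qed

lemma canonical_iso_lift:
  assumes "canonical_iso N N'" "norm_Cauchy N' s"
  obtains t where "norm_Cauchy N t" "(\<lambda>n. N' (t n - s n)) \<longlonglongrightarrow> 0"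
proof -
  have "cauchy_class N' s \<in> canonical_map N N' ` sa_carrier (cstar_completion N)"
    using assms B.class_in_carrier[OF assms(2)]
    unfolding canonical_iso_def sa_iso_def bij_betw_def by simp
  then obtain t where t: "norm_Cauchy N t" "cauchy_class N' s = cauchy_class N' t"
    by (auto simp: cstar_completion_simps canonical_map_class)
  from B.cauchy_class_eqD[OF Cauchy_dominated[OF t(1)] t(2)[symmetric]] t(1) show ?thesis by (rule that[rotated])
qed

lemma canonical_iso_equivalent:
  assumes "\<And>a. N a \<le> D * N' a" "D > 0"
  shows "canonical_iso N N'"
  unfolding canonical_iso_def sa_iso_def
proof (intro conjI canonical_hom bij_betw_imageI)
  interpret R: cstar_dominated N' N D
    using assms by unfold_locales auto
  show "inj_on (canonical_map N N') (sa_carrier (cstar_completion N))"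
  proof (rule inj_onI)
    fix X Y assume "X \<in> sa_carrier (cstar_completion N)" "Y \<in> sa_carrier (cstar_completion N)"
      and eq: "canonical_map N N' X = canonical_map N N' Y"
    then obtain s t where st: "X = cauchy_class N s" "norm_Cauchy N s" "Y = cauchy_class N t" "norm_Cauchy N t"
      by (auto simp: cstar_completion_simps)
    hence "cauchy_class N' s = cauchy_class N' t" using eq by (simp add: canonical_map_class)
    from B.cauchy_class_eqD[OF Cauchy_dominated[OF st(2)] this]
    show "X = Y" unfolding st by (intro A.cauchy_class_eqI R.null_dominated)
  qed
  show "canonical_map N N' ` sa_carrier (cstar_completion N) = sa_carrier (cstar_completion N')"
  proof -
    have "canonical_map N N' (cauchy_class N s) = cauchy_class N' s" if "norm_Cauchy N' s" for s
      using R.Cauchy_dominated[OF that] by (rule canonical_map_class)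
    thus ?thesis
      using Cauchy_dominated R.Cauchy_dominated
      by (force simp: cstar_completion_simps canonical_map_class image_iff)
  qed
qed

end

lemma cstar_normed_tilde_norm:
  assumes "cstar_norm N" "star_hom (counit G)"
  shows "cstar_norm (tilde_norm G N)"
proof -
  interpret cstar_normed N by unfold_locales fact
  have e: "counit G (a + b) = counit G a + counit G b" "counit G (c *\<^sub>C a) = c * counit G a"
    "counit G (a * b) = counit G a * counit G b" "counit G (star a) = cnj (counit G a)" for a b c
    using assms(2) by (simp_all add: star_hom_def clinear_def scaleC_complex_def star_complex_def)
  have e0: "counit G 0 = 0" using e(1)[of 0 0] by simp
  show ?thesis
    unfolding cstar_norm_def tilde_norm_def
  proof (intro conjI allI)
    fix a b :: 'a and c :: complex
    show "0 \<le> max (N a) (cmod (counit G a))" by (simp add: le_max_iff_disj)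
    show "max (N a) (cmod (counit G a)) = 0 \<longleftrightarrow> a = 0"
      using N_nonneg[of a] norm_ge_zero[of "counit G a"] e0 by (auto simp: max_def simp del: N_nonneg norm_ge_zero)
    show "max (N (a + b)) (cmod (counit G (a + b))) \<le>
        max (N a) (cmod (counit G a)) + max (N b) (cmod (counit G b))"
      unfolding e by (intro max.boundedI order_trans[OF N_add] order_trans[OF norm_triangle_ineq] add_mono) auto
    show "max (N (c *\<^sub>C a)) (cmod (counit G (c *\<^sub>C a))) = cmod c * max (N a) (cmod (counit G a))"
      by (simp add: e N_scaleC norm_mult max_mult_distrib_left)
    show "max (N (a * b)) (cmod (counit G (a * b))) \<le>
        max (N a) (cmod (counit G a)) * max (N b) (cmod (counit G b))"
      unfolding e norm_mult
      by (intro max.boundedI order_trans[OF N_mult] mult_mono) (auto simp: le_max_iff_disj)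
    show "max (N (star a * a)) (cmod (counit G (star a * a))) = (max (N a) (cmod (counit G a)))\<^sup>2"
    proof -
      have "max (x\<^sup>2) (y\<^sup>2) = (max x y)\<^sup>2" if "x \<ge> 0" "y \<ge> 0" for x y :: real
        using that power_mono[of x y 2] power_mono[of y x 2] by (auto simp: max_def)
      thus ?thesis by (simp add: e N_star_mult norm_mult power2_eq_square)
    qed
  qed
qed

section \<open>The maximal norm and the Kazhdan projection\<close>

lemma norm_scale_eq:
  fixes f :: "'v::complex_vector \<Rightarrow> real"
  assumes "f 0 = 0" "\<And>c a. f (c *\<^sub>C a) \<le> cmod c * f a"
  shows "f (c *\<^sub>C a) = cmod c * f a"
proof (cases "c = 0")
  case False
  have "f a \<le> cmod (1 / c) * f (c *\<^sub>C a)"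
    using assms(2)[of "1 / c" "c *\<^sub>C a"] False by (simp add: scaleC_scaleC scaleC_one)
  hence "cmod c * f a \<le> f (c *\<^sub>C a)" using False by (simp add: norm_divide field_simps)
  with assms(2)[of c a] show ?thesis by simp
qed (simp add: assms(1))

locale cqg =
  fixes G :: "('a::complex_star_algebra, 'i) cqg"
  assumes cqg: "compact_quantum_group G"
begin

abbreviation "cou \<equiv> counit G"

lemma hopf: "hopf_star_algebra G" and haar_st: "haar_state G (haar G)"
  using cqg by (simp_all add: compact_quantum_group_def)

lemma counit_hom: "star_hom cou" and comult_hom: "star_hom (comult G)"
  using hopf by (simp_all add: hopf_star_algebra_def)

lemma counit_simps [simp]:
  "cou (a + b) = cou a + cou b" "cou (c *\<^sub>C a) = c * cou a" "cou (a * b) = cou a * cou b"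
  "cou (star a) = cnj (cou a)" "cou 1 = 1"
  using counit_hom by (simp_all add: star_hom_def clinear_def scaleC_complex_def star_complex_def)

lemma counit_clinear: "clinear cou"
  using counit_hom by (simp add: star_hom_def)

lemma counit_zero [simp]: "cou 0 = 0" and counit_diff [simp]: "cou (a - b) = cou a - cou b"
  and counit_minus [simp]: "cou (- a) = - cou a"
  using counit_clinear by (simp_all add: clinear_0 clinear_diff clinear_minus)

lemma counit_sum: "cou (sum f A) = (\<Sum>i\<in>A. cou (f i))"
  by (induction A rule: infinite_finite_induct) auto

lemma Pol_induct [case_names zero add scale entry]:
  assumes "P 0" "\<And>a b. P a \<Longrightarrow> P b \<Longrightarrow> P (a + b)" "\<And>c a. P a \<Longrightarrow> P (c *\<^sub>C a)"
    "\<And>n v i j. unitary_corep G n v \<Longrightarrow> i < n \<Longrightarrow> j < n \<Longrightarrow> P (v i j)"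
  shows "P a"
proof -
  have "a \<in> CV.span {v i j | n v i j. unitary_corep G n v \<and> i < n \<and> j < n}"
    using cqg by (simp add: compact_quantum_group_def)
  thus ?thesis
    by (rule CV.span_induct) (use assms in \<open>auto simp: CV.subspace_def\<close>)
qed

lemma Pol_bounded_induct:
  assumes add: "\<And>a b c. F (a + b) c \<le> F a c + F b c"
    and scale: "\<And>k a c. F (k *\<^sub>C a) c = cmod k * F a c"
    and entry: "\<And>n v i j. unitary_corep G n v \<Longrightarrow> i < n \<Longrightarrow> j < n \<Longrightarrow> \<exists>C\<ge>0. \<forall>c. F (v i j) c \<le> C * g c"
  shows "\<exists>C\<ge>0. \<forall>c. F a c \<le> C * (g c :: real)"
proof (induction a rule: Pol_induct)
  case zero
  show ?case using scale[of 0 0] by (intro exI[of _ 0]) simp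
next
  case (add a b)
  then obtain C D where CD: "C \<ge> 0" "D \<ge> 0" "\<And>c. F a c \<le> C * g c" "\<And>c. F b c \<le> D * g c" by blast
  have "F (a + b) c \<le> (C + D) * g c" for c
    using assms(1)[of a b c] CD(3,4)[of c] by (simp add: distrib_right)
  thus ?case using CD(1,2) by (intro exI[of _ "C + D"]) simp
next
  case (scale k a)
  then obtain C where C: "C \<ge> 0" "\<And>c. F a c \<le> C * g c" by blast
  have "F (k *\<^sub>C a) c \<le> cmod k * C * g c" for c
    using mult_left_mono[OF C(2)[of c], of "cmod k"] by (simp add: assms(2) mult.assoc)
  thus ?case using C(1) by (intro exI[of _ "cmod k * C"]) simp
qed (rule entry)

lemma unitary_entry_le:
  assumes "cstar_norm N" "unitary_corep G n v" "i < n" "j < n"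
  shows "N (v i j) \<le> 1"
proof -
  interpret cstar_normed N by unfold_locales fact
  show ?thesis
    by (rule N_le_one_of_sum[where K = "{..<n}" and v = "\<lambda>k. v k j"])
      (use assms(2-) in \<open>auto simp: unitary_corep_def\<close>)
qed

text \<open>The entries of a unitary matrix are contractions in every C*-norm.\<close>

lemma cstar_norms_bounded: "\<exists>B. \<forall>N. cstar_norm N \<longrightarrow> N (a :: 'a) \<le> B"
proof -
  have "\<exists>C\<ge>0. \<forall>N. (if cstar_norm N then N a else 0) \<le> C * (\<lambda>_. 1) N"
  proof (rule Pol_bounded_induct)
    fix n v i j assume "unitary_corep G n v" "i < n" "j < n"
    thus "\<exists>C\<ge>0. \<forall>N. (if cstar_norm N then N (v i j) else 0) \<le> C * (\<lambda>_. 1) N"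
      using unitary_entry_le by (intro exI[of _ 1]) simp
  qed (simp_all add: cstar_norm_def)
  then obtain C where "\<And>N. (if cstar_norm N then N a else 0) \<le> C" by auto
  hence "\<forall>N. cstar_norm N \<longrightarrow> N a \<le> C" by metis
  thus ?thesis ..
qed

lemma le_max_norm:
  assumes "cstar_norm N"
  shows "N (a :: 'a) \<le> max_norm a"
  unfolding max_norm_def
proof (rule cSUP_upper)
  show "bdd_above ((\<lambda>N. N a) ` {N. cstar_norm N})"
    using cstar_norms_bounded[of a] by (auto simp: bdd_above_def)
qed (use assms in simp)

lemma max_norm_le:
  assumes "cstar_norm (N0 :: 'a \<Rightarrow> real)" "\<And>N. cstar_norm N \<Longrightarrow> N (a :: 'a) \<le> B"
  shows "max_norm a \<le> B"
  unfolding max_norm_def by (rule cSUP_least) (use assms in auto)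

lemma cstar_norm_max_norm:
  assumes "cstar_norm (N0 :: 'a \<Rightarrow> real)"
  shows "cstar_norm (max_norm :: 'a \<Rightarrow> real)"
proof -
  note le = max_norm_le[OF assms]
  interpret N0: cstar_normed N0 by unfold_locales fact
  have nonneg: "0 \<le> max_norm a" for a :: 'a
    using N0.N_nonneg[of a] le_max_norm[OF assms, of a] by linarith
  have D: "N 0 = 0" "N (a + b) \<le> N a + N b" "N (c *\<^sub>C a) = cmod c * N a" "N (a * b) \<le> N a * N b"
    "N (star a * a) = (N a)\<^sup>2" "N a \<ge> 0" if "cstar_norm N" for N :: "'a \<Rightarrow> real" and a b c
    using that by (simp_all add: cstar_norm_def)
  have zero: "max_norm (0::'a) = 0"
    by (rule antisym[OF le nonneg]) (simp add: D)
  have scale_le: "max_norm (c *\<^sub>C a) \<le> cmod c * max_norm a" for c and a :: 'a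
    by (rule le) (simp add: D le_max_norm mult_left_mono)
  note scale = norm_scale_eq[of max_norm, OF zero scale_le]
  show ?thesis
    unfolding cstar_norm_def
  proof (intro conjI allI)
    fix a b :: 'a and c :: complex
    show "0 \<le> max_norm a" by (rule nonneg)
    show "max_norm a = 0 \<longleftrightarrow> a = 0"
      using zero N0.N_nonneg[of a] N0.N_eq_0[of a] le_max_norm[OF assms, of a] by (metis order_antisym)
    show "max_norm (a + b) \<le> max_norm a + max_norm b"
      by (rule le) (meson D(2) add_mono le_max_norm order_trans)
    show "max_norm (c *\<^sub>C a) = cmod c * max_norm a" by (rule scale)
    show "max_norm (a * b) \<le> max_norm a * max_norm b"
      by (rule le) (meson D(4,6) mult_mono le_max_norm order_trans nonneg)
    show "max_norm (star a * a) = (max_norm a)\<^sup>2"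
    proof (rule antisym)
      show "max_norm (star a * a) \<le> (max_norm a)\<^sup>2"
        by (rule le) (simp add: D le_max_norm power_mono)
      have "max_norm a \<le> sqrt (max_norm (star a * a))"
      proof (rule le)
        fix N :: "'a \<Rightarrow> real" assume N: "cstar_norm N"
        have "(N a)\<^sup>2 \<le> max_norm (star a * a)" using le_max_norm[OF N, of "star a * a"] by (simp add: D N)
        thus "N a \<le> sqrt (max_norm (star a * a))" by (rule real_le_rsqrt)
      qed
      thus "(max_norm a)\<^sup>2 \<le> max_norm (star a * a)"
        using nonneg[of a] nonneg[of "star a * a"] by (metis power_mono real_sqrt_pow2)
    qed
  qed
qed

lemma unbounded_counit_sequence:
  assumes N: "cstar_norm N" and unb: "\<not> (\<exists>K. \<forall>a. cmod (cou a) \<le> K * N a)"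
  shows "\<exists>a. (\<forall>n. cou (a n) = 1) \<and> norm_Cauchy (tilde_norm G N) a \<and> (\<lambda>n. N (a n)) \<longlonglongrightarrow> 0"
proof -
  interpret N: cstar_normed N by unfold_locales fact
  have "\<exists>a. cou a = 1 \<and> N a < inverse (real (Suc n))" for n
  proof -
    obtain a where a: "cmod (cou a) > real (Suc n) * N a" using unb by (meson not_le)
    have "0 \<le> real (Suc n) * N a" by (intro mult_nonneg_nonneg) simp_all
    hence c0: "cou a \<noteq> 0" using a by (metis norm_zero not_le)
    have "N ((1 / cou a) *\<^sub>C a) < inverse (real (Suc n))"
      using a c0 by (simp add: N.N_scaleC norm_divide field_simps)
    moreover have "cou ((1 / cou a) *\<^sub>C a) = 1" using c0 by simp
    ultimately show ?thesis by blast
  qed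
  then obtain a where a: "\<And>n. cou (a n) = 1" "\<And>n. N (a n) < inverse (real (Suc n))" by metis
  have aN: "(\<lambda>n. N (a n)) \<longlonglongrightarrow> 0"
    by (rule Lim_null_comparison[OF always_eventually LIMSEQ_inverse_real_of_nat])
      (use a(2) in \<open>auto intro: less_imp_le\<close>)
  have "norm_Cauchy N a"
    by (rule N.norm_Cauchy_close[OF N.norm_Cauchy_const[of 0]]) (simp add: aN)
  hence "norm_Cauchy (tilde_norm G N) a"
    by (simp add: norm_Cauchy_def tilde_norm_def a(1))
  with a(1) aN show ?thesis by blast
qed

text \<open>If the counit is not \<open>N\<close>-bounded, some \<open>a\<^sub>n\<close> satisfy \<open>\<epsilon>(a\<^sub>n) = 1\<close> and \<open>N(a\<^sub>n) \<rightarrow> 0\<close>. They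
  are Cauchy in the norm \<open>max N |\<epsilon>|\<close>; surjectivity of the canonical map lifts their limit to the
  maximal completion, and injectivity turns \<open>a p = \<epsilon>(a) p\<close> in the quotient into the same identity
  upstairs: the limit \<open>p\<close> of \<open>b\<^sub>n\<close> is the Kazhdan projection.\<close>

lemma kazhdan_sequence:
  assumes N: "cstar_norm N" and unb: "\<not> (\<exists>K. \<forall>a. cmod (cou a) \<le> K * N a)"
    and iso: "canonical_iso (max_norm :: 'a \<Rightarrow> real) (tilde_norm G N)"
  obtains b where "norm_Cauchy max_norm b" "(\<lambda>n. cou (b n)) \<longlonglongrightarrow> 1"
    "\<And>a. (\<lambda>n. max_norm (a * b n - cou a *\<^sub>C b n)) \<longlonglongrightarrow> 0"
proof -
  let ?T = "tilde_norm G N"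
  interpret N: cstar_normed N by unfold_locales fact
  interpret M: cstar_normed "max_norm :: 'a \<Rightarrow> real" by unfold_locales (rule cstar_norm_max_norm[OF N])
  have T: "cstar_norm ?T" by (rule cstar_normed_tilde_norm[OF N counit_hom])
  interpret T: cstar_normed ?T by unfold_locales fact
  interpret MT: cstar_dominated "max_norm :: 'a \<Rightarrow> real" ?T 1
    by unfold_locales (simp_all add: le_max_norm T)
  obtain a where a: "\<And>n. cou (a n) = 1" "norm_Cauchy ?T a" and aN: "(\<lambda>n. N (a n)) \<longlonglongrightarrow> 0"
    using unbounded_counit_sequence[OF N unb] by blast
  obtain b where b: "norm_Cauchy max_norm b" "(\<lambda>n. ?T (b n - a n)) \<longlonglongrightarrow> 0"
    by (rule MT.canonical_iso_lift[OF iso a(2)])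
  have bN: "(\<lambda>n. N (b n - a n)) \<longlonglongrightarrow> 0" and bc: "(\<lambda>n. cou (b n) - 1) \<longlonglongrightarrow> 0"
    by (rule Lim_null_comparison[OF always_eventually b(2)], simp add: tilde_norm_def a(1))+
  have bN0: "(\<lambda>n. N (b n)) \<longlonglongrightarrow> 0" using N.null_add[OF bN aN] by simp
  have "(\<lambda>n. max_norm (x * b n - cou x *\<^sub>C b n)) \<longlonglongrightarrow> 0" for x
  proof (rule MT.canonical_iso_null[OF iso])
    show "norm_Cauchy max_norm (\<lambda>n. x * b n - cou x *\<^sub>C b n)"
      by (intro M.norm_Cauchy_diff M.norm_Cauchy_mult M.norm_Cauchy_const M.norm_Cauchy_scaleC b)
    have "(\<lambda>n. N (x * b n + (- cou x) *\<^sub>C b n)) \<longlonglongrightarrow> 0"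
      by (intro N.null_add N.null_scaleC bN0 N.null_mult_left[of _ _ "N x"]) simp
    thus "(\<lambda>n. ?T (x * b n - cou x *\<^sub>C b n)) \<longlonglongrightarrow> 0"
      by (simp add: tilde_norm_def)
  qed
  with b(1) bc show ?thesis by (intro that[of b]) (auto simp: LIM_zero_iff)
qed

end

section \<open>Representations on \<open>\<ell>\<^sup>2\<close>\<close>

lemma norm_mult_le_squares: "cmod (x * cnj y) \<le> (cmod x)\<^sup>2 + (cmod y)\<^sup>2"
proof -
  have "cmod (x * cnj y) = cmod x * cmod y" by (simp add: norm_mult)
  moreover have "0 \<le> cmod x * cmod y" by simp
  ultimately show ?thesis using sum_squares_bound[of "cmod x" "cmod y"] by linarith
qed

lemma ell2_inner_summable:
  assumes "x \<in> ell2 I" "y \<in> ell2 I"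
  shows "(\<lambda>i. x i * cnj (y i)) summable_on UNIV"
proof (rule abs_summable_summable)
  have "(\<lambda>i. (cmod (x i))\<^sup>2 + (cmod (y i))\<^sup>2) summable_on UNIV"
    using assms by (intro summable_on_add) (auto simp: ell2_def)
  thus "(\<lambda>i. norm (x i * cnj (y i))) summable_on UNIV"
    by (rule summable_on_comparison_test) (auto simp del: complex_cnj_mult intro: norm_mult_le_squares)
qed

lemma ell2_square_summable: "x \<in> ell2 I \<Longrightarrow> (\<lambda>i. (cmod (x i))\<^sup>2) summable_on UNIV"
  by (simp add: ell2_def)

lemma ell2_scale:
  assumes "x \<in> ell2 I"
  shows "(\<lambda>i. c * x i) \<in> ell2 I"
  using assms summable_on_cmult_right[of "\<lambda>i. (cmod (x i))\<^sup>2" UNIV "(cmod c)\<^sup>2"]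
  by (simp add: ell2_def norm_mult power_mult_distrib)

lemma norm_add_square_le: "(cmod (x + y))\<^sup>2 \<le> 2 * ((cmod x)\<^sup>2 + (cmod y)\<^sup>2)"
proof -
  have "(cmod (x + y))\<^sup>2 \<le> (cmod x + cmod y)\<^sup>2"
    by (intro power_mono norm_triangle_ineq) simp
  also have "\<dots> \<le> 2 * ((cmod x)\<^sup>2 + (cmod y)\<^sup>2)"
    using sum_squares_bound[of "cmod x" "cmod y"] by (simp add: power2_sum)
  finally show ?thesis .
qed

lemma ell2_add:
  assumes "x \<in> ell2 I" "y \<in> ell2 I"
  shows "(\<lambda>i. x i + y i) \<in> ell2 I"
proof -
  have "(\<lambda>i. 2 * ((cmod (x i))\<^sup>2 + (cmod (y i))\<^sup>2)) summable_on UNIV"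
    using assms by (intro summable_on_cmult_right summable_on_add) (auto simp: ell2_def)
  hence "(\<lambda>i. (cmod (x i + y i))\<^sup>2) summable_on UNIV"
    by (rule summable_on_comparison_test) (simp_all only: norm_add_square_le zero_le_power2)
  thus ?thesis using assms by (simp add: ell2_def)
qed

lemma ell2_diff: "x \<in> ell2 I \<Longrightarrow> y \<in> ell2 I \<Longrightarrow> (\<lambda>i. x i - y i) \<in> ell2 I"
  using ell2_add[OF _ ell2_scale[of y I "- 1"], of x] by simp

lemma l2_inner_add_left:
  "x \<in> ell2 I \<Longrightarrow> y \<in> ell2 I \<Longrightarrow> z \<in> ell2 I \<Longrightarrow>
    l2_inner (\<lambda>i. x i + y i) z = l2_inner x z + l2_inner y z"
  using infsum_add[OF ell2_inner_summable ell2_inner_summable, of x I z y I z]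
  by (simp add: l2_inner_def distrib_right)

lemma l2_inner_scale_left: "l2_inner (\<lambda>i. c * x i) z = c * l2_inner x z"
  by (simp add: l2_inner_def infsum_cmult_right' mult.assoc)

lemma l2_inner_commute: "l2_inner y x = cnj (l2_inner x y)"
  by (simp add: l2_inner_def mult.commute flip: infsum_cnj)

lemma l2_inner_add_right:
  "x \<in> ell2 I \<Longrightarrow> y \<in> ell2 I \<Longrightarrow> z \<in> ell2 I \<Longrightarrow>
    l2_inner z (\<lambda>i. x i + y i) = l2_inner z x + l2_inner z y"
  using l2_inner_add_left[of x I y z] by (metis complex_cnj_add l2_inner_commute)

lemma l2_inner_scale_right: "l2_inner z (\<lambda>i. c * x i) = cnj c * l2_inner z x"
  using l2_inner_scale_left[of c x z] by (metis complex_cnj_mult l2_inner_commute)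

lemma l2_inner_self:
  assumes "x \<in> ell2 I"
  shows "l2_inner x x = of_real ((l2_norm x)\<^sup>2)"
proof -
  have "l2_inner x x = (\<Sum>\<^sub>\<infinity>i. of_real ((cmod (x i))\<^sup>2))"
    by (simp add: l2_inner_def complex_norm_square del: of_real_power)
  also have "\<dots> = of_real (\<Sum>\<^sub>\<infinity>i. (cmod (x i))\<^sup>2)"
    using ell2_square_summable[OF assms]
    by (intro infsumI) (simp only: has_sum_of_real_iff has_sum_infsum)
  also have "(\<Sum>\<^sub>\<infinity>i. (cmod (x i))\<^sup>2) = (l2_norm x)\<^sup>2"
    by (simp add: l2_norm_def infsum_nonneg)
  finally show ?thesis .
qed

lemma l2_norm_nonneg [simp]: "l2_norm x \<ge> 0"
  by (simp add: l2_norm_def infsum_nonneg)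

lemma l2_norm_zero [simp]: "l2_norm (\<lambda>_. 0) = 0"
  by (simp add: l2_norm_def)

lemma l2_norm_scale: "x \<in> ell2 I \<Longrightarrow> (l2_norm (\<lambda>i. c * x i))\<^sup>2 = (cmod c)\<^sup>2 * (l2_norm x)\<^sup>2"
proof -
  assume x: "x \<in> ell2 I"
  have "of_real ((l2_norm (\<lambda>i. c * x i))\<^sup>2) = (of_real ((cmod c)\<^sup>2 * (l2_norm x)\<^sup>2) :: complex)"
    using l2_inner_self[OF ell2_scale[OF x, of c]] l2_inner_self[OF x] complex_norm_square[of c]
    by (simp add: l2_inner_scale_left l2_inner_scale_right mult.assoc)
  thus ?thesis by (simp only: of_real_eq_iff)
qed

lemma l2_norm_add_square:
  assumes "x \<in> ell2 I" "y \<in> ell2 I"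
  shows "(l2_norm (\<lambda>i. x i + y i))\<^sup>2 \<le> 2 * (l2_norm x)\<^sup>2 + 2 * (l2_norm y)\<^sup>2"
proof -
  note sx = ell2_square_summable[OF assms(1)] and sy = ell2_square_summable[OF assms(2)]
  have "(\<Sum>\<^sub>\<infinity>i. (cmod (x i + y i))\<^sup>2) \<le> (\<Sum>\<^sub>\<infinity>i. 2 * ((cmod (x i))\<^sup>2 + (cmod (y i))\<^sup>2))"
    using ell2_square_summable[OF ell2_add[OF assms]] sx sy
    by (intro infsum_mono summable_on_cmult_right summable_on_add) (auto simp only: norm_add_square_le)
  also have "\<dots> = 2 * ((\<Sum>\<^sub>\<infinity>i. (cmod (x i))\<^sup>2) + (\<Sum>\<^sub>\<infinity>i. (cmod (y i))\<^sup>2))"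
    unfolding infsum_cmult_right' infsum_add[OF sx sy] ..
  finally show ?thesis by (simp add: l2_norm_def infsum_nonneg)
qed

context cstar_normed
begin

lemma norm_Cauchy_sqrt_poly:
  assumes h: "norm_Cauchy N h" "\<And>n. N (h n) \<le> r" and r: "r < 1"
  shows "norm_Cauchy N (\<lambda>n. sqrt_poly n (h n))"
  unfolding norm_Cauchy_def
proof (intro allI impI)
  fix e :: real assume e: "e > 0"
  have r0: "0 \<le> r" using h(2)[of 0] N_nonneg[of "h 0"] by linarith
  have "summable (\<lambda>n. r ^ n)" using r0 r by simp
  then obtain K where K: "\<And>m n. m \<ge> K \<Longrightarrow> norm (\<Sum>k\<in>{m..<n}. r ^ k) < e / 3"
    unfolding summable_Cauchy using e by (meson divide_pos_pos zero_less_numeral)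
  have tail: "N (sqrt_poly m (h n) - sqrt_poly K (h n)) < e / 3" if "m \<ge> K" for m n
  proof -
    have "{..m} = {..K} \<union> {Suc K..<Suc m}" "{..K} \<inter> {Suc K..<Suc m} = {}" using that by auto
    hence "sqrt_poly m (h n) - sqrt_poly K (h n) =
        (\<Sum>k\<in>{Suc K..<Suc m}. of_real (sqrt_coeff k) *\<^sub>C h n ^ k)"
      by (simp add: sqrt_poly_def sum.union_disjoint)
    also have "N \<dots> \<le> (\<Sum>k\<in>{Suc K..<Suc m}. r ^ k)"
    proof (rule order_trans[OF N_sum sum_mono])
      fix k
      have "\<bar>sqrt_coeff k\<bar> * N (h n ^ k) \<le> 1 * r ^ k"
        using N_power[of "h n" k] power_mono[OF h(2)[of n] N_nonneg, of k]
        by (intro mult_mono sqrt_coeff_le_1) auto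
      thus "N (of_real (sqrt_coeff k) *\<^sub>C h n ^ k) \<le> r ^ k"
        unfolding N_scaleC norm_of_real by simp
    qed
    also have "\<dots> < e / 3" using K[of "Suc K" "Suc m"] by simp
    finally show ?thesis .
  qed
  have "norm_Cauchy N (\<lambda>n. sqrt_poly K (h n))"
    unfolding sqrt_poly_def
    by (intro norm_Cauchy_sum norm_Cauchy_scaleC norm_Cauchy_power h)
  then obtain M where M: "\<And>m n. m \<ge> M \<Longrightarrow> n \<ge> M \<Longrightarrow> N (sqrt_poly K (h m) - sqrt_poly K (h n)) < e / 3"
    using norm_CauchyD[of _ "e / 3"] e by fastforce
  have "N (sqrt_poly m (h m) - sqrt_poly n (h n)) < e" if "m \<ge> max M K" "n \<ge> max M K" for m n
    using tail[of m m] tail[of n n] M[of m n] that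
      N_diff_triangle[of "sqrt_poly m (h m)" "sqrt_poly n (h n)" "sqrt_poly K (h m)"]
      N_diff_triangle[of "sqrt_poly K (h m)" "sqrt_poly n (h n)" "sqrt_poly K (h n)"]
      N_minus_commute[of "sqrt_poly n (h n)" "sqrt_poly K (h n)"] by simp
  thus "\<exists>M. \<forall>m\<ge>M. \<forall>n\<ge>M. N (sqrt_poly m (h m) - sqrt_poly n (h n)) < e" by blast
qed

end

locale cstar_rep = cstar_normed N for N :: "'a::complex_star_algebra \<Rightarrow> real" +
  fixes I :: "'k set" and \<pi> :: "(nat \<Rightarrow> 'a) set \<Rightarrow> ('k \<Rightarrow> complex) \<Rightarrow> 'k \<Rightarrow> complex"
  assumes rep: "sa_rep (cstar_completion N) I \<pi>"
begin

lemma pi_ell2: "X \<in> sa_carrier (cstar_completion N) \<Longrightarrow> x \<in> ell2 I \<Longrightarrow> \<pi> X x \<in> ell2 I"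
  using rep by (simp add: sa_rep_def bounded_op_def)

lemma pi_class_ell2: "norm_Cauchy N s \<Longrightarrow> x \<in> ell2 I \<Longrightarrow> \<pi> (cauchy_class N s) x \<in> ell2 I"
  by (simp add: pi_ell2 class_in_carrier)

lemma pi_emb_ell2: "x \<in> ell2 I \<Longrightarrow> \<pi> (emb N a) x \<in> ell2 I"
  by (simp add: pi_ell2 emb_in_carrier)

lemma pi_class_add:
  "norm_Cauchy N s \<Longrightarrow> norm_Cauchy N t \<Longrightarrow> x \<in> ell2 I \<Longrightarrow>
    \<pi> (cauchy_class N (\<lambda>n. s n + t n)) x = (\<lambda>i. \<pi> (cauchy_class N s) x i + \<pi> (cauchy_class N t) x i)"
  using rep by (simp add: sa_rep_def class_in_carrier flip: completion_add)

lemma pi_class_scale: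
  "norm_Cauchy N s \<Longrightarrow> x \<in> ell2 I \<Longrightarrow>
    \<pi> (cauchy_class N (\<lambda>n. c *\<^sub>C s n)) x = (\<lambda>i. c * \<pi> (cauchy_class N s) x i)"
  using rep by (simp add: sa_rep_def class_in_carrier flip: completion_scale)

lemma pi_class_mult:
  "norm_Cauchy N s \<Longrightarrow> norm_Cauchy N t \<Longrightarrow> x \<in> ell2 I \<Longrightarrow>
    \<pi> (cauchy_class N (\<lambda>n. s n * t n)) x = \<pi> (cauchy_class N s) (\<pi> (cauchy_class N t) x)"
  using rep by (simp add: sa_rep_def class_in_carrier flip: completion_mult)

lemma pi_one: "x \<in> ell2 I \<Longrightarrow> \<pi> (cauchy_class N (\<lambda>_. 1)) x = x"
  using rep by (simp add: sa_rep_def cstar_completion_simps)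

lemma pi_class_star:
  "norm_Cauchy N s \<Longrightarrow> x \<in> ell2 I \<Longrightarrow> y \<in> ell2 I \<Longrightarrow>
    l2_inner (\<pi> (cauchy_class N s) x) y = l2_inner x (\<pi> (cauchy_class N (\<lambda>n. star (s n))) y)"
  using rep by (simp add: sa_rep_def class_in_carrier flip: completion_star)

lemma pi_emb_add: "x \<in> ell2 I \<Longrightarrow> \<pi> (emb N (a + b)) x = (\<lambda>i. \<pi> (emb N a) x i + \<pi> (emb N b) x i)"
  and pi_emb_scale: "x \<in> ell2 I \<Longrightarrow> \<pi> (emb N (c *\<^sub>C a)) x = (\<lambda>i. c * \<pi> (emb N a) x i)"
  using pi_class_add[OF norm_Cauchy_const norm_Cauchy_const] pi_class_scale[OF norm_Cauchy_const]
  by (simp_all add: emb_def)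

lemma pi_emb_zero: "x \<in> ell2 I \<Longrightarrow> \<pi> (emb N 0) x = (\<lambda>i. 0)"
  using pi_emb_scale[of x 0 0] by simp

lemma norm_pi_class:
  assumes "norm_Cauchy N s" "x \<in> ell2 I"
  shows "of_real ((l2_norm (\<pi> (cauchy_class N s) x))\<^sup>2) =
    l2_inner (\<pi> (cauchy_class N (\<lambda>n. star (s n) * s n)) x) x"
proof -
  let ?y = "\<pi> (cauchy_class N s) x"
  have y: "?y \<in> ell2 I" using assms by (rule pi_class_ell2)
  have "l2_inner (\<pi> (cauchy_class N (\<lambda>n. star (s n) * s n)) x) x =
      l2_inner (\<pi> (cauchy_class N (\<lambda>n. star (s n))) ?y) x"
    using assms by (simp add: pi_class_mult norm_Cauchy_star)
  also have "\<dots> = l2_inner ?y (\<pi> (cauchy_class N (\<lambda>n. star (star (s n)))) x)"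
    by (rule pi_class_star) (use assms y in \<open>simp_all add: norm_Cauchy_star\<close>)
  also have "\<dots> = of_real ((l2_norm ?y)\<^sup>2)" using l2_inner_self[OF y] by (simp add: star_star)
  finally show ?thesis by simp
qed

text \<open>The approximate square roots \<open>y\<^sub>n\<close> of \<open>1 - s\<^sub>n\<^sup>* s\<^sub>n\<close> define an element \<open>Y\<close> of the completion with
  \<open>\<parallel>x\<parallel>\<^sup>2 = \<parallel>\<pi>(X)x\<parallel>\<^sup>2 + \<parallel>\<pi>(Y)x\<parallel>\<^sup>2\<close>.\<close>

lemma pi_contractive:
  assumes s: "norm_Cauchy N s" "\<And>n. N (s n) \<le> r" "r < 1" and x: "x \<in> ell2 I"
  shows "(l2_norm (\<pi> (cauchy_class N s) x))\<^sup>2 \<le> (l2_norm x)\<^sup>2"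
proof -
  have r0: "0 \<le> r" using s(2)[of 0] N_nonneg[of "s 0"] by linarith
  define h where "h = (\<lambda>n. star (s n) * s n)"
  define y where "y = (\<lambda>n. sqrt_poly n (h n))"
  have hC: "norm_Cauchy N h" unfolding h_def by (intro norm_Cauchy_mult norm_Cauchy_star s)
  have hr: "N (h n) \<le> r\<^sup>2" for n
    using power_mono[OF s(2)[of n] N_nonneg, of 2] by (simp add: h_def N_star_mult)
  have r2: "r\<^sup>2 < 1" using r0 s(3) by (simp add: power_less_one_iff)
  have yC: "norm_Cauchy N y" unfolding y_def by (rule norm_Cauchy_sqrt_poly[OF hC hr r2])
  have sy: "star (y n) = y n" for n by (simp add: y_def star_sqrt_poly h_def star_simps)
  have lim: "(\<lambda>n. N ((y n * y n + h n) - 1)) \<longlonglongrightarrow> 0"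
  proof (rule Lim_null_comparison[OF _ poly_geometric_tendsto_0[of "r\<^sup>2"]])
    show "\<forall>\<^sub>F n in sequentially. norm (N ((y n * y n + h n) - 1)) \<le> (real n + 1)\<^sup>2 * (r\<^sup>2) ^ n"
    proof (rule eventually_sequentiallyI[of 1])
      fix n :: nat assume "n \<ge> 1"
      from N_sqrt_poly_square[OF this hr, of n] r2
      show "norm (N ((y n * y n + h n) - 1)) \<le> (real n + 1)\<^sup>2 * (r\<^sup>2) ^ n"
        by (simp add: y_def algebra_simps)
    qed
  qed (use r2 in auto)
  have cls: "cauchy_class N (\<lambda>n. y n * y n + h n) = cauchy_class N (\<lambda>_. 1)"
    by (rule cauchy_class_eqI[OF lim])
  have yy: "norm_Cauchy N (\<lambda>n. y n * y n)" using yC by (intro norm_Cauchy_mult)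
  have "l2_inner x x = l2_inner (\<pi> (cauchy_class N (\<lambda>n. y n * y n + h n)) x) x"
    unfolding cls pi_one[OF x] ..
  also have "\<dots> = l2_inner (\<pi> (cauchy_class N (\<lambda>n. y n * y n)) x) x + l2_inner (\<pi> (cauchy_class N h) x) x"
    unfolding pi_class_add[OF yy hC x]
    by (rule l2_inner_add_left) (use x yy hC in \<open>simp_all add: pi_class_ell2\<close>)
  also have "\<dots> = of_real ((l2_norm (\<pi> (cauchy_class N y) x))\<^sup>2 + (l2_norm (\<pi> (cauchy_class N s) x))\<^sup>2)"
    using norm_pi_class[OF yC x] norm_pi_class[OF s(1) x] by (simp add: sy h_def)
  finally have "(l2_norm x)\<^sup>2 = (l2_norm (\<pi> (cauchy_class N y) x))\<^sup>2 + (l2_norm (\<pi> (cauchy_class N s) x))\<^sup>2"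
    unfolding l2_inner_self[OF x] of_real_eq_iff .
  thus ?thesis by simp
qed

end

section \<open>Positive semidefinite forms\<close>

locale psd_form =
  fixes q :: "'v::complex_vector \<Rightarrow> 'v \<Rightarrow> complex"
  assumes add_left: "q (x + y) z = q x z + q y z"
    and scale_left: "q (c *\<^sub>C x) z = c * q x z"
    and hermitian: "q y x = cnj (q x y)"
    and nonneg: "Re (q x x) \<ge> 0"
begin

lemma add_right: "q z (x + y) = q z x + q z y"
  using add_left[of x y z] by (metis complex_cnj_add hermitian)

lemma scale_right: "q z (c *\<^sub>C x) = cnj c * q z x"
  using scale_left[of c x z] by (metis complex_cnj_mult hermitian)

lemma zero_left [simp]: "q 0 z = 0" and zero_right [simp]: "q z 0 = 0"
  using scale_left[of 0 0 z] scale_right[of z 0 0] by simp_all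

lemma minus_left: "q (- x) z = - q x z" and minus_right: "q z (- x) = - q z x"
  using scale_left[of "- 1" x z] scale_right[of z "- 1" x] by (simp_all add: scaleC_one)

lemma diff_left: "q (x - y) z = q x z - q y z" and diff_right: "q z (x - y) = q z x - q z y"
  using add_left[of x "- y" z] add_right[of z x "- y"] by (simp_all add: minus_left minus_right)

lemma sum_left: "q (sum f A) z = (\<Sum>i\<in>A. q (f i) z)" and sum_right: "q z (sum f A) = (\<Sum>i\<in>A. q z (f i))"
  by (induction A rule: infinite_finite_induct) (simp_all add: add_left add_right)

lemma self_real: "q x x = of_real (Re (q x x))"
  using hermitian[of x x] by (simp add: complex_eq_iff)

lemma Cauchy_Schwarz: "(cmod (q x y))\<^sup>2 \<le> Re (q x x) * Re (q y y)"
proof -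
  define c where "c = q x y"
  have key: "0 \<le> Re (q x x) - 2 * t * (cmod c)\<^sup>2 + t\<^sup>2 * (cmod c)\<^sup>2 * Re (q y y)" for t :: real
  proof -
    define d where "d = of_real t * c"
    have "q (x - d *\<^sub>C y) (x - d *\<^sub>C y) = q x x - cnj d * c - d * cnj c + d * cnj d * q y y"
      by (simp add: diff_left diff_right scale_left scale_right c_def hermitian[of y x] algebra_simps)
    also have "\<dots> = q x x - 2 * of_real t * (c * cnj c) + of_real t * of_real t * (c * cnj c) * q y y"
      by (simp add: d_def algebra_simps)
    also have "\<dots> = of_real (Re (q x x) - 2 * t * (cmod c)\<^sup>2 + t\<^sup>2 * (cmod c)\<^sup>2 * Re (q y y))"
      using self_real[of x] self_real[of y] unfolding complex_norm_square[symmetric]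
      by (metis (no_types, lifting) of_real_add of_real_diff of_real_mult of_real_numeral power2_eq_square)
    finally show ?thesis using nonneg[of "x - d *\<^sub>C y"] by simp
  qed
  show ?thesis
  proof (cases "Re (q y y) = 0")
    case True
    have "cmod c = 0"
    proof (rule ccontr)
      assume "cmod c \<noteq> 0"
      hence "(cmod c)\<^sup>2 > 0" by simp
      define t where "t = (Re (q x x) + 1) / (cmod c)\<^sup>2"
      have "t * (cmod c)\<^sup>2 = Re (q x x) + 1" using \<open>(cmod c)\<^sup>2 > 0\<close> by (simp add: t_def)
      moreover have "0 \<le> Re (q x x) - 2 * (t * (cmod c)\<^sup>2)" using key[of t] True by (simp add: mult.assoc)
      ultimately show False using nonneg[of x] by linarith
    qed
    thus ?thesis by (simp add: c_def True)
  next
    case False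
    hence pos: "Re (q y y) > 0" using nonneg[of y] by simp
    have "0 \<le> Re (q x x) - (cmod c)\<^sup>2 / Re (q y y)"
      using key[of "1 / Re (q y y)"] pos by (simp add: power2_eq_square field_simps)
    thus ?thesis using pos by (simp add: c_def field_simps)
  qed
qed

lemma null_left: "Re (q x x) = 0 \<Longrightarrow> q x y = 0" and null_right: "Re (q y y) = 0 \<Longrightarrow> q x y = 0"
  using Cauchy_Schwarz[of x y] by auto

definition nrm :: "'v \<Rightarrow> real" where "nrm x = sqrt (Re (q x x))"

lemma nrm_nonneg [simp]: "nrm x \<ge> 0"
  by (simp add: nrm_def nonneg)

lemma nrm_square: "(nrm x)\<^sup>2 = Re (q x x)"
  by (simp add: nrm_def nonneg)

lemma inner_le_nrm: "cmod (q x y) \<le> nrm x * nrm y"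
  using Cauchy_Schwarz[of x y] by (simp add: nrm_def real_le_rsqrt flip: real_sqrt_mult)

lemma nrm_add: "nrm (x + y) \<le> nrm x + nrm y"
proof -
  have "(nrm (x + y))\<^sup>2 = (nrm x)\<^sup>2 + 2 * Re (q x y) + (nrm y)\<^sup>2"
    using hermitian[of y x] by (simp add: nrm_square add_left add_right)
  also have "Re (q x y) \<le> nrm x * nrm y"
    by (rule order_trans[OF complex_Re_le_cmod inner_le_nrm])
  finally have "(nrm (x + y))\<^sup>2 \<le> (nrm x + nrm y)\<^sup>2" by (simp add: power2_sum)
  thus ?thesis by (rule power2_le_imp_le) simp
qed

lemma nrm_scale: "nrm (c *\<^sub>C x) = cmod c * nrm x"
proof -
  have "q (c *\<^sub>C x) (c *\<^sub>C x) = of_real ((cmod c)\<^sup>2) * q x x"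
    by (simp add: scale_left scale_right complex_norm_square mult_ac del: of_real_power)
  thus ?thesis by (simp add: nrm_def real_sqrt_mult)
qed

definition orthonormal :: "'v list \<Rightarrow> bool" where
  "orthonormal es \<longleftrightarrow> (\<forall>i<length es. \<forall>j<length es. q (es ! i) (es ! j) = (if i = j then 1 else 0))"

definition proj :: "'v list \<Rightarrow> 'v \<Rightarrow> 'v" where
  "proj es x = (\<Sum>i<length es. q x (es ! i) *\<^sub>C es ! i)"

lemma proj_add: "proj es (x + y) = proj es x + proj es y"
  and proj_scale: "proj es (c *\<^sub>C x) = c *\<^sub>C proj es x"
  and proj_zero: "proj es 0 = 0"
  by (simp_all add: proj_def add_left scale_left scaleC_add_left sum.distrib CV.scale_sum_right scaleC_scaleC)

lemma proj_inner:
  assumes "orthonormal es" "j < length es"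
  shows "q (proj es x) (es ! j) = q x (es ! j)"
proof -
  have "q (proj es x) (es ! j) = (\<Sum>i<length es. if i = j then q x (es ! i) else 0)"
    unfolding proj_def sum_left scale_left
    by (rule sum.cong) (use assms in \<open>auto simp: orthonormal_def\<close>)
  thus ?thesis using assms(2) by simp
qed

lemma residual_orthogonal:
  assumes "orthonormal es" "j < length es"
  shows "q (x - proj es x) (es ! j) = 0"
  by (simp add: diff_left proj_inner assms)

lemma residual_norm:
  assumes "orthonormal es"
  shows "Re (q (x - proj es x) (x - proj es x)) = Re (q x x) - (\<Sum>i<length es. (cmod (q x (es ! i)))\<^sup>2)"
proof -
  have "q (x - proj es x) (proj es x) = 0"
    unfolding proj_def[of es x] sum_right scale_right
    using residual_orthogonal[OF assms, of _ x] by (simp add: proj_def)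
  hence "q (x - proj es x) (x - proj es x) = q (x - proj es x) x" by (simp add: diff_right)
  also have "\<dots> = q x x - (\<Sum>i<length es. q x (es ! i) * q (es ! i) x)"
    by (simp add: diff_left proj_def sum_left scale_left)
  also have "(\<Sum>i<length es. q x (es ! i) * q (es ! i) x) = of_real (\<Sum>i<length es. (cmod (q x (es ! i)))\<^sup>2)"
    unfolding of_real_sum complex_norm_square using hermitian[of _ x] by metis
  finally show ?thesis by simp
qed

lemma orthonormal_extend:
  assumes es: "orthonormal es" and r: "Re (q r r) > 0" "\<And>j. j < length es \<Longrightarrow> q r (es ! j) = 0"
  defines "e \<equiv> of_real (1 / sqrt (Re (q r r))) *\<^sub>C r"
  shows "orthonormal (es @ [e])"
proof -
  have "q e e = of_real (1 / sqrt (Re (q r r)) * (1 / sqrt (Re (q r r))) * Re (q r r))"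
    using self_real[of r] unfolding of_real_mult by (simp add: e_def scale_left scale_right)
  also have "\<dots> = 1" using r(1) by simp
  finally have "q e e = 1" .
  moreover have "q e (es ! j) = 0" "q (es ! j) e = 0" if "j < length es" for j
    using r(2)[OF that] hermitian[of "es ! j" r] by (simp_all add: e_def scale_left scale_right)
  ultimately show ?thesis
    using es by (auto simp: orthonormal_def nth_append less_Suc_eq)
qed

text \<open>For a semidefinite form the expansion in the orthonormal family holds up to null vectors.\<close>

lemma Gram_Schmidt:
  assumes W: "CV.subspace W" and X: "finite X" "X \<subseteq> W"
  shows "\<exists>es. orthonormal es \<and> set es \<subseteq> W \<and>
    (\<forall>x\<in>CV.span X. Re (q (x - proj es x) (x - proj es x)) = 0)"
proof -
  have "\<exists>es. orthonormal es \<and> set es \<subseteq> W \<and> (\<forall>x\<in>X. Re (q (x - proj es x) (x - proj es x)) = 0)"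
    using X
  proof (induction X rule: finite_induct)
    case empty
    show ?case by (rule exI[of _ "[]"]) (simp add: orthonormal_def)
  next
    case (insert x X)
    then obtain es where es: "orthonormal es" "set es \<subseteq> W"
      "\<And>y. y \<in> X \<Longrightarrow> Re (q (y - proj es y) (y - proj es y)) = 0" by auto
    define r where "r = x - proj es x"
    show ?case
    proof (cases "Re (q r r) = 0")
      case True
      thus ?thesis using es by (auto simp: r_def)
    next
      case False
      hence r: "Re (q r r) > 0" using nonneg[of r] by simp
      have ro: "q r (es ! j) = 0" if "j < length es" for j
        using residual_orthogonal[OF es(1) that] by (simp add: r_def)
      define e where "e = of_real (1 / sqrt (Re (q r r))) *\<^sub>C r"
      have o: "orthonormal (es @ [e])"
        unfolding e_def by (rule orthonormal_extend[OF es(1) r ro])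
      have eo: "q (es ! j) e = 0" if "j < length es" for j
        using o[unfolded orthonormal_def, rule_format, of j "length es"] that by (simp add: nth_append)
      have p: "proj (es @ [e]) y = proj es y + q y e *\<^sub>C e" for y
        by (simp add: proj_def nth_append)
      have pe: "q (proj es y) e = 0" for y
        by (simp add: proj_def sum_left scale_left eo)
      have "Re (q (y - proj (es @ [e]) y) (y - proj (es @ [e]) y)) = 0" if "y \<in> insert x X" for y
      proof (cases "y = x")
        case True
        have "q x e = q r e" using pe[of x] by (simp add: r_def diff_left)
        also have "\<dots> = of_real (1 / sqrt (Re (q r r)) * Re (q r r))"
          using self_real[of r] unfolding of_real_mult e_def scale_right by simp
        also have "1 / sqrt (Re (q r r)) * Re (q r r) = sqrt (Re (q r r))"
          using r by (simp add: real_div_sqrt)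
        finally have "q x e *\<^sub>C e = r"
          using r by (simp add: e_def scaleC_scaleC scaleC_one flip: of_real_mult)
        hence "x - proj (es @ [e]) x = 0" unfolding p by (simp add: r_def)
        thus ?thesis by (simp only: True zero_left zero_complex.sel)
      next
        case False
        hence n: "Re (q (y - proj es y) (y - proj es y)) = 0" using that es(3) by blast
        have "q y e = 0" using null_left[OF n, of e] pe[of y] by (simp add: diff_left)
        thus ?thesis using n by (simp add: p)
      qed
      moreover have "e \<in> W"
        unfolding e_def r_def proj_def using insert.prems es(2) W
        by (intro CV.subspace_scale CV.subspace_diff CV.subspace_sum) auto
      ultimately show ?thesis using o es(2) by (intro exI[of _ "es @ [e]"]) auto
    qed
  qed
  then obtain es where es: "orthonormal es" "set es \<subseteq> W"
    "\<And>x. x \<in> X \<Longrightarrow> Re (q (x - proj es x) (x - proj es x)) = 0" by blast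
  define Z where "Z = {x. Re (q (x - proj es x) (x - proj es x)) = 0}"
  have "CV.subspace Z"
    unfolding CV.subspace_def
  proof (intro conjI ballI allI)
    show "0 \<in> Z" by (simp add: Z_def proj_zero)
    fix x assume x: "x \<in> Z"
    show "c *\<^sub>C x \<in> Z" for c
    proof -
      have "c *\<^sub>C x - proj es (c *\<^sub>C x) = c *\<^sub>C (x - proj es x)"
        by (simp add: proj_scale CV.scale_right_diff_distrib)
      thus ?thesis using x null_left[of "x - proj es x"] by (simp add: Z_def scale_left)
    qed
    fix y assume y: "y \<in> Z"
    have eq: "x + y - proj es (x + y) = (x - proj es x) + (y - proj es y)" by (simp add: proj_add)
    have "q (x - proj es x) z = 0" "q (y - proj es y) z = 0" for z
      using x y null_left by (auto simp: Z_def)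
    thus "x + y \<in> Z" by (simp only: Z_def mem_Collect_eq eq add_left) simp
  qed
  moreover have "X \<subseteq> Z" using es(3) by (auto simp: Z_def)
  ultimately have "CV.span X \<subseteq> Z" by (rule CV.span_minimal[rotated])
  thus ?thesis using es(1,2) by (auto simp: Z_def)
qed

end

section \<open>Algebraic tensor products and slice maps\<close>

lemma cbilinear_elem_tensor: "cbilinear ((\<otimes>\<^sub>C) :: 'a::complex_vector \<Rightarrow> 'b::complex_vector \<Rightarrow> _)"
  unfolding cbilinear_def clinear_def
  by (intro conjI allI; transfer; simp add: tensor_eq_def cbilinear_simps)

lemma clinear_sum: "clinear f \<Longrightarrow> f (sum g A) = (\<Sum>i\<in>A. f (g i))"
  by (induction A rule: infinite_finite_induct) (auto simp: clinear_0 clinear_def)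

lemma cbilinear_clinear: "cbilinear B \<Longrightarrow> clinear (B a)" "cbilinear B \<Longrightarrow> clinear (\<lambda>a. B a b)"
  by (simp_all add: cbilinear_def)

lemmas elem_tensor_simps = cbilinear_simps[OF cbilinear_elem_tensor]

lemma elem_tensor_sum_left: "sum f A \<otimes>\<^sub>C b = (\<Sum>i\<in>A. f i \<otimes>\<^sub>C b)"
  using clinear_sum[OF cbilinear_clinear(2)[OF cbilinear_elem_tensor]] .

lemma elem_tensor_sum_right: "b \<otimes>\<^sub>C sum f A = (\<Sum>i\<in>A. b \<otimes>\<^sub>C f i)"
  using clinear_sum[OF cbilinear_clinear(1)[OF cbilinear_elem_tensor]] .

lemma elem_tensor_mult: "(a \<otimes>\<^sub>C b) * (c \<otimes>\<^sub>C d) = (a * c) \<otimes>\<^sub>C (b * d)"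
  by transfer (simp add: tmul_def tensor_eq_def)

lemma elem_tensor_star: "star (a \<otimes>\<^sub>C b) = star a \<otimes>\<^sub>C star b"
  by transfer (simp add: tensor_eq_def)

lemma elem_tensor_one: "1 \<otimes>\<^sub>C 1 = 1"
  by transfer (simp add: tensor_eq_def)

lemma abs_tensor_list: "abs_tensor L = (\<Sum>(a, b)\<leftarrow>L. a \<otimes>\<^sub>C b)"
proof (induction L)
  case Nil
  show ?case by (simp add: zero_tensor_def)
next
  case (Cons p L)
  have "abs_tensor (p # L) = abs_tensor ([p] @ L)" by simp
  also have "\<dots> = abs_tensor [p] + abs_tensor L" by (rule plus_tensor.abs_eq[symmetric])
  also have "abs_tensor [p] = fst p \<otimes>\<^sub>C snd p" by (simp add: elem_tensor.abs_eq)
  finally show ?case using Cons by (simp add: case_prod_beta)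
qed

lemma tensor_list_rep: "\<exists>L. t = (\<Sum>(a, b)\<leftarrow>L. a \<otimes>\<^sub>C b)"
  by (metis Quotient_abs_rep Quotient_tensor abs_tensor_list)

lemma tensor_induct [case_names zero add elem]:
  assumes "P 0" "\<And>s t. P s \<Longrightarrow> P t \<Longrightarrow> P (s + t)" "\<And>a b. P (a \<otimes>\<^sub>C b)"
  shows "P t"
proof -
  obtain L where "t = (\<Sum>(a, b)\<leftarrow>L. a \<otimes>\<^sub>C b)" using tensor_list_rep by blast
  moreover have "P (\<Sum>(a, b)\<leftarrow>L. a \<otimes>\<^sub>C b)"
    by (induction L) (auto intro: assms)
  ultimately show ?thesis by simp
qed

definition slice_left :: "('a::complex_vector \<Rightarrow> complex) \<Rightarrow> ('a, 'b::complex_vector) tensor \<Rightarrow> 'b" where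
  "slice_left f t = tensor_lift (\<lambda>x y. f x *\<^sub>C y) t"

definition slice_right :: "('b::complex_vector \<Rightarrow> complex) \<Rightarrow> ('a::complex_vector, 'b) tensor \<Rightarrow> 'a" where
  "slice_right f t = tensor_lift (\<lambda>x y. f y *\<^sub>C x) t"

lemma cbilinear_slice:
  assumes "clinear f"
  shows "cbilinear (\<lambda>x y. f x *\<^sub>C y)" "cbilinear (\<lambda>x y. f y *\<^sub>C x)"
  using assms by (auto simp: cbilinear_def clinear_def scaleC_add_left scaleC_add_right scaleC_scaleC
      scaleC_complex_def mult.commute)

lemma clinear_slice_left: "clinear f \<Longrightarrow> clinear (slice_left f)"
  using tensor_lift_clinear[OF cbilinear_slice(1), of f] by (simp add: slice_left_def[abs_def])

lemma clinear_slice_right: "clinear f \<Longrightarrow> clinear (slice_right f)"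
  using tensor_lift_clinear[OF cbilinear_slice(2), of f] by (simp add: slice_right_def[abs_def])

lemma slice_left_elem: "clinear f \<Longrightarrow> slice_left f (a \<otimes>\<^sub>C b) = f a *\<^sub>C b"
  by (simp add: slice_left_def tensor_lift_elem cbilinear_slice)

lemma slice_right_elem: "clinear f \<Longrightarrow> slice_right f (a \<otimes>\<^sub>C b) = f b *\<^sub>C a"
  by (simp add: slice_right_def tensor_lift_elem cbilinear_slice)

lemma clinear_add: "clinear f \<Longrightarrow> f (x + y) = f x + f y"
  and clinear_scaleC: "clinear f \<Longrightarrow> f (c *\<^sub>C x) = c *\<^sub>C f x"
  by (simp_all add: clinear_def)

lemmas slice_left_simps = clinear_add[OF clinear_slice_left] clinear_scaleC[OF clinear_slice_left]
  clinear_sum[OF clinear_slice_left] clinear_0[OF clinear_slice_left] slice_left_elem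

lemmas slice_right_simps = clinear_add[OF clinear_slice_right] clinear_scaleC[OF clinear_slice_right]
  clinear_sum[OF clinear_slice_right] clinear_0[OF clinear_slice_right] slice_right_elem

lemma slice_right_mult_left:
  assumes "clinear f"
  shows "slice_right f ((a \<otimes>\<^sub>C b) * t) = a * slice_right (\<lambda>c. f (b * c)) t"
proof -
  have c: "clinear (\<lambda>c. f (b * c))"
    using assms by (simp add: clinear_def distrib_left mult_scaleC_right)
  show ?thesis
    by (induction t rule: tensor_induct)
      (simp_all add: slice_right_simps assms c distrib_left elem_tensor_mult mult_scaleC_right)
qed

lemma slice_left_sandwich:
  assumes "clinear f"
  shows "slice_left f ((1 \<otimes>\<^sub>C w) * t * (1 \<otimes>\<^sub>C z)) = w * slice_left f t * z"
  by (induction t rule: tensor_induct)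
    (simp_all add: slice_left_simps assms distrib_left distrib_right elem_tensor_mult mult_scaleC_left mult_scaleC_right)

lemma slice_Fubini:
  assumes "clinear f" "clinear g"
  shows "g (slice_left f t) = f (slice_right g t)"
  by (induction t rule: tensor_induct)
    (simp_all add: slice_left_simps slice_right_simps assms clinear_add clinear_0 clinear_scaleC scaleC_complex_def mult.commute)

lemma slice_right_fun_add: "slice_right (\<lambda>c. f c + g c) t = slice_right f t + slice_right g t"
  and slice_right_fun_scale: "slice_right (\<lambda>c. k * f c) t = k *\<^sub>C slice_right f t"
  by (simp_all add: slice_right_def tensor_lift_def scaleC_add_left tsum_add tsum_scaleC[symmetric] scaleC_scaleC)

text \<open>Finitely many vectors can be expanded with linear coordinate functionals that are defined on the
  whole space, so that they can be applied to one leg of a tensor.\<close>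

lemma finite_expansion:
  assumes "finite (X :: 'v::complex_vector set)"
  shows "\<exists>E f. finite E \<and> (\<forall>e. clinear (f e)) \<and> (\<forall>x\<in>X. x = (\<Sum>e\<in>E. f e x *\<^sub>C e))"
proof -
  define B where "B = CV.extend_basis ({} :: 'v set)"
  have B: "CV.independent B" "CV.span B = UNIV"
    unfolding B_def using CV.independent_extend_basis[OF CV.independent_empty] CV.span_extend_basis[OF CV.independent_empty]
    by auto
  define f where "f = (\<lambda>e x. CV.representation B x e)"
  define E where "E = (\<Union>x\<in>X. {e. CV.representation B x e \<noteq> 0})"
  have fin: "finite E" unfolding E_def using assms by (simp add: CV.finite_representation)
  have "clinear (f e)" for e
    unfolding clinear_def f_def using B
    by (auto simp: CV.representation_add CV.representation_scale scaleC_complex_def)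
  moreover have "x = (\<Sum>e\<in>E. f e x *\<^sub>C e)" if "x \<in> X" for x
  proof -
    have "x = (\<Sum>e | CV.representation B x e \<noteq> 0. CV.representation B x e *\<^sub>C e)"
      using CV.sum_nonzero_representation_eq[OF B(1), of x] B(2) by simp
    also have "\<dots> = (\<Sum>e\<in>E. f e x *\<^sub>C e)"
      unfolding f_def by (rule sum.mono_neutral_left) (use fin that in \<open>auto simp: E_def\<close>)
    finally show ?thesis .
  qed
  ultimately show ?thesis using fin by blast
qed

lemma slice_left_corner:
  assumes "clinear f"
  shows "slice_left f ((w \<otimes>\<^sub>C 1) * t * (z \<otimes>\<^sub>C 1)) = slice_left (\<lambda>x. f (w * x * z)) t"
proof -
  have "clinear (\<lambda>x. f (w * x * z))"
    using assms by (simp add: clinear_def distrib_left distrib_right mult_scaleC_left mult_scaleC_right)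
  thus ?thesis
    by (induction t rule: tensor_induct)
      (simp_all add: slice_left_simps assms distrib_left distrib_right elem_tensor_mult)
qed

lemma tensor_indexed_rep:
  obtains k :: nat and a b where "t = (\<Sum>i<k. a i \<otimes>\<^sub>C b i)"
proof -
  obtain L where L: "t = (\<Sum>(a, b)\<leftarrow>L. a \<otimes>\<^sub>C b)" using tensor_list_rep by blast
  hence "t = (\<Sum>i<length L. fst (L ! i) \<otimes>\<^sub>C snd (L ! i))"
    by (simp add: sum_list_sum_nth split_def atLeast0LessThan)
  thus ?thesis by (rule that)
qed

lemma eq_by_functionals:
  assumes "\<And>f :: 'v::complex_vector \<Rightarrow> complex. clinear f \<Longrightarrow> f x = f y"
  shows "x = y"
proof (rule ccontr)
  assume "x \<noteq> y"
  then obtain f :: "'v \<Rightarrow> complex" where "clinear f" "f (x - y) = 1" using ex_functional[of "x - y"] by auto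
  thus False using assms[of f] by (simp add: clinear_diff)
qed

section \<open>Unitary corepresentations\<close>

text \<open>Coordinate vectors become elements of a complex vector space, to which the orthonormalization for
  forms applies.\<close>

instantiation "fun" :: (type, complex_vector) complex_vector
begin
definition "scaleC c f = (\<lambda>x. c *\<^sub>C f x)"
instance
  by standard (auto simp: scaleC_fun_def fun_eq_iff scaleC_add_left scaleC_add_right scaleC_scaleC scaleC_one)
end

lemma sum_fun_apply: "(\<Sum>i\<in>A. f i) x = (\<Sum>i\<in>A. f i x)" for f :: "'i \<Rightarrow> 'x \<Rightarrow> 'v::comm_monoid_add"
  by (induction A rule: infinite_finite_induct) auto

lemma scaleC_cfun_apply: "(c *\<^sub>C x) i = c * x i" for x :: "'k \<Rightarrow> complex"
  by (simp add: scaleC_fun_def scaleC_complex_def)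

lemma sum_delta_scaleC: "finite A \<Longrightarrow> (\<Sum>k\<in>A. (if k = i then 1 else 0) *\<^sub>C f k) = (if i \<in> A then f i else 0)"
  "finite A \<Longrightarrow> (\<Sum>k\<in>A. (if i = k then 1 else 0) *\<^sub>C f k) = (if i \<in> A then f i else 0)"
  for f :: "'i \<Rightarrow> 'v::complex_vector"
proof -
  have "(\<Sum>k\<in>A. (if k = i then 1 else 0) *\<^sub>C f k) = (\<Sum>k\<in>A. if k = i then f k else 0)"
    by (intro sum.cong) (auto simp: scaleC_one)
  moreover have "(\<Sum>k\<in>A. (if i = k then 1 else 0) *\<^sub>C f k) = (\<Sum>k\<in>A. if i = k then f k else 0)"
    by (intro sum.cong) (auto simp: scaleC_one)
  moreover assume "finite A"
  ultimately show "(\<Sum>k\<in>A. (if k = i then 1 else 0) *\<^sub>C f k) = (if i \<in> A then f i else 0)"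
    "(\<Sum>k\<in>A. (if i = k then 1 else 0) *\<^sub>C f k) = (if i \<in> A then f i else 0)" by simp_all
qed

definition cform :: "nat \<Rightarrow> (nat \<Rightarrow> complex) \<Rightarrow> (nat \<Rightarrow> complex) \<Rightarrow> complex" where
  "cform n x y = (\<Sum>i<n. x i * cnj (y i))"

lemma cform_self: "cform n x x = of_real (\<Sum>i<n. (cmod (x i))\<^sup>2)"
  by (simp add: cform_def complex_norm_square del: of_real_power)

interpretation cform: psd_form "cform n" for n
proof
  show "Re (cform n x x) \<ge> 0" for x by (simp add: cform_self sum_nonneg)
qed (simp_all add: cform_def plus_fun_def scaleC_cfun_apply algebra_simps sum.distrib sum_distrib_left)

lemma cform_definite: "x \<in> cvec n \<Longrightarrow> Re (cform n x x) = 0 \<Longrightarrow> x = 0"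
  by (auto simp: cform_self cvec_def fun_eq_iff sum_nonneg_eq_0_iff) (metis lessThan_iff not_le)

lemma cvec_subspace_iff: "cvec_subspace n W \<longleftrightarrow> CV.subspace W \<and> W \<subseteq> cvec n"
  by (auto simp: cvec_subspace_def CV.subspace_def plus_fun_def zero_fun_def scaleC_fun_def scaleC_complex_def)

definition unitvec :: "nat \<Rightarrow> nat \<Rightarrow> complex" where
  "unitvec j = (\<lambda>i. if i = j then 1 else 0)"

lemma unitvec_cvec: "j < n \<Longrightarrow> unitvec j \<in> cvec n"
  by (auto simp: unitvec_def cvec_def)

lemma cvec_expand:
  assumes "x \<in> cvec n"
  shows "x = (\<Sum>j<n. x j *\<^sub>C unitvec j)"
proof
  fix i
  have "(\<Sum>j<n. x j *\<^sub>C unitvec j) i = (\<Sum>j<n. if j = i then x j else 0)"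
    unfolding sum_fun_apply scaleC_cfun_apply unitvec_def by (rule sum.cong) auto
  thus "x i = (\<Sum>j<n. x j *\<^sub>C unitvec j) i" using assms by (auto simp: cvec_def)
qed

lemma subspace_cvec: "CV.subspace (cvec n)"
  by (auto simp: CV.subspace_def cvec_def plus_fun_def zero_fun_def scaleC_cfun_apply)

lemma cvec_subspace_eq:
  assumes "cvec_subspace n W" "\<And>j. j < n \<Longrightarrow> unitvec j \<in> W"
  shows "W = cvec n"
proof -
  have "x \<in> W" if "x \<in> cvec n" for x
    by (subst cvec_expand[OF that])
      (use assms in \<open>auto simp: cvec_subspace_iff intro!: CV.subspace_sum CV.subspace_scale\<close>)
  thus ?thesis using assms(1) by (auto simp: cvec_subspace_iff)
qed

lemma cform_unitvec: "i < n \<Longrightarrow> cform n x (unitvec i) = x i" "i < n \<Longrightarrow> cform n (unitvec i) x = cnj (x i)"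
proof -
  assume i: "i < n"
  have "cform n x (unitvec i) = (\<Sum>k<n. if k = i then x k else 0)"
    unfolding cform_def unitvec_def by (rule sum.cong) auto
  thus 1: "cform n x (unitvec i) = x i" using i by simp
  show "cform n (unitvec i) x = cnj (x i)" using 1 cform.hermitian[of n "unitvec i" x] by simp
qed

text \<open>The residuals of the unit vectors have total squared norm \<open>n - length es\<close>, and one of them is non-zero
  unless the subspace is everything.\<close>

lemma cvec_orthonormal_basis:
  assumes W: "cvec_subspace n W"
  obtains es where "cform.orthonormal n es" "set es \<subseteq> W" "\<forall>w\<in>W. cform.proj n es w = w"
    "W \<noteq> cvec n \<Longrightarrow> length es < n"
proof -
  have sub: "CV.subspace W" "W \<subseteq> cvec n" using W by (auto simp: cvec_subspace_iff)
  obtain B where B: "B \<subseteq> W" "CV.independent B" "W \<subseteq> CV.span B"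
    using CV.maximal_independent_subset by blast
  have "x \<in> CV.span (unitvec ` {..<n})" if "x \<in> cvec n" for x
    by (subst cvec_expand[OF that]) (intro CV.span_sum CV.span_scale CV.span_base, auto)
  hence "B \<subseteq> CV.span (unitvec ` {..<n})" using B(1) sub(2) by blast
  hence fin: "finite B" using CV.independent_span_bound[OF _ B(2)] by blast
  from cform.Gram_Schmidt[OF sub(1) fin B(1)] obtain es where es: "cform.orthonormal n es" "set es \<subseteq> W"
    "\<And>x. x \<in> CV.span B \<Longrightarrow> Re (cform n (x - cform.proj n es x) (x - cform.proj n es x)) = 0" by blast
  have pW: "cform.proj n es x \<in> W" for x
    unfolding cform.proj_def using es(2) sub(1) by (intro CV.subspace_sum CV.subspace_scale) auto
  have p: "cform.proj n es w = w" if "w \<in> W" for w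
  proof -
    have "w - cform.proj n es w \<in> cvec n"
      using pW[of w] that sub by (blast intro: CV.subspace_diff)
    from cform_definite[OF this es(3)] that B(3) show ?thesis by auto
  qed
  have "length es < n" if ne: "W \<noteq> cvec n"
  proof -
    obtain j where j: "j < n" "unitvec j \<notin> W" using cvec_subspace_eq[OF W] ne by blast
    let ?r = "\<lambda>i. unitvec i - cform.proj n es (unitvec i)"
    have r: "Re (cform n (?r i) (?r i)) = 1 - (\<Sum>a<length es. (cmod ((es ! a) i))\<^sup>2)" if "i < n" for i
      unfolding cform.residual_norm[OF es(1)] using that by (simp add: cform_unitvec) (simp add: unitvec_def)
    have len: "(\<Sum>i<n. (cmod ((es ! a) i))\<^sup>2) = 1" if "a < length es" for a
    proof -
      have "cform n (es ! a) (es ! a) = 1" using es(1) that by (simp add: cform.orthonormal_def)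
      thus ?thesis unfolding cform_self by (metis of_real_eq_1_iff)
    qed
    have "Re (cform n (?r j) (?r j)) \<noteq> 0"
    proof
      assume "Re (cform n (?r j) (?r j)) = 0"
      moreover have "?r j \<in> cvec n"
        using pW[of "unitvec j"] sub(2) unitvec_cvec[OF j(1)] subspace_cvec by (blast intro: CV.subspace_diff)
      ultimately have "?r j = 0" by (rule cform_definite[rotated])
      thus False using pW[of "unitvec j"] j(2) by simp
    qed
    hence "0 < Re (cform n (?r j) (?r j))" using cform.nonneg[of n "?r j"] by linarith
    hence "0 < (\<Sum>i<n. Re (cform n (?r i) (?r i)))"
      using j(1) by (intro sum_pos2[of _ j]) (auto intro: cform.nonneg)
    also have "\<dots> = real n - (\<Sum>i<n. \<Sum>a<length es. (cmod ((es ! a) i))\<^sup>2)"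
      by (simp add: r sum_subtractf)
    also have "(\<Sum>i<n. \<Sum>a<length es. (cmod ((es ! a) i))\<^sup>2) = real (length es)"
      by (subst sum.swap) (simp add: len)
    finally show ?thesis by simp
  qed
  with es(1,2) p show ?thesis using that by blast
qed

context cqg
begin

lemma corep_comult: "unitary_corep G n v \<Longrightarrow> i < n \<Longrightarrow> j < n \<Longrightarrow> comult G (v i j) = (\<Sum>k<n. v i k \<otimes>\<^sub>C v k j)"
  and corep_star_left: "unitary_corep G n v \<Longrightarrow> i < n \<Longrightarrow> j < n \<Longrightarrow> (\<Sum>k<n. star (v k i) * v k j) = (if i = j then 1 else 0)"
  and corep_star_right: "unitary_corep G n v \<Longrightarrow> i < n \<Longrightarrow> j < n \<Longrightarrow> (\<Sum>k<n. v i k * star (v j k)) = (if i = j then 1 else 0)"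
  by (simp_all add: unitary_corep_def)

lemma counit_left: "slice_left cou (comult G a) = a" and counit_right: "slice_right cou (comult G a) = a"
  using hopf by (simp_all add: hopf_star_algebra_def slice_left_def slice_right_def)

lemma antipode_clinear: "clinear (antipode G)"
  using hopf by (simp add: hopf_star_algebra_def)

lemma cbilinear_antipode:
  "cbilinear (\<lambda>x y. antipode G x * y)" "cbilinear (\<lambda>x y. x * antipode G y)"
  using antipode_clinear by (auto simp: cbilinear_def clinear_def algebra_simps mult_scaleC_left mult_scaleC_right)

lemma antipode_left: "tensor_lift (\<lambda>x y. antipode G x * y) (comult G a) = cou a *\<^sub>C 1"
  and antipode_right: "tensor_lift (\<lambda>x y. x * antipode G y) (comult G a) = cou a *\<^sub>C 1"
  using hopf by (simp_all add: hopf_star_algebra_def)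

text \<open>Apply \<open>\<epsilon> \<otimes> id\<close> to \<open>\<Delta>(v\<^sub>i\<^sub>j)\<close> and cancel the unitary matrix \<open>v\<close>.\<close>

lemma corep_counit:
  assumes v: "unitary_corep G n v" "i < n" "l < n"
  shows "cou (v i l) = (if i = l then 1 else 0)"
proof -
  have e: "(\<Sum>k<n. cou (v i k) *\<^sub>C v k j) = v i j" if "j < n" for j
    using counit_left[of "v i j"] corep_comult[OF v(1,2) that]
    by (simp add: slice_left_simps counit_clinear)
  have "(if i = l then 1 else 0) = (\<Sum>j<n. v i j * star (v l j))"
    using corep_star_right[OF v] by simp
  also have "\<dots> = (\<Sum>j<n. \<Sum>k<n. cou (v i k) *\<^sub>C (v k j * star (v l j)))"
  proof (intro sum.cong refl)
    fix j assume "j \<in> {..<n}"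
    hence "v i j * star (v l j) = (\<Sum>k<n. cou (v i k) *\<^sub>C v k j) * star (v l j)" by (simp add: e)
    thus "v i j * star (v l j) = (\<Sum>k<n. cou (v i k) *\<^sub>C (v k j * star (v l j)))"
      by (simp add: sum_distrib_right mult_scaleC_left)
  qed
  also have "\<dots> = (\<Sum>k<n. cou (v i k) *\<^sub>C (\<Sum>j<n. v k j * star (v l j)))"
    by (subst sum.swap) (simp add: CV.scale_sum_right)
  also have "\<dots> = (\<Sum>k<n. if k = l then cou (v i k) *\<^sub>C 1 else 0)"
    by (intro sum.cong refl) (use corep_star_right[OF v(1) _ v(3)] in auto)
  also have "\<dots> = cou (v i l) *\<^sub>C 1" using v(3) by simp
  finally have "cou (if i = l then 1 else 0) = cou (cou (v i l) *\<^sub>C 1)" by simp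
  thus ?thesis by (simp split: if_splits)
qed

lemma corep_antipode_sum:
  assumes "\<And>i j. i < n \<Longrightarrow> j < n \<Longrightarrow> comult G (v i j) = (\<Sum>k<n. v i k \<otimes>\<^sub>C v k j)"
    "\<And>i j. i < n \<Longrightarrow> j < n \<Longrightarrow> cou (v i j) = (if i = j then 1 else 0)" "i < n" "j < n"
  shows "(\<Sum>k<n. antipode G (v i k) * v k j) = (if i = j then 1 else 0)"
    "(\<Sum>k<n. v i k * antipode G (v k j)) = (if i = j then 1 else 0)"
  using antipode_left[of "v i j"] antipode_right[of "v i j"] assms
  by (simp_all add: clinear_sum[OF tensor_lift_clinear] cbilinear_antipode tensor_lift_elem scaleC_one split: if_splits)

lemma corep_antipode:
  assumes v: "unitary_corep G n v" "i < n" "l < n"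
  shows "antipode G (v i l) = star (v l i)"
proof -
  have a: "(\<Sum>k<n. antipode G (v i k) * v k j) = (if i = j then 1 else 0)" if "j < n" for j
    by (rule corep_antipode_sum) (use v that corep_comult corep_counit in auto)
  have "star (v l i) = (\<Sum>j<n. (if i = j then star (v l j) else 0))" using v by simp
  also have "\<dots> = (\<Sum>j<n. (\<Sum>k<n. antipode G (v i k) * v k j) * star (v l j))"
    by (intro sum.cong refl) (simp add: a)
  also have "\<dots> = (\<Sum>k<n. antipode G (v i k) * (\<Sum>j<n. v k j * star (v l j)))"
    by (simp add: sum_distrib_left sum_distrib_right mult.assoc) (rule sum.swap)
  also have "\<dots> = (\<Sum>k<n. if k = l then antipode G (v i k) else 0)"
    by (intro sum.cong refl) (use corep_star_right[OF v(1) _ v(3)] in auto)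
  finally show ?thesis using v(3) by simp
qed

definition corep_act :: "nat \<Rightarrow> (nat \<Rightarrow> nat \<Rightarrow> 'a) \<Rightarrow> ('a \<Rightarrow> complex) \<Rightarrow> (nat \<Rightarrow> complex) \<Rightarrow> nat \<Rightarrow> complex" where
  "corep_act n v f x = (\<lambda>i. if i < n then \<Sum>j<n. f (v i j) * x j else 0)"

lemma corep_invariantD: "corep_invariant n v W \<Longrightarrow> clinear f \<Longrightarrow> x \<in> W \<Longrightarrow> corep_act n v f x \<in> W"
  by (simp add: corep_invariant_def corep_act_def)

text \<open>The matrix of \<open>P v P\<close> in an orthonormal basis \<open>es\<close> of the range of the orthogonal projection \<open>P\<close>.\<close>

definition compress :: "nat \<Rightarrow> (nat \<Rightarrow> nat \<Rightarrow> 'a) \<Rightarrow> (nat \<Rightarrow> complex) list \<Rightarrow> nat \<Rightarrow> nat \<Rightarrow> 'a" where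
  "compress n v es a b = (\<Sum>i<n. \<Sum>j<n. (cnj ((es ! a) i) * (es ! b) j) *\<^sub>C v i j)"

lemma compress_functional:
  assumes "clinear f"
  shows "f (compress n v es a b) = cform n (corep_act n v f (es ! b)) (es ! a)"
  using assms
  by (simp add: compress_def clinear_sum clinear_scaleC cform_def corep_act_def sum_distrib_left
      sum_distrib_right scaleC_complex_def mult_ac)

lemma compress_intertwine:
  assumes inv: "corep_invariant n v W" and es: "set es \<subseteq> W" "\<forall>w\<in>W. cform.proj n es w = w"
    and b: "b < length es" and i: "i < n"
  shows "(\<Sum>j<n. (es ! b) j *\<^sub>C v i j) = (\<Sum>a<length es. (es ! a) i *\<^sub>C compress n v es a b)"
proof (rule eq_by_functionals)
  fix f :: "'a \<Rightarrow> complex" assume f: "clinear f"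
  have "corep_act n v f (es ! b) \<in> W" using inv f es(1) b by (intro corep_invariantD) auto
  from bspec[OF es(2) this] have "corep_act n v f (es ! b) i =
      (\<Sum>a<length es. cform n (corep_act n v f (es ! b)) (es ! a) * (es ! a) i)"
    by (metis (no_types, lifting) cform.proj_def scaleC_cfun_apply sum.cong sum_fun_apply)
  thus "f (\<Sum>j<n. (es ! b) j *\<^sub>C v i j) = f (\<Sum>a<length es. (es ! a) i *\<^sub>C compress n v es a b)"
    using i f by (simp add: clinear_sum clinear_scaleC compress_functional corep_act_def scaleC_complex_def mult.commute)
qed

text \<open>Invariance makes the isometry with columns \<open>es\<close> an intertwiner, which gives the comultiplication and one
  half of unitarity. The other half is automatic: the antipode provides a right inverse, which
  must agree with the left inverse.\<close>

lemma compress_unitary: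
  assumes v: "unitary_corep G n v" and inv: "corep_invariant n v W"
    and es: "cform.orthonormal n es" "set es \<subseteq> W" "\<forall>w\<in>W. cform.proj n es w = w"
  shows "unitary_corep G (length es) (compress n v es)"
proof -
  let ?k = "length es" and ?w = "compress n v es"
  note int = compress_intertwine[OF inv es(2,3)]
  have ort: "(\<Sum>i<n. (es ! a) i * cnj ((es ! b) i)) = (if a = b then 1 else 0)" if "a < ?k" "b < ?k" for a b
    using es(1) that by (simp add: cform.orthonormal_def cform_def)
  have com: "comult G (?w a b) = (\<Sum>c<?k. ?w a c \<otimes>\<^sub>C ?w c b)" if "a < ?k" "b < ?k" for a b
  proof -
    have cc: "clinear (comult G)" using comult_hom by (simp add: star_hom_def)
    have "comult G (?w a b) = (\<Sum>i<n. \<Sum>j<n. (cnj ((es ! a) i) * (es ! b) j) *\<^sub>C (\<Sum>k<n. v i k \<otimes>\<^sub>C v k j))"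
      unfolding compress_def clinear_sum[OF cc] clinear_scaleC[OF cc]
      by (intro sum.cong refl) (simp add: corep_comult[OF v])
    also have "\<dots> = (\<Sum>i<n. \<Sum>k<n. (cnj ((es ! a) i) *\<^sub>C v i k) \<otimes>\<^sub>C (\<Sum>j<n. (es ! b) j *\<^sub>C v k j))"
    proof (rule sum.cong[OF refl])
      fix i
      have "(\<Sum>j<n. (cnj ((es ! a) i) * (es ! b) j) *\<^sub>C (\<Sum>k<n. v i k \<otimes>\<^sub>C v k j)) =
          (\<Sum>j<n. \<Sum>k<n. (cnj ((es ! a) i) * (es ! b) j) *\<^sub>C (v i k \<otimes>\<^sub>C v k j))"
        by (simp add: CV.scale_sum_right)
      also have "\<dots> = (\<Sum>k<n. \<Sum>j<n. (cnj ((es ! a) i) * (es ! b) j) *\<^sub>C (v i k \<otimes>\<^sub>C v k j))"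
        by (rule sum.swap)
      finally show "(\<Sum>j<n. (cnj ((es ! a) i) * (es ! b) j) *\<^sub>C (\<Sum>k<n. v i k \<otimes>\<^sub>C v k j)) =
          (\<Sum>k<n. (cnj ((es ! a) i) *\<^sub>C v i k) \<otimes>\<^sub>C (\<Sum>j<n. (es ! b) j *\<^sub>C v k j))"
        by (simp add: elem_tensor_sum_right elem_tensor_simps scaleC_scaleC mult.commute)
    qed
    also have "\<dots> = (\<Sum>i<n. \<Sum>k<n. \<Sum>c<?k. ((cnj ((es ! a) i) * (es ! c) k) *\<^sub>C v i k) \<otimes>\<^sub>C ?w c b)"
      by (intro sum.cong refl) (simp add: int[OF that(2)] elem_tensor_sum_right elem_tensor_simps scaleC_scaleC mult.commute)
    also have "\<dots> = (\<Sum>i<n. \<Sum>c<?k. \<Sum>k<n. ((cnj ((es ! a) i) * (es ! c) k) *\<^sub>C v i k) \<otimes>\<^sub>C ?w c b)"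
      by (rule sum.cong[OF refl]) (rule sum.swap)
    also have "\<dots> = (\<Sum>c<?k. \<Sum>i<n. \<Sum>k<n. ((cnj ((es ! a) i) * (es ! c) k) *\<^sub>C v i k) \<otimes>\<^sub>C ?w c b)"
      by (rule sum.swap)
    also have "\<dots> = (\<Sum>c<?k. ?w a c \<otimes>\<^sub>C ?w c b)"
      unfolding compress_def[of n v es a] elem_tensor_sum_left ..
    finally show ?thesis .
  qed
  have left: "(\<Sum>c<?k. star (?w c a) * ?w c b) = (if a = b then 1 else 0)" if "a < ?k" "b < ?k" for a b
  proof -
    have "(if a = b then 1 else 0) = (\<Sum>j<n. ((es ! b) j * cnj ((es ! a) j)) *\<^sub>C (1::'a))"
      using ort[OF that(2,1)] by (simp add: CV.scale_sum_left[symmetric] scaleC_one)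
    also have "\<dots> = (\<Sum>j<n. \<Sum>j'<n. ((es ! b) j' * cnj ((es ! a) j)) *\<^sub>C (\<Sum>i<n. star (v i j) * v i j'))"
    proof (intro sum.cong refl)
      fix j assume "j \<in> {..<n}"
      hence j: "j < n" by simp
      have "(\<Sum>j'<n. ((es ! b) j' * cnj ((es ! a) j)) *\<^sub>C (\<Sum>i<n. star (v i j) * v i j')) =
          (\<Sum>j'<n. if j = j' then ((es ! b) j' * cnj ((es ! a) j)) *\<^sub>C 1 else 0)"
        by (intro sum.cong refl) (use corep_star_left[OF v j] in auto)
      thus "((es ! b) j * cnj ((es ! a) j)) *\<^sub>C (1::'a) =
          (\<Sum>j'<n. ((es ! b) j' * cnj ((es ! a) j)) *\<^sub>C (\<Sum>i<n. star (v i j) * v i j'))" using j by simp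
    qed
    also have "\<dots> = (\<Sum>i<n. star (\<Sum>j<n. (es ! a) j *\<^sub>C v i j) * (\<Sum>j<n. (es ! b) j *\<^sub>C v i j))"
    proof -
      have "(\<Sum>i<n. star (\<Sum>j<n. (es ! a) j *\<^sub>C v i j) * (\<Sum>j<n. (es ! b) j *\<^sub>C v i j)) =
          (\<Sum>i<n. \<Sum>j<n. \<Sum>j'<n. ((es ! b) j' * cnj ((es ! a) j)) *\<^sub>C (star (v i j) * v i j'))"
        by (simp add: star_sum star_scaleC sum_product mult_scaleC_left mult_scaleC_right scaleC_scaleC mult.commute)
      also have "\<dots> = (\<Sum>j<n. \<Sum>i<n. \<Sum>j'<n. ((es ! b) j' * cnj ((es ! a) j)) *\<^sub>C (star (v i j) * v i j'))"
        by (rule sum.swap)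
      also have "\<dots> = (\<Sum>j<n. \<Sum>j'<n. \<Sum>i<n. ((es ! b) j' * cnj ((es ! a) j)) *\<^sub>C (star (v i j) * v i j'))"
        by (rule sum.cong[OF refl], rule sum.swap)
      finally show ?thesis by (simp add: CV.scale_sum_right)
    qed
    also have "\<dots> = (\<Sum>i<n. star (\<Sum>c<?k. (es ! c) i *\<^sub>C ?w c a) * (\<Sum>c<?k. (es ! c) i *\<^sub>C ?w c b))"
      by (intro sum.cong refl) (simp add: int that)
    also have "\<dots> = (\<Sum>i<n. \<Sum>c<?k. \<Sum>d<?k. ((es ! d) i * cnj ((es ! c) i)) *\<^sub>C (star (?w c a) * ?w d b))"
      by (simp add: star_sum star_scaleC sum_product mult_scaleC_left mult_scaleC_right scaleC_scaleC mult.commute)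
    also have "\<dots> = (\<Sum>c<?k. \<Sum>i<n. \<Sum>d<?k. ((es ! d) i * cnj ((es ! c) i)) *\<^sub>C (star (?w c a) * ?w d b))"
      by (rule sum.swap)
    also have "\<dots> = (\<Sum>c<?k. \<Sum>d<?k. \<Sum>i<n. ((es ! d) i * cnj ((es ! c) i)) *\<^sub>C (star (?w c a) * ?w d b))"
      by (rule sum.cong[OF refl], rule sum.swap)
    also have "\<dots> = (\<Sum>c<?k. \<Sum>d<?k. if d = c then star (?w c a) * ?w d b else 0)"
      by (intro sum.cong refl) (simp add: CV.scale_sum_left[symmetric] ort scaleC_one)
    also have "\<dots> = (\<Sum>c<?k. star (?w c a) * ?w c b)" by simp
    finally show ?thesis by simp
  qed
  have cou: "cou (?w a b) = (if a = b then 1 else 0)" if "a < ?k" "b < ?k" for a b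
  proof -
    have "cou (?w a b) = (\<Sum>i<n. \<Sum>j<n. if i = j then (es ! b) j * cnj ((es ! a) i) else 0)"
      unfolding compress_def counit_sum by (intro sum.cong refl) (simp add: corep_counit[OF v] mult.commute)
    also have "\<dots> = (\<Sum>i<n. (es ! b) i * cnj ((es ! a) i))"
      by (rule sum.cong) auto
    finally show ?thesis using ort[OF that(2,1)] by simp
  qed
  have right: "(\<Sum>c<?k. ?w a c * star (?w b c)) = (if a = b then 1 else 0)" if "a < ?k" "b < ?k" for a b
  proof -
    have ap: "(\<Sum>k<?k. ?w i k * antipode G (?w k j)) = (if i = j then 1 else 0)" if "i < ?k" "j < ?k" for i j
      by (rule corep_antipode_sum) (use com cou that in auto)
    have "star (?w b c) = antipode G (?w c b)" if c: "c < ?k" for c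
    proof -
      have "star (?w b c) = (\<Sum>d<?k. if d = b then star (?w d c) else 0)" using \<open>b < ?k\<close> by simp
      also have "\<dots> = (\<Sum>d<?k. star (?w d c) * (\<Sum>e<?k. ?w d e * antipode G (?w e b)))"
        by (intro sum.cong refl) (use ap \<open>b < ?k\<close> in auto)
      also have "\<dots> = (\<Sum>e<?k. (\<Sum>d<?k. star (?w d c) * ?w d e) * antipode G (?w e b))"
        by (simp add: sum_distrib_left sum_distrib_right mult.assoc) (rule sum.swap)
      also have "\<dots> = (\<Sum>e<?k. if c = e then antipode G (?w e b) else 0)"
        by (intro sum.cong refl) (use left c in auto)
      finally show ?thesis using c by simp
    qed
    thus ?thesis using ap[OF that] by simp
  qed
  show ?thesis unfolding unitary_corep_def using com left right by blast
qed

definition ortho :: "nat \<Rightarrow> (nat \<Rightarrow> complex) set \<Rightarrow> (nat \<Rightarrow> complex) set" where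
  "ortho n W = {x \<in> cvec n. \<forall>w\<in>W. cform n x w = 0}"

lemma ortho_subspace: "cvec_subspace n (ortho n W)"
  using subspace_cvec[of n]
  by (auto simp: cvec_subspace_iff CV.subspace_def ortho_def cform.add_left cform.scale_left)

text \<open>The operators \<open>(id \<otimes> f)v\<close> form a *-closed set, because \<open>(v\<^sub>i\<^sub>j)\<^sup>* = S(v\<^sub>j\<^sub>i)\<close>.\<close>

lemma ortho_invariant:
  assumes v: "unitary_corep G n v" and inv: "corep_invariant n v W"
  shows "corep_invariant n v (ortho n W)"
proof -
  have "corep_act n v f x \<in> ortho n W" if f: "clinear f" and x: "x \<in> ortho n W" for f x
  proof -
    define g where "g = (\<lambda>a. cnj (f (star (antipode G a))))"
    have g: "clinear g"
      using f antipode_clinear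
      by (auto simp: g_def clinear_def star_add star_scaleC scaleC_complex_def)
    have gv: "g (v j i) = cnj (f (v i j))" if "i < n" "j < n" for i j
      by (simp add: g_def corep_antipode[OF v] that star_star)
    have "cform n (corep_act n v f x) w = 0" if w: "w \<in> W" for w
    proof -
      have "cform n (corep_act n v f x) w = (\<Sum>i<n. \<Sum>j<n. f (v i j) * x j * cnj (w i))"
        by (simp add: cform_def corep_act_def sum_distrib_right)
      also have "\<dots> = (\<Sum>j<n. \<Sum>i<n. f (v i j) * x j * cnj (w i))" by (rule sum.swap)
      also have "\<dots> = cform n x (corep_act n v g w)"
      proof -
        have "(\<Sum>i<n. f (v i j) * x j * cnj (w i)) = x j * cnj (corep_act n v g w j)" if "j < n" for j
        proof -
          have "corep_act n v g w j = (\<Sum>i<n. cnj (f (v i j)) * w i)"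
            unfolding corep_act_def using that by (auto simp: gv intro!: sum.cong)
          thus ?thesis by (simp add: sum_distrib_left mult_ac)
        qed
        thus ?thesis by (simp add: cform_def)
      qed
      also have "\<dots> = 0" using x corep_invariantD[OF inv g w] by (simp add: ortho_def)
      finally show ?thesis .
    qed
    thus ?thesis by (simp add: ortho_def) (simp add: corep_act_def cvec_def)
  qed
  thus ?thesis by (simp add: corep_invariant_def corep_act_def)
qed

definition irr_entries :: "'a set" where
  "irr_entries = {umat G \<alpha> i j | \<alpha> i j. \<alpha> \<in> irr G \<and> i < irrdim G \<alpha> \<and> j < irrdim G \<alpha>}"

lemma irr_corep: "\<alpha> \<in> irr G \<Longrightarrow> unitary_corep G (irrdim G \<alpha>) (umat G \<alpha>)"
  and irr_irreducible: "\<alpha> \<in> irr G \<Longrightarrow> irreducible_corep (irrdim G \<alpha>) (umat G \<alpha>)"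
  and irr_complete: "unitary_corep G n v \<Longrightarrow> irreducible_corep n v \<Longrightarrow>
    \<exists>\<alpha>\<in>irr G. equivalent_corep n v (irrdim G \<alpha>) (umat G \<alpha>)"
  using cqg by (simp_all add: compact_quantum_group_def)

lemma equivalent_entry:
  assumes "equivalent_corep n v m w" "i < n" "j < n"
  obtains c where "v i j = (\<Sum>k<m. \<Sum>l<m. c k l *\<^sub>C w k l)"
proof -
  from assms(1) obtain T T' where nm: "n = m" and
    T: "\<And>i j. i < n \<Longrightarrow> j < n \<Longrightarrow> (\<Sum>k<n. T' i k * T k j) = (if i = j then 1 else (0::complex))"
    "\<And>i j. i < n \<Longrightarrow> j < n \<Longrightarrow> (\<Sum>k<n. T i k *\<^sub>C v k j) = (\<Sum>k<n. T k j *\<^sub>C w i k)"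
    unfolding equivalent_corep_def by blast
  have "v i j = (\<Sum>k<n. (if i = k then 1 else 0) *\<^sub>C v k j)"
    using assms(2) by (simp add: sum_delta_scaleC)
  also have "\<dots> = (\<Sum>k<n. (\<Sum>l<n. T' i l * T l k) *\<^sub>C v k j)"
    by (intro sum.cong refl) (simp add: T(1) assms(2))
  also have "\<dots> = (\<Sum>l<n. T' i l *\<^sub>C (\<Sum>k<n. T l k *\<^sub>C v k j))"
    by (simp add: CV.scale_sum_left CV.scale_sum_right scaleC_scaleC) (rule sum.swap)
  also have "\<dots> = (\<Sum>l<n. \<Sum>k<n. (T' i l * T k j) *\<^sub>C w l k)"
    by (intro sum.cong refl) (simp add: T(2) assms(3) CV.scale_sum_right scaleC_scaleC)
  finally show ?thesis unfolding nm by (rule that)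
qed

text \<open>Complete reducibility: along with a subspace its orthogonal complement is invariant, and
  compressing to orthonormal bases of the two gives smaller unitary corepresentations, whose entries
  yield those of \<open>v\<close> by linear combination.\<close>

lemma corep_entry_span:
  "unitary_corep G n v \<Longrightarrow> i < n \<Longrightarrow> j < n \<Longrightarrow> v i j \<in> CV.span irr_entries"
proof (induction n arbitrary: v i j rule: less_induct)
  case (less n)
  note v = less.prems(1)
  show ?case
  proof (cases "irreducible_corep n v")
    case True
    then obtain \<alpha> where \<alpha>: "\<alpha> \<in> irr G" "equivalent_corep n v (irrdim G \<alpha>) (umat G \<alpha>)"
      using irr_complete[OF v] by blast
    obtain c where c: "v i j = (\<Sum>k<irrdim G \<alpha>. \<Sum>l<irrdim G \<alpha>. c k l *\<^sub>C umat G \<alpha> k l)"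
      by (rule equivalent_entry[OF \<alpha>(2) less.prems(2,3)])
    show ?thesis
      unfolding c using \<alpha>(1) by (intro CV.span_sum CV.span_scale CV.span_base) (auto simp: irr_entries_def)
  next
    case False
    then obtain W where W: "cvec_subspace n W" "corep_invariant n v W" "W \<noteq> {0}" "W \<noteq> cvec n"
      using less.prems(2) by (auto simp: irreducible_corep_def zero_fun_def)
    obtain es where es: "cform.orthonormal n es" "set es \<subseteq> W" "\<forall>w\<in>W. cform.proj n es w = w"
      "length es < n" by (rule cvec_orthonormal_basis[OF W(1)]) (use W(4) in blast)
    have W': "ortho n W \<noteq> cvec n"
    proof
      assume "ortho n W = cvec n"
      hence "cform n w w = 0" if "w \<in> W" for w using that W(1) by (auto simp: ortho_def cvec_subspace_iff)
      hence "w = 0" if "w \<in> W" for w using that W(1) cform_definite[of w n] by (auto simp: cvec_subspace_iff)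
      moreover have "0 \<in> W" using W(1) by (simp add: cvec_subspace_def zero_fun_def)
      ultimately show False using W(3) by blast
    qed
    obtain ts where ts: "cform.orthonormal n ts" "set ts \<subseteq> ortho n W"
      "\<forall>w\<in>ortho n W. cform.proj n ts w = w" "length ts < n"
      by (rule cvec_orthonormal_basis[OF ortho_subspace]) (use W' in blast)
    have piece: "(\<Sum>l<n. cform.proj n fs (unitvec j) l *\<^sub>C v i l) \<in> CV.span irr_entries"
      if inv: "corep_invariant n v Y" and fs: "cform.orthonormal n fs" "set fs \<subseteq> Y"
        "\<forall>w\<in>Y. cform.proj n fs w = w" "length fs < n" for Y fs
    proof -
      note w = compress_unitary[OF v inv fs(1-3)]
      have "(\<Sum>l<n. cform.proj n fs (unitvec j) l *\<^sub>C v i l) =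
          (\<Sum>b<length fs. cform n (unitvec j) (fs ! b) *\<^sub>C (\<Sum>l<n. (fs ! b) l *\<^sub>C v i l))"
        by (simp add: cform.proj_def sum_fun_apply scaleC_cfun_apply CV.scale_sum_left CV.scale_sum_right scaleC_scaleC)
          (rule sum.swap)
      also have "\<dots> = (\<Sum>b<length fs. cform n (unitvec j) (fs ! b) *\<^sub>C
          (\<Sum>a<length fs. (fs ! a) i *\<^sub>C compress n v fs a b))"
        by (intro sum.cong refl) (simp add: compress_intertwine[OF inv fs(2,3)] less.prems(2))
      also have "\<dots> \<in> CV.span irr_entries"
        by (intro CV.span_sum CV.span_scale less.IH[OF fs(4) w]) auto
      finally show ?thesis .
    qed
    define r where "r = unitvec j - cform.proj n es (unitvec j)"
    have pW: "cform.proj n es (unitvec j) \<in> W"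
      unfolding cform.proj_def using es(2) W(1)
      by (intro CV.subspace_sum CV.subspace_scale) (auto simp: cvec_subspace_iff)
    have "cform n r w = 0" if "w \<in> W" for w
    proof -
      have "cform n r (cform.proj n es w) = 0"
        unfolding cform.proj_def[of n es w] cform.sum_right cform.scale_right
        using cform.residual_orthogonal[OF es(1)] by (simp add: r_def)
      thus ?thesis using es(3) that by simp
    qed
    moreover have "r \<in> cvec n"
      unfolding r_def using pW W(1) unitvec_cvec[OF less.prems(3)] subspace_cvec
      by (intro CV.subspace_diff) (auto simp: cvec_subspace_iff)
    ultimately have "r \<in> ortho n W" by (simp add: ortho_def)
    hence "r = cform.proj n ts r" using ts(3) by simp
    also have "\<dots> = cform.proj n ts (unitvec j)"
    proof -
      have "cform n (cform.proj n es (unitvec j)) (ts ! b) = 0" if "b < length ts" for b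
      proof -
        have "ts ! b \<in> ortho n W" using ts(2) that nth_mem by blast
        hence "cform n (ts ! b) (cform.proj n es (unitvec j)) = 0" using pW by (simp add: ortho_def)
        thus ?thesis using cform.hermitian[of n "cform.proj n es (unitvec j)" "ts ! b"] by simp
      qed
      thus ?thesis by (simp add: cform.proj_def[of n ts] r_def cform.diff_left)
    qed
    finally have split: "unitvec j = cform.proj n es (unitvec j) + cform.proj n ts (unitvec j)"
      by (metis add.commute diff_eq_eq r_def)
    have "v i j = (\<Sum>l<n. unitvec j l *\<^sub>C v i l)"
      using less.prems(3) by (simp add: unitvec_def sum_delta_scaleC)
    also have "\<dots> = (\<Sum>l<n. cform.proj n es (unitvec j) l *\<^sub>C v i l) + (\<Sum>l<n. cform.proj n ts (unitvec j) l *\<^sub>C v i l)"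
      by (subst split) (simp add: scaleC_add_left sum.distrib)
    also have "\<dots> \<in> CV.span irr_entries"
      by (intro CV.span_add piece[OF W(2) es] piece[OF ortho_invariant[OF v W(2)] ts])
    finally show ?thesis .
  qed
qed

lemma Pol_span: "a \<in> CV.span irr_entries"
proof (induction a rule: Pol_induct)
  case (entry n v i j)
  thus ?case by (rule corep_entry_span)
qed (auto intro: CV.span_zero CV.span_add CV.span_scale)

lemma irr_nonempty: "irr G \<noteq> {}"
proof -
  have "comult G 1 = 1" using comult_hom by (simp add: star_hom_def)
  hence "unitary_corep G 1 (\<lambda>_ _. 1)"
    by (simp add: unitary_corep_def elem_tensor_one)
  moreover have "irreducible_corep 1 (\<lambda>_ _. 1::'a)"
    unfolding irreducible_corep_def
  proof (intro conjI allI impI)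
    fix W assume "cvec_subspace 1 W \<and> corep_invariant 1 (\<lambda>_ _. 1::'a) W"
    hence W: "cvec_subspace 1 W" by simp
    show "W = {\<lambda>_. 0} \<or> W = cvec 1"
    proof (cases "W \<subseteq> {0}")
      case True
      thus ?thesis using W by (auto simp: cvec_subspace_def zero_fun_def)
    next
      case False
      then obtain x where x: "x \<in> W" "x \<noteq> 0" by blast
      hence x1: "x \<in> cvec 1" using W by (auto simp: cvec_subspace_iff)
      hence "x = x 0 *\<^sub>C unitvec 0" using cvec_expand[of x 1] by simp
      moreover from this x(2) have "x 0 \<noteq> 0" by (metis CV.scale_zero_left)
      ultimately have "unitvec 0 = (1 / x 0) *\<^sub>C x"
        by (metis (no_types, lifting) nonzero_eq_divide_eq scaleC_one scaleC_scaleC)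
      hence "unitvec 0 \<in> W" using x(1) W by (metis CV.subspace_scale cvec_subspace_iff)
      thus ?thesis using cvec_subspace_eq[OF W] by simp
    qed
  qed simp
  ultimately show ?thesis using irr_complete by blast
qed

text \<open>The linear relations among the entries of a row form an invariant subspace, and a row of a unitary
  matrix does not vanish. Almost invariance only speaks of non-zero \<open>\<eta>\<close>, so it may be tested on \<open>u\<^sub>r\<^sub>l\<close>.\<close>

lemma irr_entry_nonzero:
  assumes \<alpha>: "\<alpha> \<in> irr G" and r: "r < irrdim G \<alpha>" and l: "l < irrdim G \<alpha>"
  shows "umat G \<alpha> r l \<noteq> 0"
proof
  assume zero: "umat G \<alpha> r l = 0"
  define n where "n = irrdim G \<alpha>"
  define v where "v = umat G \<alpha>"
  have v: "unitary_corep G n v" and irr: "irreducible_corep n v"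
    using irr_corep[OF \<alpha>] irr_irreducible[OF \<alpha>] by (simp_all add: n_def v_def)
  have r: "r < n" and l: "l < n" using assms by (simp_all add: n_def)
  define W where "W = {x \<in> cvec n. (\<Sum>j<n. x j *\<^sub>C v r j) = 0}"
  have "(\<Sum>j<n. (c *\<^sub>C x) j *\<^sub>C v r j) = c *\<^sub>C (\<Sum>j<n. x j *\<^sub>C v r j)" for c x
    by (simp add: scaleC_cfun_apply CV.scale_sum_right scaleC_scaleC)
  hence sub: "cvec_subspace n W"
    using subspace_cvec[of n]
    by (auto simp: W_def cvec_subspace_iff CV.subspace_def scaleC_add_left sum.distrib)
  have "corep_act n v f x \<in> W" if f: "clinear f" and x: "x \<in> W" for f x
  proof -
    have cc: "clinear (comult G)" using comult_hom by (simp add: star_hom_def)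
    have "0 = slice_right f (comult G (\<Sum>j<n. x j *\<^sub>C v r j))"
      using x by (simp add: W_def clinear_0[OF cc] slice_right_simps f)
    also have "\<dots> = (\<Sum>j<n. x j *\<^sub>C (\<Sum>k<n. f (v k j) *\<^sub>C v r k))"
      unfolding clinear_sum[OF cc] clinear_scaleC[OF cc] slice_right_simps(2,3)[OF f]
      by (intro sum.cong refl) (simp add: corep_comult[OF v r] slice_right_simps f)
    also have "\<dots> = (\<Sum>k<n. corep_act n v f x k *\<^sub>C v r k)"
      by (simp add: CV.scale_sum_left CV.scale_sum_right scaleC_scaleC corep_act_def mult.commute)
        (rule sum.swap)
    finally show ?thesis by (simp add: W_def) (simp add: corep_act_def cvec_def)
  qed
  hence "corep_invariant n v W" by (simp add: corep_invariant_def corep_act_def)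
  with irr sub have W: "W = {0} \<or> W = cvec n" by (simp add: irreducible_corep_def zero_fun_def)
  have "unitvec l \<in> W"
    using zero l unitvec_cvec[OF l] by (simp add: W_def unitvec_def sum_delta_scaleC v_def)
  moreover have "unitvec l \<noteq> 0" by (auto simp: unitvec_def fun_eq_iff)
  ultimately have "W = cvec n" using W by blast
  hence z: "v r j = 0" if "j < n" for j
  proof -
    have "unitvec j \<in> W" using unitvec_cvec[OF that] \<open>W = cvec n\<close> by simp
    thus ?thesis using that by (simp add: W_def unitvec_def sum_delta_scaleC)
  qed
  have "(1::'a) = (\<Sum>k<n. v r k * star (v r k))" using corep_star_right[OF v r r] by simp
  also have "\<dots> = 0" by (simp add: z)
  finally show False by simp
qed

end

section \<open>Almost invariant vectors and property (T)\<close>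

context cqg
begin

abbreviation "hr \<equiv> haar G"

lemma haar_clinear: "clinear hr" and haar_one [simp]: "hr 1 = 1"
  and haar_nonneg: "hr (star a * a) \<in> \<real>\<^sub>\<ge>\<^sub>0"
  and haar_left: "slice_left hr (comult G a) = hr a *\<^sub>C 1"
  and haar_right: "slice_right hr (comult G a) = hr a *\<^sub>C 1"
  using haar_st by (simp_all add: haar_state_def slice_left_def slice_right_def)

lemmas haar_simps = clinear_add[OF haar_clinear] clinear_scaleC[OF haar_clinear, unfolded scaleC_complex_def]
  clinear_0[OF haar_clinear] clinear_diff[OF haar_clinear] clinear_minus[OF haar_clinear]
  clinear_sum[OF haar_clinear]

lemma haar_form_nonneg: "Re (hr (star a * a)) \<ge> 0" and haar_form_real: "Im (hr (star a * a)) = 0"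
  using haar_nonneg[of a] by (auto simp: nonneg_Reals_def)

lemma haar_form_hermitian: "hr (star x * y) = cnj (hr (star y * x))"
proof -
  have 1: "Im (hr (star x * y) + hr (star y * x)) = 0"
    using haar_form_real[of "x + y"] haar_form_real[of x] haar_form_real[of y]
    by (simp add: star_add algebra_simps haar_simps)
  have "hr (star (x + \<i> *\<^sub>C y) * (x + \<i> *\<^sub>C y)) =
      hr (star x * x) + \<i> * hr (star x * y) - \<i> * hr (star y * x) + hr (star y * y)"
    by (simp add: star_simps alg_simps haar_simps)
  hence 2: "Re (hr (star x * y) - hr (star y * x)) = 0"
    using haar_form_real[of "x + \<i> *\<^sub>C y"] haar_form_real[of x] haar_form_real[of y] by simp
  show ?thesis using 1 2 by (simp add: complex_eq_iff)
qed

sublocale hf: psd_form "\<lambda>x y. hr (star y * x)"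
  by unfold_locales (simp_all add: haar_simps alg_simps haar_form_nonneg flip: haar_form_hermitian)

lemma L2_norm_square: "(L2_norm G a)\<^sup>2 = Re (hr (star a * a))"
  by (simp add: L2_norm_def haar_form_nonneg)

lemma L2_norm_nonneg [simp]: "L2_norm G a \<ge> 0"
  by (simp add: L2_norm_def haar_form_nonneg)

lemma L2_norm_entry_le:
  assumes v: "unitary_corep G n v" "i < n" "j < n"
  shows "L2_norm G (v i j) \<le> 1"
proof -
  have "(\<Sum>k<n. Re (hr (star (v k j) * v k j))) = Re (hr (\<Sum>k<n. star (v k j) * v k j))"
    by (simp add: haar_simps)
  also have "\<dots> = 1" using corep_star_left[OF v(1,3,3)] by simp
  finally have "Re (hr (star (v i j) * v i j)) \<le> 1"
    using member_le_sum[of i "{..<n}" "\<lambda>k. Re (hr (star (v k j) * v k j))"] v(2) haar_form_nonneg by simp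
  thus ?thesis by (simp add: L2_norm_def)
qed

lemma sum_list_displacement:
  "(\<Sum>(a, x)\<leftarrow>displacement G \<pi> \<alpha> c \<xi>. F a x) =
    (\<Sum>i<irrdim G \<alpha>. \<Sum>j<irrdim G \<alpha>. F (matrix_unit_act G \<alpha> i j c) (\<pi> (emb max_norm (umat G \<alpha> i j)) \<xi>))
      + F (- H_elem G \<alpha> c) \<xi>"
  for F :: "'a \<Rightarrow> ('k \<Rightarrow> complex) \<Rightarrow> complex"
proof -
  have "(\<Sum>p\<leftarrow>concat (map g [0..<n]). h p) = (\<Sum>i<n. \<Sum>p\<leftarrow>g i. h p)"
    for n and g :: "nat \<Rightarrow> ('a \<times> ('k \<Rightarrow> complex)) list" and h :: "_ \<Rightarrow> complex"
    by (induction n) simp_all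
  moreover have "(\<Sum>p\<leftarrow>map g [0..<n]. h p) = (\<Sum>i<n. h (g i))"
    for n and g :: "nat \<Rightarrow> ('a \<times> ('k \<Rightarrow> complex))" and h :: "_ \<Rightarrow> complex"
    by (induction n) simp_all
  ultimately show ?thesis by (simp add: displacement_def)
qed

text \<open>The coefficients of \<open>\<eta> = u\<^sub>r\<^sub>l\<close>, for which \<open>V(\<eta> \<otimes> \<xi>) - \<eta> \<otimes> \<xi> = \<Sum>\<^sub>i u\<^sub>r\<^sub>i \<otimes> (\<pi>(u\<^sub>i\<^sub>l)\<xi> - \<delta>\<^sub>i\<^sub>l \<xi>)\<close>.\<close>

definition unit_coeff :: "nat \<Rightarrow> nat \<Rightarrow> nat \<Rightarrow> nat \<Rightarrow> complex" where
  "unit_coeff r l = (\<lambda>r' l'. if r' = r \<and> l' = l then 1 else 0)"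

lemma H_elem_unit_coeff:
  assumes "r < irrdim G \<alpha>" "l < irrdim G \<alpha>"
  shows "H_elem G \<alpha> (unit_coeff r l) = umat G \<alpha> r l"
proof -
  have "H_elem G \<alpha> (unit_coeff r l) = (\<Sum>r'<irrdim G \<alpha>. if r' = r then (\<Sum>l'<irrdim G \<alpha>. if l' = l then umat G \<alpha> r' l' else 0) else 0)"
    unfolding H_elem_def by (intro sum.cong refl) (auto simp: unit_coeff_def sum_delta_scaleC assms)
  thus ?thesis using assms by simp
qed

lemma matrix_unit_act_unit_coeff:
  assumes "r < irrdim G \<alpha>"
  shows "matrix_unit_act G \<alpha> i j (unit_coeff r l) = (if j = l then umat G \<alpha> r i else 0)"
proof -
  have "matrix_unit_act G \<alpha> i j (unit_coeff r l) = (\<Sum>r'<irrdim G \<alpha>. if r' = r then (if j = l then umat G \<alpha> r' i else 0) else 0)"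
    unfolding matrix_unit_act_def by (intro sum.cong refl) (auto simp: unit_coeff_def scaleC_one)
  thus ?thesis using assms by simp
qed

definition tensor_form :: "('a \<times> ('k \<Rightarrow> complex)) list \<Rightarrow> complex" where
  "tensor_form L = (\<Sum>(a, x)\<leftarrow>L. \<Sum>(b, y)\<leftarrow>L. hr (star b * a) * l2_inner x y)"

lemma L2_tensor_norm_eq: "L2_tensor_norm G L = sqrt (Re (tensor_form L))"
  by (simp add: L2_tensor_norm_def tensor_form_def)

end

locale cqg_rep = cqg G + cstar_rep "max_norm :: 'a \<Rightarrow> real" I \<pi>
  for G :: "('a::complex_star_algebra, 'i) cqg" and I :: "'k set" and \<pi>
begin

definition defect :: "'i \<Rightarrow> nat \<Rightarrow> ('k \<Rightarrow> complex) \<Rightarrow> nat \<Rightarrow> 'k \<Rightarrow> complex" where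
  "defect \<alpha> l \<xi> i = (\<lambda>k. \<pi> (emb max_norm (umat G \<alpha> i l)) \<xi> k - (if i = l then 1 else 0) * \<xi> k)"

lemma defect_ell2: "\<xi> \<in> ell2 I \<Longrightarrow> defect \<alpha> l \<xi> i \<in> ell2 I"
  unfolding defect_def by (intro ell2_diff ell2_scale pi_emb_ell2)

text \<open>The three conditions on \<open>F\<close> are satisfied by functions that are conjugate-linear in both
  arguments as well as by bilinear ones. The inner product on the tensor product is of the first kind in
  its second argument and of the second kind in its first one, so it can be evaluated by applying the
  lemma twice.\<close>

lemma sum_list_displacement_unit:
  fixes F :: "'a \<Rightarrow> ('k \<Rightarrow> complex) \<Rightarrow> complex"
  assumes F: "\<And>x. F 0 x = 0" "\<And>a x. F (- a) x = - F a x"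
    "\<And>a x y d. x \<in> ell2 I \<Longrightarrow> y \<in> ell2 I \<Longrightarrow> d \<in> {0, 1} \<Longrightarrow> F a (\<lambda>k. x k - d * y k) = F a x - d * F a y"
    and rl: "r < irrdim G \<alpha>" "l < irrdim G \<alpha>" and \<xi>: "\<xi> \<in> ell2 I"
  shows "(\<Sum>(a, x)\<leftarrow>displacement G \<pi> \<alpha> (unit_coeff r l) \<xi>. F a x) =
    (\<Sum>i<irrdim G \<alpha>. F (umat G \<alpha> r i) (defect \<alpha> l \<xi> i))"
proof -
  let ?n = "irrdim G \<alpha>" and ?p = "\<lambda>i j. \<pi> (emb max_norm (umat G \<alpha> i j)) \<xi>"
  have "(\<Sum>(a, x)\<leftarrow>displacement G \<pi> \<alpha> (unit_coeff r l) \<xi>. F a x) =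
      (\<Sum>i<?n. \<Sum>j<?n. if j = l then F (umat G \<alpha> r i) (?p i j) else 0) - F (umat G \<alpha> r l) \<xi>"
    unfolding sum_list_displacement H_elem_unit_coeff[OF rl] matrix_unit_act_unit_coeff[OF rl(1)] F(2)
    by (simp add: F(1) if_distrib[of "\<lambda>a. F a _"] cong: if_cong)
  also have "\<dots> = (\<Sum>i<?n. F (umat G \<alpha> r i) (?p i l)) - (\<Sum>i<?n. if i = l then F (umat G \<alpha> r i) \<xi> else 0)"
    using rl by simp
  also have "\<dots> = (\<Sum>i<?n. F (umat G \<alpha> r i) (?p i l) - (if i = l then 1 else 0) * F (umat G \<alpha> r i) \<xi>)"
    unfolding sum_subtractf[symmetric] by (intro sum.cong refl) auto
  also have "\<dots> = (\<Sum>i<?n. F (umat G \<alpha> r i) (defect \<alpha> l \<xi> i))"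
    unfolding defect_def using \<xi> by (intro sum.cong refl F(3)[symmetric]) (auto simp: pi_emb_ell2)
  finally show ?thesis .
qed

lemma l2_inner_diff_scale:
  assumes "x \<in> ell2 I" "y \<in> ell2 I" "z \<in> ell2 I"
  shows "l2_inner (\<lambda>k. x k - d * y k) z = l2_inner x z - d * l2_inner y z"
    "l2_inner z (\<lambda>k. x k - d * y k) = l2_inner z x - cnj d * l2_inner z y"
  using l2_inner_add_left[OF assms(1) ell2_scale[OF assms(2), of "- d"] assms(3)]
    l2_inner_add_right[OF assms(1) ell2_scale[OF assms(2), of "- d"] assms(3)]
    l2_inner_scale_left[of "- d" y z] l2_inner_scale_right[of z "- d" y] by simp_all

lemma displacement_ell2:
  "\<xi> \<in> ell2 I \<Longrightarrow> (a, x) \<in> set (displacement G \<pi> \<alpha> c \<xi>) \<Longrightarrow> x \<in> ell2 I"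
  by (auto simp: displacement_def pi_emb_ell2)

lemma tensor_form_unit:
  assumes rl: "r < irrdim G \<alpha>" "l < irrdim G \<alpha>" and \<xi>: "\<xi> \<in> ell2 I"
  shows "tensor_form (displacement G \<pi> \<alpha> (unit_coeff r l) \<xi>) =
    (\<Sum>i<irrdim G \<alpha>. \<Sum>k<irrdim G \<alpha>. hr (star (umat G \<alpha> r k) * umat G \<alpha> r i) *
      l2_inner (defect \<alpha> l \<xi> i) (defect \<alpha> l \<xi> k))"
proof -
  let ?D = "displacement G \<pi> \<alpha> (unit_coeff r l) \<xi>" and ?n = "irrdim G \<alpha>"
  define g where "g = (\<lambda>a x. if x \<in> ell2 I then \<Sum>k<?n. hr (star (umat G \<alpha> r k) * a) * l2_inner x (defect \<alpha> l \<xi> k) else 0)"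
  have "(\<Sum>(b, y)\<leftarrow>?D. hr (star b * a) * l2_inner x y) = g a x" if x: "x \<in> ell2 I" for a x
  proof -
    define F where "F = (\<lambda>b y. hr (star b * a) * l2_inner x y)"
    have "(\<Sum>(b, y)\<leftarrow>?D. F b y) = (\<Sum>k<?n. F (umat G \<alpha> r k) (defect \<alpha> l \<xi> k))"
      by (rule sum_list_displacement_unit[OF _ _ _ rl \<xi>])
        (auto simp: F_def haar_simps star_minus l2_inner_diff_scale x algebra_simps)
    thus ?thesis by (simp add: F_def g_def x)
  qed
  hence "tensor_form ?D = (\<Sum>(a, x)\<leftarrow>?D. g a x)"
    unfolding tensor_form_def using displacement_ell2[OF \<xi>]
    by (intro arg_cong[of _ _ sum_list] map_cong refl) (auto simp: case_prod_beta)
  also have "\<dots> = (\<Sum>i<?n. g (umat G \<alpha> r i) (defect \<alpha> l \<xi> i))"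
  proof (rule sum_list_displacement_unit[OF _ _ _ rl \<xi>])
    fix a x y and d :: complex assume xy: "x \<in> ell2 I" "y \<in> ell2 I"
    have "(\<lambda>k. x k - d * y k) \<in> ell2 I" using xy by (intro ell2_diff ell2_scale)
    thus "g a (\<lambda>k. x k - d * y k) = g a x - d * g a y"
      using xy by (simp add: g_def l2_inner_diff_scale defect_ell2 \<xi> algebra_simps sum_subtractf sum_distrib_left)
  qed (simp_all add: g_def haar_simps sum_negf)
  finally show ?thesis by (simp add: g_def defect_ell2 \<xi>)
qed

text \<open>Summing over the row index \<open>r\<close> replaces \<open>h(u\<^sub>r\<^sub>k\<^sup>* u\<^sub>r\<^sub>i)\<close> by \<open>h(\<delta>\<^sub>k\<^sub>i 1) = \<delta>\<^sub>k\<^sub>i\<close>, so no orthogonality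
  relations for the Haar state enter.\<close>

lemma sum_defect:
  assumes \<alpha>: "\<alpha> \<in> irr G" and l: "l < irrdim G \<alpha>" and \<xi>: "\<xi> \<in> ell2 I"
  shows "(\<Sum>i<irrdim G \<alpha>. (l2_norm (defect \<alpha> l \<xi> i))\<^sup>2) =
    (\<Sum>r<irrdim G \<alpha>. Re (tensor_form (displacement G \<pi> \<alpha> (unit_coeff r l) \<xi>)))"
proof -
  let ?n = "irrdim G \<alpha>" and ?u = "umat G \<alpha>" and ?d = "defect \<alpha> l \<xi>"
  have "(\<Sum>r<?n. tensor_form (displacement G \<pi> \<alpha> (unit_coeff r l) \<xi>)) =
      (\<Sum>r<?n. \<Sum>i<?n. \<Sum>k<?n. hr (star (?u r k) * ?u r i) * l2_inner (?d i) (?d k))"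
    by (intro sum.cong refl) (simp add: tensor_form_unit l \<xi>)
  also have "\<dots> = (\<Sum>i<?n. \<Sum>r<?n. \<Sum>k<?n. hr (star (?u r k) * ?u r i) * l2_inner (?d i) (?d k))"
    by (rule sum.swap)
  also have "\<dots> = (\<Sum>i<?n. \<Sum>k<?n. \<Sum>r<?n. hr (star (?u r k) * ?u r i) * l2_inner (?d i) (?d k))"
    by (rule sum.cong[OF refl], rule sum.swap)
  also have "\<dots> = (\<Sum>i<?n. \<Sum>k<?n. hr (\<Sum>r<?n. star (?u r k) * ?u r i) * l2_inner (?d i) (?d k))"
    by (simp add: haar_simps sum_distrib_right)
  also have "\<dots> = (\<Sum>i<?n. \<Sum>k<?n. if k = i then l2_inner (?d i) (?d k) else 0)"
    by (intro sum.cong refl) (simp add: corep_star_left[OF irr_corep[OF \<alpha>]] haar_simps)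
  also have "\<dots> = (\<Sum>i<?n. l2_inner (?d i) (?d i))" by simp
  also have "\<dots> = of_real (\<Sum>i<?n. (l2_norm (?d i))\<^sup>2)"
    by (simp add: l2_inner_self[OF defect_ell2[OF \<xi>]] del: of_real_power)
  finally have "Re (\<Sum>r<?n. tensor_form (displacement G \<pi> \<alpha> (unit_coeff r l) \<xi>)) = (\<Sum>i<?n. (l2_norm (?d i))\<^sup>2)"
    by simp
  thus ?thesis by simp
qed

definition almost_inv :: "'i set \<Rightarrow> real \<Rightarrow> ('k \<Rightarrow> complex) \<Rightarrow> bool" where
  "almost_inv E \<delta> \<xi> \<longleftrightarrow> \<xi> \<in> ell2 I \<and> (\<forall>\<alpha>\<in>E. \<forall>c. H_elem G \<alpha> c \<noteq> 0 \<longrightarrow>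
    L2_tensor_norm G (displacement G \<pi> \<alpha> c \<xi>) < \<delta> * L2_norm G (H_elem G \<alpha> c) * l2_norm \<xi>)"

lemma almost_inv_mono:
  assumes "almost_inv E \<delta> \<xi>" "E' \<subseteq> E" "\<delta> \<le> \<delta>'"
  shows "almost_inv E' \<delta>' \<xi>"
  unfolding almost_inv_def
proof (intro conjI ballI allI impI)
  show "\<xi> \<in> ell2 I" using assms(1) by (simp add: almost_inv_def)
  fix \<alpha> c assume "\<alpha> \<in> E'" "H_elem G \<alpha> c \<noteq> 0"
  hence "L2_tensor_norm G (displacement G \<pi> \<alpha> c \<xi>) < \<delta> * L2_norm G (H_elem G \<alpha> c) * l2_norm \<xi>"
    using assms(1,2) by (auto simp: almost_inv_def)
  also have "\<dots> \<le> \<delta>' * L2_norm G (H_elem G \<alpha> c) * l2_norm \<xi>"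
    using assms(3) by (intro mult_right_mono) auto
  finally show "L2_tensor_norm G (displacement G \<pi> \<alpha> c \<xi>) < \<delta>' * L2_norm G (H_elem G \<alpha> c) * l2_norm \<xi>" .
qed

lemma almost_inv_unit:
  assumes inv: "almost_inv {\<alpha>} \<delta> \<xi>" and \<alpha>: "\<alpha> \<in> irr G" "r < irrdim G \<alpha>" "l < irrdim G \<alpha>" and \<delta>: "\<delta> > 0"
  shows "Re (tensor_form (displacement G \<pi> \<alpha> (unit_coeff r l) \<xi>)) \<le> (\<delta> * l2_norm \<xi>)\<^sup>2"
    "l2_norm \<xi> = 0 \<Longrightarrow> Re (tensor_form (displacement G \<pi> \<alpha> (unit_coeff r l) \<xi>)) < 0"
proof -
  let ?t = "Re (tensor_form (displacement G \<pi> \<alpha> (unit_coeff r l) \<xi>))"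
  have lt: "sqrt ?t < \<delta> * L2_norm G (umat G \<alpha> r l) * l2_norm \<xi>"
  proof -
    have "\<forall>c. H_elem G \<alpha> c \<noteq> 0 \<longrightarrow>
        L2_tensor_norm G (displacement G \<pi> \<alpha> c \<xi>) < \<delta> * L2_norm G (H_elem G \<alpha> c) * l2_norm \<xi>"
      using inv by (simp add: almost_inv_def)
    from this[rule_format, of "unit_coeff r l"] show ?thesis
      using irr_entry_nonzero[OF \<alpha>] by (simp add: H_elem_unit_coeff[OF \<alpha>(2,3)] L2_tensor_norm_eq)
  qed
  also have "\<dots> \<le> \<delta> * 1 * l2_norm \<xi>"
    using \<delta> L2_norm_entry_le[OF irr_corep[OF \<alpha>(1)] \<alpha>(2,3)] by (intro mult_right_mono mult_left_mono) auto
  finally have "sqrt ?t < \<delta> * l2_norm \<xi>" by simp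
  moreover have "\<delta> * l2_norm \<xi> \<ge> 0" using \<delta> by simp
  ultimately show "?t \<le> (\<delta> * l2_norm \<xi>)\<^sup>2"
    by (meson less_imp_le not_le order_trans real_le_rsqrt real_sqrt_le_mono sqrt_le_D zero_le_power2)
  show "l2_norm \<xi> = 0 \<Longrightarrow> ?t < 0" using lt by simp
qed

lemma almost_inv_entry:
  assumes inv: "almost_inv {\<alpha>} \<delta> \<xi>" and \<alpha>: "\<alpha> \<in> irr G" and il: "i < irrdim G \<alpha>" "l < irrdim G \<alpha>" and \<delta>: "\<delta> > 0"
  shows "(l2_norm (defect \<alpha> l \<xi> i))\<^sup>2 \<le> real (irrdim G \<alpha>) * (\<delta> * l2_norm \<xi>)\<^sup>2" "l2_norm \<xi> > 0"
proof -
  have \<xi>: "\<xi> \<in> ell2 I" using inv by (simp add: almost_inv_def)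
  have "(l2_norm (defect \<alpha> l \<xi> i))\<^sup>2 \<le> (\<Sum>i<irrdim G \<alpha>. (l2_norm (defect \<alpha> l \<xi> i))\<^sup>2)"
    using il(1) by (intro member_le_sum) auto
  also have "\<dots> \<le> (\<Sum>r<irrdim G \<alpha>. (\<delta> * l2_norm \<xi>)\<^sup>2)"
    unfolding sum_defect[OF \<alpha> il(2) \<xi>]
    by (intro sum_mono almost_inv_unit(1)[OF inv \<alpha>]) (use il \<delta> in auto)
  finally show "(l2_norm (defect \<alpha> l \<xi> i))\<^sup>2 \<le> real (irrdim G \<alpha>) * (\<delta> * l2_norm \<xi>)\<^sup>2" by simp
  show "l2_norm \<xi> > 0"
  proof (rule ccontr)
    assume "\<not> l2_norm \<xi> > 0"
    hence 0: "l2_norm \<xi> = 0" using l2_norm_nonneg[of \<xi>] by linarith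
    have "(\<Sum>r<irrdim G \<alpha>. Re (tensor_form (displacement G \<pi> \<alpha> (unit_coeff r l) \<xi>))) < 0"
      using il by (intro sum_strict_mono[of _ _ "\<lambda>_. 0", simplified] almost_inv_unit(2)[OF inv \<alpha> _ il(2) \<delta> 0]) auto
    moreover have "0 \<le> (\<Sum>i<irrdim G \<alpha>. (l2_norm (defect \<alpha> l \<xi> i))\<^sup>2)" by (intro sum_nonneg) auto
    ultimately show False unfolding sum_defect[OF \<alpha> il(2) \<xi>] by simp
  qed
qed

definition nearly_fixed :: "'a \<Rightarrow> real \<Rightarrow> 'i set \<Rightarrow> real \<Rightarrow> bool" where
  "nearly_fixed a e E \<delta> \<longleftrightarrow> finite E \<and> E \<subseteq> irr G \<and> \<delta> > 0 \<and> (\<forall>\<xi>. almost_inv E \<delta> \<xi> \<longrightarrow>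
    (l2_norm (\<lambda>k. \<pi> (emb max_norm a) \<xi> k - cou a * \<xi> k))\<^sup>2 \<le> e * (l2_norm \<xi>)\<^sup>2)"

lemma almost_inv_approx: "e > 0 \<Longrightarrow> \<exists>E \<delta>. nearly_fixed a e E \<delta>"
proof -
  define P where "P = {a. \<forall>e>0. \<exists>E \<delta>. nearly_fixed a e E \<delta>}"
  have "CV.subspace P"
    unfolding CV.subspace_def
  proof (intro conjI ballI allI)
    show "0 \<in> P"
      by (auto simp: P_def nearly_fixed_def almost_inv_def pi_emb_zero intro!: exI[of _ "{}"] exI[of _ 1])
  next
    fix a b assume ab: "a \<in> P" "b \<in> P"
    have "\<exists>E \<delta>. nearly_fixed (a + b) e E \<delta>" if e: "e > 0" for e
    proof -
      have "e / 4 > 0" using e by simp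
      then obtain E \<delta> E' \<delta>' where E: "nearly_fixed a (e / 4) E \<delta>" and E': "nearly_fixed b (e / 4) E' \<delta>'"
        using ab unfolding P_def by blast
      have "(l2_norm (\<lambda>k. \<pi> (emb max_norm (a + b)) \<xi> k - cou (a + b) * \<xi> k))\<^sup>2 \<le> e * (l2_norm \<xi>)\<^sup>2"
        if inv: "almost_inv (E \<union> E') (min \<delta> \<delta>') \<xi>" for \<xi>
      proof -
        have \<xi>: "\<xi> \<in> ell2 I" using inv by (simp add: almost_inv_def)
        let ?x = "\<lambda>k. \<pi> (emb max_norm a) \<xi> k - cou a * \<xi> k" and ?y = "\<lambda>k. \<pi> (emb max_norm b) \<xi> k - cou b * \<xi> k"
        have "(\<lambda>k. \<pi> (emb max_norm (a + b)) \<xi> k - cou (a + b) * \<xi> k) = (\<lambda>k. ?x k + ?y k)"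
          by (simp add: pi_emb_add[OF \<xi>] algebra_simps)
        moreover have "(l2_norm (\<lambda>k. ?x k + ?y k))\<^sup>2 \<le> 2 * (l2_norm ?x)\<^sup>2 + 2 * (l2_norm ?y)\<^sup>2"
          by (intro l2_norm_add_square[of _ I] ell2_diff ell2_scale pi_emb_ell2 \<xi>)
        moreover have "almost_inv E \<delta> \<xi>" "almost_inv E' \<delta>' \<xi>"
          by (rule almost_inv_mono[OF inv]; simp)+
        hence "(l2_norm ?x)\<^sup>2 \<le> e / 4 * (l2_norm \<xi>)\<^sup>2" "(l2_norm ?y)\<^sup>2 \<le> e / 4 * (l2_norm \<xi>)\<^sup>2"
          using E E' by (simp_all only: nearly_fixed_def)
        ultimately show ?thesis by simp
      qed
      hence "nearly_fixed (a + b) e (E \<union> E') (min \<delta> \<delta>')" using E E' by (simp add: nearly_fixed_def)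
      thus ?thesis by blast
    qed
    thus "a + b \<in> P" by (simp add: P_def)
  next
    fix c a assume a: "a \<in> P"
    have "\<exists>E \<delta>. nearly_fixed (c *\<^sub>C a) e E \<delta>" if e: "e > 0" for e
    proof -
      have c: "(cmod c)\<^sup>2 + 1 > 0" by (simp add: add_nonneg_pos)
      hence "e / ((cmod c)\<^sup>2 + 1) > 0" using e by (rule divide_pos_pos[rotated])
      then obtain E \<delta> where E: "nearly_fixed a (e / ((cmod c)\<^sup>2 + 1)) E \<delta>" using a unfolding P_def by blast
      have "(l2_norm (\<lambda>k. \<pi> (emb max_norm (c *\<^sub>C a)) \<xi> k - cou (c *\<^sub>C a) * \<xi> k))\<^sup>2 \<le> e * (l2_norm \<xi>)\<^sup>2"
        if inv: "almost_inv E \<delta> \<xi>" for \<xi>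
      proof -
        have \<xi>: "\<xi> \<in> ell2 I" using inv by (simp add: almost_inv_def)
        let ?x = "\<lambda>k. \<pi> (emb max_norm a) \<xi> k - cou a * \<xi> k"
        have "?x \<in> ell2 I" by (intro ell2_diff ell2_scale pi_emb_ell2 \<xi>)
        hence "(l2_norm (\<lambda>k. c * ?x k))\<^sup>2 = (cmod c)\<^sup>2 * (l2_norm ?x)\<^sup>2" by (rule l2_norm_scale)
        also have "(l2_norm ?x)\<^sup>2 \<le> e / ((cmod c)\<^sup>2 + 1) * (l2_norm \<xi>)\<^sup>2"
          using E inv by (simp only: nearly_fixed_def)
        hence "(cmod c)\<^sup>2 * (l2_norm ?x)\<^sup>2 \<le> ((cmod c)\<^sup>2 + 1) * (e / ((cmod c)\<^sup>2 + 1) * (l2_norm \<xi>)\<^sup>2)"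
          using c by (intro mult_mono) auto
        also have "\<dots> = e * (l2_norm \<xi>)\<^sup>2" using c by simp
        finally show ?thesis by (simp add: pi_emb_scale[OF \<xi>] algebra_simps)
      qed
      hence "nearly_fixed (c *\<^sub>C a) e E \<delta>" using E by (simp add: nearly_fixed_def)
      thus ?thesis by blast
    qed
    thus "c *\<^sub>C a \<in> P" by (simp add: P_def)
  qed
  moreover have "irr_entries \<subseteq> P"
  proof
    fix a assume "a \<in> irr_entries"
    then obtain \<alpha> i l where a: "a = umat G \<alpha> i l" and \<alpha>: "\<alpha> \<in> irr G" "i < irrdim G \<alpha>" "l < irrdim G \<alpha>"
      by (auto simp: irr_entries_def)
    have n: "real (irrdim G \<alpha>) > 0" using \<alpha> by simp
    have "\<exists>E \<delta>. nearly_fixed a e E \<delta>" if e: "e > 0" for e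
    proof -
      define \<delta> where "\<delta> = sqrt (e / real (irrdim G \<alpha>))"
      have \<delta>: "\<delta> > 0" "real (irrdim G \<alpha>) * \<delta>\<^sup>2 = e" using e n by (simp_all add: \<delta>_def)
      have "(l2_norm (\<lambda>k. \<pi> (emb max_norm a) \<xi> k - cou a * \<xi> k))\<^sup>2 \<le> e * (l2_norm \<xi>)\<^sup>2"
        if inv: "almost_inv {\<alpha>} \<delta> \<xi>" for \<xi>
      proof -
        have "(\<lambda>k. \<pi> (emb max_norm a) \<xi> k - cou a * \<xi> k) = defect \<alpha> l \<xi> i"
          by (simp add: defect_def a corep_counit[OF irr_corep[OF \<alpha>(1)] \<alpha>(2,3)])
        thus ?thesis
          using almost_inv_entry(1)[OF inv \<alpha> \<delta>(1)] \<delta>(2) by (simp add: power_mult_distrib flip: mult.assoc)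
      qed
      hence "nearly_fixed a e {\<alpha>} \<delta>" using \<alpha>(1) \<delta>(1) by (simp add: nearly_fixed_def)
      thus ?thesis by blast
    qed
    thus "a \<in> P" by (simp add: P_def)
  qed
  ultimately have "CV.span irr_entries \<subseteq> P" by (rule CV.span_minimal[rotated])
  thus "e > 0 \<Longrightarrow> \<exists>E \<delta>. nearly_fixed a e E \<delta>" using Pol_span[of a] by (auto simp: P_def)
qed

lemma invariant_vectorI:
  assumes \<zeta>: "\<zeta> \<in> ell2 I" and inv: "\<And>a. \<pi> (emb max_norm a) \<zeta> = (\<lambda>k. cou a * \<zeta> k)"
  shows "invariant_vector G \<pi> \<zeta>"
  unfolding invariant_vector_def
proof (intro ballI allI)
  fix \<alpha> c assume \<alpha>: "\<alpha> \<in> irr G"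
  let ?n = "irrdim G \<alpha>"
  have "(\<Sum>(b, y)\<leftarrow>displacement G \<pi> \<alpha> c \<zeta>. hr (star b * a) * l2_inner x y) = 0" for a x
  proof -
    have "\<pi> (emb max_norm (umat G \<alpha> i j)) \<zeta> = (if i = j then \<zeta> else (\<lambda>_. 0))" if "i < ?n" "j < ?n" for i j
      using corep_counit[OF irr_corep[OF \<alpha>] that] by (simp add: inv)
    moreover have z: "l2_inner x (\<lambda>_. 0) = 0" by (simp add: l2_inner_def)
    ultimately have "(\<Sum>i<?n. \<Sum>j<?n. hr (star (matrix_unit_act G \<alpha> i j c) * a) *
        l2_inner x (\<pi> (emb max_norm (umat G \<alpha> i j)) \<zeta>)) =
        (\<Sum>i<?n. \<Sum>j<?n. if i = j then hr (star (matrix_unit_act G \<alpha> i j c) * a) * l2_inner x \<zeta> else 0)"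
      by (intro sum.cong refl) auto
    also have "\<dots> = (\<Sum>i<?n. hr (star (matrix_unit_act G \<alpha> i i c) * a) * l2_inner x \<zeta>)"
      by (intro sum.cong refl) simp
    also have "\<dots> = hr (star (\<Sum>i<?n. matrix_unit_act G \<alpha> i i c) * a) * l2_inner x \<zeta>"
      by (simp add: star_sum sum_distrib_right haar_simps)
    also have "(\<Sum>i<?n. matrix_unit_act G \<alpha> i i c) = H_elem G \<alpha> c"
      unfolding matrix_unit_act_def H_elem_def by (rule sum.swap)
    finally show ?thesis by (simp add: sum_list_displacement star_minus haar_simps)
  qed
  hence "tensor_form (displacement G \<pi> \<alpha> c \<zeta>) = (\<Sum>(a, x)\<leftarrow>displacement G \<pi> \<alpha> c \<zeta>. 0)"
    by (simp add: tensor_form_def)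
  also have "\<dots> = 0" by (simp add: split_def)
  finally have "tensor_form (displacement G \<pi> \<alpha> c \<zeta>) = 0" .
  thus "L2_tensor_norm G (displacement G \<pi> \<alpha> c \<zeta>) = 0" by (simp add: L2_tensor_norm_eq)
qed

text \<open>If \<open>\<pi>(p)\<xi> = 0\<close> for the limit \<open>p\<close> of \<open>b\<^sub>n\<close>, then \<open>\<pi>(c)\<xi>\<close> is small for \<open>c = b\<^sub>L\<close> close to \<open>p\<close>, while it is
  close to \<open>\<epsilon>(c)\<xi>\<close> by almost invariance, and \<open>\<epsilon>(c)\<close> is close to \<open>1\<close>.\<close>

lemma invariant_vector_exists:
  assumes b: "norm_Cauchy max_norm b" "(\<lambda>n. cou (b n)) \<longlonglongrightarrow> 1"
    "\<And>a. (\<lambda>n. max_norm (a * b n - cou a *\<^sub>C b n)) \<longlonglongrightarrow> 0"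
    and inv: "almost_invariant_vectors G I \<pi>"
  shows "\<exists>\<zeta>\<in>ell2 I. \<zeta> \<noteq> (\<lambda>_. 0) \<and> invariant_vector G \<pi> \<zeta>"
proof -
  let ?M = "max_norm :: 'a \<Rightarrow> real"
  obtain K where K: "\<And>m n. m \<ge> K \<Longrightarrow> n \<ge> K \<Longrightarrow> ?M (b m - b n) < 1 / 8"
    using norm_CauchyD[OF b(1), of "1 / 8"] by auto
  have "\<forall>\<^sub>F n in sequentially. cmod (cou (b n) - 1) < 1 / 4"
    using tendstoD[OF b(2), of "1 / 4"] by (simp add: dist_norm)
  then obtain K' where K': "\<And>n. n \<ge> K' \<Longrightarrow> cmod (cou (b n) - 1) < 1 / 4"
    by (auto simp: eventually_sequentially)
  define L where "L = max K K'"
  define c where "c = b L"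
  obtain E \<delta> where "nearly_fixed c (1 / 16) E \<delta>" using almost_inv_approx[of "1 / 16" c] by auto
  hence E: "finite E" "E \<subseteq> irr G" "\<delta> > 0" "\<forall>\<xi>. almost_inv E \<delta> \<xi> \<longrightarrow>
      (l2_norm (\<lambda>k. \<pi> (emb ?M c) \<xi> k - cou c * \<xi> k))\<^sup>2 \<le> 1 / 16 * (l2_norm \<xi>)\<^sup>2"
    unfolding nearly_fixed_def by blast+
  obtain \<alpha> where \<alpha>: "\<alpha> \<in> irr G" using irr_nonempty by blast
  have n: "irrdim G \<alpha> > 0" using irr_irreducible[OF \<alpha>] by (simp add: irreducible_corep_def)
  obtain \<xi> where \<xi>: "almost_inv (insert \<alpha> E) \<delta> \<xi>"
    using inv E(1-3) \<alpha> unfolding almost_invariant_vectors_def almost_inv_def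
    by (metis finite_insert insert_subset)
  have \<xi>E: "\<xi> \<in> ell2 I" using \<xi> by (simp add: almost_inv_def)
  have "almost_inv {\<alpha>} \<delta> \<xi>" by (rule almost_inv_mono[OF \<xi>]) auto
  from almost_inv_entry(2)[OF this \<alpha> n n E(3)] have \<xi>0: "l2_norm \<xi> > 0" .
  have "almost_inv E \<delta> \<xi>" by (rule almost_inv_mono[OF \<xi>]) auto
  note c\<xi> = E(4)[rule_format, OF this]
  define \<zeta> where "\<zeta> = \<pi> (cauchy_class ?M b) \<xi>"
  define z where "z = \<pi> (emb ?M c) \<xi>"
  have \<zeta>E: "\<zeta> \<in> ell2 I" unfolding \<zeta>_def by (rule pi_class_ell2[OF b(1) \<xi>E])
  have zE: "z \<in> ell2 I" unfolding z_def by (rule pi_emb_ell2[OF \<xi>E])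
  have "\<zeta> \<noteq> (\<lambda>_. 0)"
  proof
    assume \<zeta>0: "\<zeta> = (\<lambda>_. 0)"
    have sh: "norm_Cauchy ?M (\<lambda>n. b (n + L))"
      using b(1) unfolding norm_Cauchy_def by (meson le_add1 order_trans trans_le_add1)
    have "(\<lambda>n. ?M (b (n + L) - b n)) \<longlonglongrightarrow> 0"
    proof (rule LIMSEQ_I)
      fix e :: real assume "e > 0"
      then obtain Q where "\<And>m n. m \<ge> Q \<Longrightarrow> n \<ge> Q \<Longrightarrow> ?M (b m - b n) < e" using norm_CauchyD[OF b(1)] by blast
      hence "\<forall>n\<ge>Q. norm (?M (b (n + L) - b n) - 0) < e" by simp
      thus "\<exists>no. \<forall>n\<ge>no. norm (?M (b (n + L) - b n) - 0) < e" by blast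
    qed
    hence cls: "cauchy_class ?M (\<lambda>n. b (n + L)) = cauchy_class ?M b" by (rule cauchy_class_eqI)
    \<comment> \<open>Contractivity requires norms below \<open>1\<close>; the factor \<open>4\<close> turns it into \<open>\<parallel>\<pi>(p - c)\<xi>\<parallel> \<le> \<parallel>\<xi>\<parallel> / 4\<close>.\<close>
    define s where "s = (\<lambda>n. 4 *\<^sub>C (b (n + L) + (- 1) *\<^sub>C c))"
    have cC: "norm_Cauchy ?M (\<lambda>_. (- 1) *\<^sub>C c)" by (rule norm_Cauchy_const)
    have sC: "norm_Cauchy ?M s"
      unfolding s_def by (intro norm_Cauchy_scaleC norm_Cauchy_add sh norm_Cauchy_const)
    have "?M (s n) \<le> 1 / 2" for n
    proof -
      have "s n = 4 *\<^sub>C (b (n + L) - b L)" by (simp add: s_def c_def scaleC_one)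
      moreover have "K \<le> n + L" "K \<le> L" by (simp_all add: L_def trans_le_add2)
      ultimately show ?thesis using K[of "n + L" L] by (simp add: N_scaleC)
    qed
    from pi_contractive[OF sC this _ \<xi>E]
    have le: "(l2_norm (\<pi> (cauchy_class ?M s) \<xi>))\<^sup>2 \<le> (l2_norm \<xi>)\<^sup>2" by simp
    have eq: "\<pi> (cauchy_class ?M s) \<xi> = (\<lambda>k. - 4 * z k)"
    proof -
      have "\<pi> (cauchy_class ?M s) \<xi> = (\<lambda>k. 4 * (\<zeta> k + (- 1) * z k))"
        unfolding s_def pi_class_scale[OF norm_Cauchy_add[OF sh cC] \<xi>E] pi_class_add[OF sh cC \<xi>E] cls
        using pi_class_scale[OF norm_Cauchy_const \<xi>E, of "- 1" c] by (simp add: \<zeta>_def z_def emb_def)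
      thus ?thesis by (simp add: \<zeta>0)
    qed
    have z: "16 * (l2_norm z)\<^sup>2 \<le> (l2_norm \<xi>)\<^sup>2"
      using le unfolding eq l2_norm_scale[OF zE] by simp
    have eq2: "(\<lambda>k. cou c * \<xi> k) = (\<lambda>k. z k + (- 1) * (z k - cou c * \<xi> k))" by simp
    have "(l2_norm (\<lambda>k. cou c * \<xi> k))\<^sup>2 \<le>
        2 * (l2_norm z)\<^sup>2 + 2 * (l2_norm (\<lambda>k. (- 1) * (z k - cou c * \<xi> k)))\<^sup>2"
      by (subst eq2, rule l2_norm_add_square[of _ I]) (intro ell2_diff ell2_scale zE \<xi>E)+
    also have "(l2_norm (\<lambda>k. (- 1) * (z k - cou c * \<xi> k)))\<^sup>2 = (l2_norm (\<lambda>k. z k - cou c * \<xi> k))\<^sup>2"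
      by (subst l2_norm_scale[of _ I], intro ell2_diff ell2_scale zE \<xi>E) simp
    finally have "(cmod (cou c))\<^sup>2 * (l2_norm \<xi>)\<^sup>2 \<le> 1 / 4 * (l2_norm \<xi>)\<^sup>2"
      using z c\<xi> by (simp add: l2_norm_scale[OF \<xi>E] z_def)
    hence "(cmod (cou c))\<^sup>2 \<le> 1 / 4" using \<xi>0 by simp
    moreover have "cmod (cou c) \<ge> 3 / 4"
      using K'[of L] norm_triangle_ineq2[of 1 "1 - cou c"] by (simp add: L_def c_def norm_minus_commute)
    hence "(3 / 4)\<^sup>2 \<le> (cmod (cou c))\<^sup>2" by (intro power_mono) auto
    ultimately show False by (simp add: power2_eq_square)
  qed
  moreover have "invariant_vector G \<pi> \<zeta>"
  proof (rule invariant_vectorI[OF \<zeta>E])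
    fix a
    have "\<pi> (emb ?M a) \<zeta> = \<pi> (cauchy_class ?M (\<lambda>n. a * b n)) \<xi>"
      unfolding \<zeta>_def emb_def by (rule pi_class_mult[OF norm_Cauchy_const b(1) \<xi>E, symmetric])
    also have "cauchy_class ?M (\<lambda>n. a * b n) = cauchy_class ?M (\<lambda>n. cou a *\<^sub>C b n)"
      by (rule cauchy_class_eqI[OF b(3)])
    finally show "\<pi> (emb ?M a) \<zeta> = (\<lambda>k. cou a * \<zeta> k)"
      by (simp add: pi_class_scale[OF b(1) \<xi>E] \<zeta>_def)
  qed
  ultimately show ?thesis using \<zeta>E by blast
qed

end

context cqg
begin

lemma property_T_of_unbounded_counit:
  assumes N: "cstar_norm N" and unb: "\<not> (\<exists>K. \<forall>a. cmod (cou a) \<le> K * N a)"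
    and iso: "canonical_iso (max_norm :: 'a \<Rightarrow> real) (tilde_norm G N)"
  shows "dual_property_T G"
proof -
  obtain b where b: "norm_Cauchy max_norm b" "(\<lambda>n. cou (b n)) \<longlonglongrightarrow> 1"
    "\<And>a. (\<lambda>n. max_norm (a * b n - cou a *\<^sub>C b n)) \<longlonglongrightarrow> 0"
    by (rule kazhdan_sequence[OF assms]) blast
  show ?thesis
    unfolding dual_property_T_def
  proof (intro allI impI, elim conjE)
    fix I :: "nat set" and \<pi>
    assume rep: "sa_rep (cstar_completion (max_norm :: 'a \<Rightarrow> real)) I \<pi>" and inv: "almost_invariant_vectors G I \<pi>"
    interpret cqg_rep G I \<pi>
      by unfold_locales (rule cstar_norm_max_norm[OF N], rule rep)
    show "\<exists>\<xi>\<in>ell2 I. \<xi> \<noteq> (\<lambda>_. 0) \<and> invariant_vector G \<pi> \<xi>"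
      by (rule invariant_vector_exists[OF b inv])
  qed
qed

lemma tilde_iso_of_bounded_counit:
  assumes N: "cstar_norm N" and K: "\<And>a. cmod (cou a) \<le> K * N a"
  shows "canonical_iso (tilde_norm G N) N"
proof -
  interpret cstar_dominated "tilde_norm G N" N 1
    by unfold_locales (simp_all add: N cstar_normed_tilde_norm counit_hom tilde_norm_def)
  show ?thesis
  proof (rule canonical_iso_equivalent)
    show "tilde_norm G N a \<le> max 1 K * N a" for a
    proof -
      have "N a \<le> max 1 K * N a" using mult_right_mono[of 1 "max 1 K" "N a"] by simp
      moreover have "K * N a \<le> max 1 K * N a" by (intro mult_right_mono) auto
      ultimately show ?thesis using K[of a] by (simp add: tilde_norm_def)
    qed
  qed simp
qed

lemma bounded_counit_of_tilde_iso:
  assumes N: "cstar_norm N" and iso: "canonical_iso (tilde_norm G N) N"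
  shows "\<exists>K. \<forall>a. cmod (cou a) \<le> K * N a"
proof (rule ccontr)
  assume unb: "\<not> (\<exists>K. \<forall>a. cmod (cou a) \<le> K * N a)"
  interpret cstar_dominated "tilde_norm G N" N 1
    by unfold_locales (simp_all add: N cstar_normed_tilde_norm counit_hom tilde_norm_def)
  obtain a where a: "\<And>n. cou (a n) = 1" "norm_Cauchy (tilde_norm G N) a" "(\<lambda>n. N (a n)) \<longlonglongrightarrow> 0"
    using unbounded_counit_sequence[OF N unb] by blast
  from canonical_iso_null[OF iso a(2,3)] have "(\<lambda>n. tilde_norm G N (a n)) \<longlonglongrightarrow> 0" .
  hence "(\<lambda>n. cmod (cou (a n))) \<longlonglongrightarrow> 0"
    by (rule Lim_null_comparison[rotated]) (simp add: tilde_norm_def)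
  thus False by (simp add: a(1) LIMSEQ_const_iff)
qed

end

section \<open>Faithfulness of the Haar state and the reduced norm\<close>

context cqg
begin

lemma comult_mult: "comult G (a * b) = comult G a * comult G b"
  and comult_star: "comult G (star a) = star (comult G a)"
  and comult_clinear: "clinear (comult G)"
  and comult_one [simp]: "comult G 1 = 1"
  using comult_hom by (simp_all add: star_hom_def)

lemma clinear_haar_mult: "clinear (\<lambda>c. hr (b * c))"
  by (simp add: clinear_def distrib_left mult_scaleC_right haar_simps scaleC_complex_def)

definition haar_null :: "'a \<Rightarrow> bool" where
  "haar_null y \<longleftrightarrow> (\<forall>b. hr (b * y) = 0)"

text \<open>Invariance of \<open>h\<close>, applied to \<open>v\<^sub>k\<^sub>l y\<close>, gives \<open>\<Sum>\<^sub>m v\<^sub>k\<^sub>m z\<^sub>m = 0\<close> for the slices \<open>z\<^sub>m\<close> of \<open>\<Delta>(y)\<close> by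
  \<open>h(v\<^sub>m\<^sub>l \<cdot>)\<close>; multiplying by the inverse of the matrix \<open>v\<close> gives \<open>z\<^sub>m = 0\<close>.\<close>

lemma haar_null_slice_right:
  assumes "haar_null y"
  shows "slice_right (\<lambda>c. hr (b * c)) (comult G y) = 0"
proof (induction b rule: Pol_induct)
  case zero
  show ?case
    by (simp add: slice_right_def tensor_lift_def tsum_def haar_simps split_def)
next
  case (add a b)
  thus ?case
    by (simp add: distrib_right haar_simps slice_right_fun_add)
next
  case (scale k a)
  thus ?case
    by (simp add: mult_scaleC_left haar_simps slice_right_fun_scale)
next
  case (entry n v p l)
  define z where "z = (\<lambda>m. slice_right (\<lambda>c. hr (v m l * c)) (comult G y))"
  have k: "(\<Sum>m<n. v k m * z m) = 0" if "k < n" for k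
  proof -
    have "0 = slice_right hr (comult G (v k l * y))"
      using assms by (simp add: haar_right haar_null_def)
    also have "\<dots> = (\<Sum>m<n. slice_right hr ((v k m \<otimes>\<^sub>C v m l) * comult G y))"
      using entry that by (simp add: comult_mult corep_comult sum_distrib_right slice_right_simps haar_clinear)
    also have "\<dots> = (\<Sum>m<n. v k m * z m)"
      by (simp add: slice_right_mult_left haar_clinear z_def)
    finally show ?thesis by simp
  qed
  have "0 = (\<Sum>k<n. star (v k p) * (\<Sum>m<n. v k m * z m))" by (simp add: k)
  also have "\<dots> = (\<Sum>m<n. (\<Sum>k<n. star (v k p) * v k m) * z m)"
    by (simp add: sum_distrib_left sum_distrib_right mult.assoc) (rule sum.swap)
  also have "\<dots> = (\<Sum>m<n. if p = m then z m else 0)"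
    by (intro sum.cong refl) (use entry corep_star_left in auto)
  also have "\<dots> = z p" using entry by simp
  finally show ?case by (simp add: z_def)
qed

lemma haar_null_slice_left:
  assumes "haar_null y" "clinear f"
  shows "haar_null (slice_left f (comult G y))"
  unfolding haar_null_def
proof
  fix b
  have "hr (b * slice_left f (comult G y)) = f (slice_right (\<lambda>c. hr (b * c)) (comult G y))"
    using slice_Fubini[OF assms(2) clinear_haar_mult[of b]] .
  thus "hr (b * slice_left f (comult G y)) = 0"
    by (simp add: haar_null_slice_right[OF assms(1)] clinear_0[OF assms(2)])
qed

text \<open>The null space is a left ideal and a left coideal, so it contains \<open>\<Sum> S(y\<^sub>1) y\<^sub>2 = \<epsilon>(y)1\<close>.\<close>

lemma haar_null_counit:
  assumes "haar_null y"
  shows "cou y = 0"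
proof -
  obtain L where L: "comult G y = (\<Sum>(a, b)\<leftarrow>L. a \<otimes>\<^sub>C b)" using tensor_list_rep by blast
  obtain E f where E: "finite E" "\<forall>e. clinear (f e)"
    "\<forall>x\<in>fst ` set L. x = (\<Sum>e\<in>E. f e x *\<^sub>C e)"
    using finite_expansion[of "fst ` set L"] by auto
  have S: "clinear (antipode G)" by (rule antipode_clinear)
  have "hr (tensor_lift (\<lambda>x y. antipode G x * y) (\<Sum>(a, b)\<leftarrow>M. a \<otimes>\<^sub>C b)) =
      (\<Sum>e\<in>E. hr (antipode G e * slice_left (f e) (\<Sum>(a, b)\<leftarrow>M. a \<otimes>\<^sub>C b)))" if "set M \<subseteq> set L" for M
    using that
  proof (induction M)
    case Nil
    have "tensor_lift (\<lambda>x y. antipode G x * y) 0 = (0::'a)"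
      by (rule clinear_0[OF tensor_lift_clinear[OF cbilinear_antipode(1)]])
    thus ?case using E(2) by (simp add: haar_simps slice_left_simps)
  next
    case (Cons p M)
    have "hr (antipode G (fst p) * snd p) = (\<Sum>e\<in>E. hr (antipode G e * (f e (fst p) *\<^sub>C snd p)))"
    proof -
      have "antipode G (fst p) = antipode G (\<Sum>e\<in>E. f e (fst p) *\<^sub>C e)"
        using E(3) Cons.prems by simp
      also have "\<dots> = (\<Sum>e\<in>E. f e (fst p) *\<^sub>C antipode G e)"
        by (simp only: clinear_sum[OF S] clinear_scaleC[OF S])
      finally show ?thesis
        by (simp only: sum_distrib_right mult_scaleC_left mult_scaleC_right haar_simps)
    qed
    thus ?case
      using Cons E(2)
      by (simp add: clinear_add[OF tensor_lift_clinear[OF cbilinear_antipode(1)]] tensor_lift_elem cbilinear_antipode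
          slice_left_simps haar_simps distrib_left sum.distrib case_prod_beta)
  qed
  from this[of L] have "hr (cou y *\<^sub>C 1) = (\<Sum>e\<in>E. hr (antipode G e * slice_left (f e) (comult G y)))"
    unfolding L[symmetric] antipode_left by simp
  also have "\<dots> = 0"
    using haar_null_slice_left[OF assms] E(2) by (simp add: haar_null_def)
  finally show ?thesis by (simp add: haar_simps)
qed

text \<open>A null element \<open>a\<close> has \<open>f(a) = \<epsilon>((f \<otimes> id)\<Delta>(a))\<close>, where \<open>(f \<otimes> id)\<Delta>(a)\<close> is null again.\<close>

lemma haar_faithful:
  assumes "hr (star a * a) = 0"
  shows "a = 0"
proof (rule eq_by_functionals)
  have null: "haar_null a"
    unfolding haar_null_def
  proof
    fix b
    show "hr (b * a) = 0" using hf.null_left[of a "star b"] assms by (simp add: star_star)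
  qed
  fix f :: "'a \<Rightarrow> complex" assume f: "clinear f"
  have "f a = f (slice_right cou (comult G a))" by (simp add: counit_right)
  also have "\<dots> = cou (slice_left f (comult G a))"
    using slice_Fubini[OF f counit_clinear] by simp
  also have "\<dots> = 0" by (rule haar_null_counit[OF haar_null_slice_left[OF null f]])
  finally show "f a = f 0" by (simp add: clinear_0[OF f])
qed

lemma L2_norm_nrm: "L2_norm G = hf.nrm"
  by (simp add: fun_eq_iff L2_norm_def hf.nrm_def)

lemma L2_norm_eq_0: "L2_norm G a = 0 \<longleftrightarrow> a = 0"
proof
  assume "L2_norm G a = 0"
  hence "hr (star a * a) = 0" using L2_norm_square[of a] haar_form_real[of a] by (simp add: complex_eq_iff)
  thus "a = 0" by (rule haar_faithful)
qed (simp add: L2_norm_def haar_simps)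

lemma L2_norm_zero [simp]: "L2_norm G 0 = 0"
  by (simp add: L2_norm_eq_0)

lemmas L2_norm_add = hf.nrm_add[folded L2_norm_nrm]
lemmas L2_norm_scale = hf.nrm_scale[folded L2_norm_nrm]
lemmas L2_inner_le = hf.inner_le_nrm[folded L2_norm_nrm]

lemma L2_norm_one [simp]: "L2_norm G 1 = 1"
  by (simp add: L2_norm_def)

lemma left_mult_bounded: "\<exists>C\<ge>0. \<forall>b. L2_norm G (a * b) \<le> C * L2_norm G b"
proof (rule Pol_bounded_induct)
  fix a b c :: 'a and k :: complex
  show "L2_norm G ((a + b) * c) \<le> L2_norm G (a * c) + L2_norm G (b * c)"
    by (simp add: distrib_right L2_norm_add)
  show "L2_norm G ((k *\<^sub>C a) * c) = cmod k * L2_norm G (a * c)"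
    by (simp add: mult_scaleC_left L2_norm_scale)
next
  fix n v i j assume entry: "unitary_corep G n v" "i < n" "j < n"
  have "L2_norm G (v i j * b) \<le> L2_norm G b" for b
  proof (rule power2_le_imp_le)
    have "(L2_norm G (v i j * b))\<^sup>2 \<le> (\<Sum>k<n. (L2_norm G (v k j * b))\<^sup>2)"
      using entry by (intro member_le_sum) auto
    also have "\<dots> = Re (hr (star b * (\<Sum>k<n. star (v k j) * v k j) * b))"
      by (simp add: L2_norm_square haar_simps sum_distrib_left sum_distrib_right star_mult mult.assoc)
    also have "\<dots> = (L2_norm G b)\<^sup>2" using entry by (simp add: corep_star_left L2_norm_square)
    finally show "(L2_norm G (v i j * b))\<^sup>2 \<le> (L2_norm G b)\<^sup>2" .
  qed simp
  thus "\<exists>C\<ge>0. \<forall>b. L2_norm G (v i j * b) \<le> C * L2_norm G b" by (intro exI[of _ 1]) simp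
qed

abbreviation "red \<equiv> red_norm G"

lemma red_norm_bdd: "bdd_above ((\<lambda>b. L2_norm G (a * b)) ` {b. L2_norm G b \<le> 1})"
proof -
  obtain C where C: "C \<ge> 0" "\<And>b. L2_norm G (a * b) \<le> C * L2_norm G b" using left_mult_bounded by blast
  have "L2_norm G (a * b) \<le> C" if "L2_norm G b \<le> 1" for b
    using C(2)[of b] mult_left_mono[OF that C(1)] by simp
  thus ?thesis by (auto simp: bdd_above_def)
qed

lemma red_norm_nonneg: "red a \<ge> 0"
proof -
  have "L2_norm G (a * 0) \<le> red a"
    unfolding red_norm_def by (rule cSUP_upper[OF _ red_norm_bdd]) simp
  thus ?thesis by simp
qed

lemma L2_norm_mult_le: "L2_norm G (a * b) \<le> red a * L2_norm G b"
proof (cases "b = 0")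
  case False
  hence b: "L2_norm G b > 0" by (metis L2_norm_eq_0 L2_norm_nonneg less_le)
  define c where "c = of_real (1 / L2_norm G b) *\<^sub>C b"
  have n: "L2_norm G (of_real (1 / L2_norm G b) *\<^sub>C x) = L2_norm G x / L2_norm G b" for x
    unfolding L2_norm_scale norm_of_real using b by simp
  have "L2_norm G c \<le> 1" using b by (simp only: c_def n) simp
  hence "L2_norm G (a * c) \<le> red a"
    unfolding red_norm_def by (intro cSUP_upper[OF _ red_norm_bdd]) simp
  moreover have "L2_norm G (a * c) = L2_norm G (a * b) / L2_norm G b"
    by (simp only: c_def mult_scaleC_right n)
  ultimately show ?thesis using b by (simp add: field_simps)
qed simp

lemma red_norm_le:
  assumes "K \<ge> 0" "\<And>b. L2_norm G (a * b) \<le> K * L2_norm G b"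
  shows "red a \<le> K"
  unfolding red_norm_def
proof (rule cSUP_least)
  show "{b. L2_norm G b \<le> 1} \<noteq> {}" using L2_norm_one by (metis (mono_tags) empty_iff mem_Collect_eq order_refl)
  fix b assume "b \<in> {b. L2_norm G b \<le> 1}"
  thus "L2_norm G (a * b) \<le> K" using assms(2)[of b] mult_left_mono[of "L2_norm G b" 1 K] assms(1) by simp
qed

lemma cstar_norm_red_norm: "cstar_norm red"
proof -
  have scale_le: "red (c *\<^sub>C a) \<le> cmod c * red a" for c a
    by (rule red_norm_le)
      (simp_all add: red_norm_nonneg mult_scaleC_left L2_norm_scale mult.assoc mult_left_mono L2_norm_mult_le)
  have mult: "red (a * b) \<le> red a * red b" for a b
  proof (rule red_norm_le)
    fix c
    have "L2_norm G (a * b * c) \<le> red a * L2_norm G (b * c)" unfolding mult.assoc by (rule L2_norm_mult_le)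
    also have "\<dots> \<le> red a * (red b * L2_norm G c)" by (intro mult_left_mono L2_norm_mult_le red_norm_nonneg)
    finally show "L2_norm G (a * b * c) \<le> red a * red b * L2_norm G c" by (simp add: mult.assoc)
  qed (simp add: red_norm_nonneg)
  have zero: "red a = 0 \<longleftrightarrow> a = 0" for a
  proof
    assume "red a = 0"
    hence "L2_norm G (a * 1) \<le> 0" using L2_norm_mult_le[of a 1] by simp
    thus "a = 0" using L2_norm_eq_0[of a] L2_norm_nonneg[of a] by simp
  next
    assume "a = 0"
    hence "red a \<le> 0" by (intro red_norm_le) simp_all
    thus "red a = 0" using red_norm_nonneg[of a] by simp
  qed
  have sq: "(red a)\<^sup>2 \<le> red (star a * a)" for a
  proof -
    have "red a \<le> sqrt (red (star a * a))"
    proof (rule red_norm_le)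
      fix b
      have "(L2_norm G (a * b))\<^sup>2 = Re (hr (star b * (star a * a * b)))"
        by (simp add: L2_norm_square star_mult mult.assoc)
      also have "\<dots> \<le> L2_norm G (star a * a * b) * L2_norm G b"
        by (rule order_trans[OF complex_Re_le_cmod L2_inner_le])
      also have "\<dots> \<le> red (star a * a) * L2_norm G b * L2_norm G b"
        by (intro mult_right_mono L2_norm_mult_le) simp
      finally have "L2_norm G (a * b) \<le> sqrt (red (star a * a) * (L2_norm G b)\<^sup>2)"
        by (intro real_le_rsqrt) (simp add: power2_eq_square mult.assoc)
      thus "L2_norm G (a * b) \<le> sqrt (red (star a * a)) * L2_norm G b"
        by (simp add: real_sqrt_mult)
    qed (simp add: red_norm_nonneg)
    thus ?thesis using red_norm_nonneg[of a] red_norm_nonneg[of "star a * a"] by (metis power_mono real_sqrt_pow2)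
  qed
  have star_le: "red a \<le> red (star a)" for a
  proof (cases "red a = 0")
    case False
    have "red a * red a \<le> red (star a) * red a"
      using sq[of a] mult[of "star a" a] by (simp add: power2_eq_square)
    thus ?thesis using False red_norm_nonneg[of a] by (simp add: mult_le_cancel_right)
  qed (simp add: red_norm_nonneg)
  have star: "red (star a) = red a" for a
    using star_le[of a] star_le[of "star a"] by (simp add: star_star)
  show ?thesis
    unfolding cstar_norm_def
  proof (intro conjI allI)
    fix a b :: 'a and c :: complex
    show "red (a + b) \<le> red a + red b"
    proof (rule red_norm_le)
      fix x show "L2_norm G ((a + b) * x) \<le> (red a + red b) * L2_norm G x"
        using L2_norm_add[of "a * x" "b * x"] L2_norm_mult_le[of a x] L2_norm_mult_le[of b x]
        by (simp add: distrib_right)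
    qed (simp add: red_norm_nonneg)
    show "red (c *\<^sub>C a) = cmod c * red a"
      by (rule norm_scale_eq) (simp_all add: zero scale_le)
    show "red (star a * a) = (red a)\<^sup>2"
      using sq[of a] mult[of "star a" a] by (simp add: star power2_eq_square)
  qed (simp_all add: red_norm_nonneg zero mult)
qed

end

section \<open>A bounded counit forces co-amenability\<close>

context cqg
begin

text \<open>If no unit vector is almost fixed by \<open>F\<close>, then \<open>x = \<Sum> (a - \<epsilon>(a))\<^sup>* (a - \<epsilon>(a))\<close> is bounded below
  on \<open>L\<^sup>2\<close>, so \<open>R - x\<close> has reduced norm less than \<open>R\<close>, although \<open>\<epsilon>(R - x) = R\<close>. Powers of \<open>R - x\<close>
  show that \<open>\<epsilon>\<close> is unbounded.\<close>

lemma almost_invariant_in_L2: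
  assumes K: "\<And>a. cmod (cou a) \<le> K * red a" and F: "finite F" and d: "\<delta> > 0"
  shows "\<exists>\<xi>. L2_norm G \<xi> = 1 \<and> (\<forall>a\<in>F. (L2_norm G (a * \<xi> - cou a *\<^sub>C \<xi>))\<^sup>2 \<le> \<delta>)"
proof (rule ccontr)
  assume neg: "\<not> ?thesis"
  interpret R: cstar_normed red by unfold_locales (rule cstar_norm_red_norm)
  define x where "x = (\<Sum>a\<in>F. star (a - cou a *\<^sub>C 1) * (a - cou a *\<^sub>C 1))"
  have sx: "star x = x" by (simp add: x_def star_sum star_mult star_star)
  have hx: "Re (hr (star \<xi> * (x * \<xi>))) = (\<Sum>a\<in>F. (L2_norm G (a * \<xi> - cou a *\<^sub>C \<xi>))\<^sup>2)" for \<xi>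
  proof -
    have "a * \<xi> - cou a *\<^sub>C \<xi> = (a - cou a *\<^sub>C 1) * \<xi>" for a
      by (simp add: left_diff_distrib mult_scaleC_left)
    thus ?thesis
      by (simp add: L2_norm_square x_def sum_distrib_left sum_distrib_right haar_simps star_mult mult.assoc)
  qed
  have low1: "\<delta> \<le> Re (hr (star \<xi> * (x * \<xi>)))" if unit: "L2_norm G \<xi> = 1" for \<xi>
  proof -
    obtain a where a: "a \<in> F" "\<delta> \<le> (L2_norm G (a * \<xi> - cou a *\<^sub>C \<xi>))\<^sup>2"
      using neg unit by (meson less_imp_le not_le)
    note a(2)
    also have "(L2_norm G (a * \<xi> - cou a *\<^sub>C \<xi>))\<^sup>2 \<le> (\<Sum>a\<in>F. (L2_norm G (a * \<xi> - cou a *\<^sub>C \<xi>))\<^sup>2)"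
      using a(1) F by (intro member_le_sum) auto
    finally show ?thesis by (simp add: hx)
  qed
  have low: "\<delta> * (L2_norm G \<xi>)\<^sup>2 \<le> Re (hr (star \<xi> * (x * \<xi>)))" for \<xi>
  proof (cases "\<xi> = 0")
    case False
    hence p: "L2_norm G \<xi> > 0" by (metis L2_norm_eq_0 L2_norm_nonneg less_le)
    define c where "c = 1 / L2_norm G \<xi>"
    have c: "c > 0" "c * L2_norm G \<xi> = 1" using p by (simp_all add: c_def)
    have "L2_norm G (of_real c *\<^sub>C \<xi>) = 1"
      unfolding L2_norm_scale norm_of_real using c by simp
    from low1[OF this] have "\<delta> \<le> c\<^sup>2 * Re (hr (star \<xi> * (x * \<xi>)))"
      by (simp add: star_scaleC mult_scaleC_left mult_scaleC_right haar_simps power2_eq_square)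
    hence "\<delta> * (L2_norm G \<xi>)\<^sup>2 \<le> (c\<^sup>2 * Re (hr (star \<xi> * (x * \<xi>)))) * (L2_norm G \<xi>)\<^sup>2"
      by (rule mult_right_mono) simp
    also have "\<dots> = (c * L2_norm G \<xi>)\<^sup>2 * Re (hr (star \<xi> * (x * \<xi>)))"
      by (simp add: power_mult_distrib)
    finally show ?thesis using c(2) by simp
  qed (simp add: haar_simps)
  define y where "y = of_real (red x + \<delta>) *\<^sub>C 1 - x"
  have sy: "star y = y" by (simp add: y_def star_simps sx)
  have hy: "Re (hr (star \<xi> * (y * \<xi>))) = (red x + \<delta>) * (L2_norm G \<xi>)\<^sup>2 - Re (hr (star \<xi> * (x * \<xi>)))" for \<xi>
    by (simp add: y_def L2_norm_square left_diff_distrib right_diff_distrib mult_scaleC_left mult_scaleC_right haar_simps)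
  have hy_le: "Re (hr (star \<xi> * (y * \<xi>))) \<le> red x * (L2_norm G \<xi>)\<^sup>2" for \<xi>
    using low[of \<xi>] hy[of \<xi>] by (simp add: algebra_simps)
  have hy_nonneg: "0 \<le> Re (hr (star \<xi> * (y * \<xi>)))" for \<xi>
  proof -
    have "Re (hr (star \<xi> * (x * \<xi>))) \<le> L2_norm G (x * \<xi>) * L2_norm G \<xi>"
      by (rule order_trans[OF complex_Re_le_cmod L2_inner_le])
    also have "\<dots> \<le> red x * L2_norm G \<xi> * L2_norm G \<xi>"
      by (intro mult_right_mono L2_norm_mult_le) simp
    finally have "Re (hr (star \<xi> * (x * \<xi>))) \<le> red x * (L2_norm G \<xi>)\<^sup>2" by (simp add: power2_eq_square mult.assoc)
    moreover have "0 \<le> \<delta> * (L2_norm G \<xi>)\<^sup>2" using d by simp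
    ultimately show ?thesis unfolding hy by (simp add: algebra_simps)
  qed
  interpret Y: psd_form "\<lambda>\<xi> \<eta>. hr (star \<eta> * (y * \<xi>))"
  proof
    show "hr (star \<xi> * (y * \<eta>)) = cnj (hr (star \<eta> * (y * \<xi>)))" for \<xi> \<eta>
      using hf.hermitian[of "y * \<eta>" \<xi>] by (simp add: star_mult sy mult.assoc)
  qed (simp_all add: haar_simps distrib_left mult_scaleC_right hy_nonneg)
  have "red y \<le> red x"
  proof (rule red_norm_le)
    fix \<xi>
    let ?l = "L2_norm G (y * \<xi>)"
    have "?l\<^sup>2 = Re (hr (star (y * \<xi>) * (y * \<xi>)))" by (simp add: L2_norm_square)
    also have "\<dots> \<le> cmod (hr (star (y * \<xi>) * (y * \<xi>)))" by (rule complex_Re_le_cmod)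
    finally have "(?l\<^sup>2)\<^sup>2 \<le> (cmod (hr (star (y * \<xi>) * (y * \<xi>))))\<^sup>2" by (rule power_mono) simp
    also have "\<dots> \<le> Re (hr (star \<xi> * (y * \<xi>))) * Re (hr (star (y * \<xi>) * (y * (y * \<xi>))))"
      by (rule Y.Cauchy_Schwarz)
    also have "\<dots> \<le> (red x * (L2_norm G \<xi>)\<^sup>2) * (red x * ?l\<^sup>2)"
      by (intro mult_mono hy_le hy_nonneg) (simp add: red_norm_nonneg)
    finally have "?l\<^sup>2 * ?l\<^sup>2 \<le> (red x * L2_norm G \<xi>)\<^sup>2 * ?l\<^sup>2" by (simp add: power2_eq_square mult_ac)
    hence "?l\<^sup>2 \<le> (red x * L2_norm G \<xi>)\<^sup>2 \<or> ?l = 0"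
      by (metis L2_norm_nonneg less_le mult_le_cancel_right zero_less_power)
    thus "?l \<le> red x * L2_norm G \<xi>"
      by (auto intro: power2_le_imp_le simp: red_norm_nonneg)
  qed (rule red_norm_nonneg)
  have "cou x = 0" by (simp add: x_def counit_sum)
  hence cy: "cou y = of_real (red x + \<delta>)" by (simp add: y_def)
  have rx: "red x + \<delta> > 0" using d red_norm_nonneg[of x] by linarith
  have K0: "K \<ge> 1" using K[of 1] by simp
  have pw: "(red x + \<delta>) ^ n \<le> K * (red x) ^ n" for n
  proof -
    have "cou (y ^ n) = cou y ^ n" by (induction n) simp_all
    moreover have "cmod (cou y) = red x + \<delta>" unfolding cy norm_of_real using rx by simp
    ultimately have "(red x + \<delta>) ^ n = cmod (cou (y ^ n))" by (simp only: norm_power)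
    also have "\<dots> \<le> K * red (y ^ n)" by (rule K)
    also have "\<dots> \<le> K * (red x) ^ n"
    proof (rule mult_left_mono)
      have "red (y ^ n) \<le> red y ^ n" by (rule R.N_power)
      also have "\<dots> \<le> red x ^ n" by (rule power_mono[OF \<open>red y \<le> red x\<close> red_norm_nonneg])
      finally show "red (y ^ n) \<le> red x ^ n" .
    qed (use K0 in simp)
    finally show ?thesis .
  qed
  show False
  proof (cases "red x = 0")
    case True
    thus False using pw[of 1] d by simp
  next
    case False
    hence p: "red x > 0" using red_norm_nonneg[of x] by linarith
    have "1 < (red x + \<delta>) / red x" using p d by simp
    then obtain n where "K < ((red x + \<delta>) / red x) ^ n" using real_arch_pow by blast
    thus False using pw[of n] p by (simp add: power_divide field_simps)
  qed
qed

text \<open>The map \<open>c \<mapsto> (\<omega> \<otimes> id)\<Delta>(c)\<close> for the vector functional \<open>\<omega>(x) = h(\<eta>\<^sup>* x \<xi>)\<close>.\<close>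

definition corner :: "'a \<Rightarrow> 'a \<Rightarrow> 'a \<Rightarrow> 'a" where
  "corner \<xi> \<eta> c = slice_left hr ((star \<eta> \<otimes>\<^sub>C 1) * comult G c * (\<xi> \<otimes>\<^sub>C 1))"

lemma corner_clinear: "clinear (corner \<xi> \<eta>)"
  unfolding clinear_def
  by (simp add: corner_def clinear_add[OF comult_clinear] clinear_scaleC[OF comult_clinear]
      distrib_left distrib_right mult_scaleC_left mult_scaleC_right slice_left_simps haar_clinear)

lemma corner_simps:
  "corner (\<xi> + \<xi>') \<eta> c = corner \<xi> \<eta> c + corner \<xi>' \<eta> c"
  "corner \<xi> (\<eta> + \<eta>') c = corner \<xi> \<eta> c + corner \<xi> \<eta>' c"
  "corner (k *\<^sub>C \<xi>) \<eta> c = k *\<^sub>C corner \<xi> \<eta> c"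
  "corner \<xi> (k *\<^sub>C \<eta>) c = cnj k *\<^sub>C corner \<xi> \<eta> c"
  by (simp_all add: corner_def star_add star_scaleC elem_tensor_simps distrib_left distrib_right
      mult_scaleC_left mult_scaleC_right slice_left_simps haar_clinear)

text \<open>Fell absorption: the unitary \<open>a \<otimes> b \<mapsto> \<Delta>(a)(1 \<otimes> b)\<close> turns left multiplication by \<open>\<Delta>(c)\<close> into that
  by \<open>c \<otimes> 1\<close>. Here it is in coordinates, for a vector \<open>v\<^sub>i\<^sub>j \<otimes> 1\<close>.\<close>

lemma entry_tensor_one:
  assumes v: "unitary_corep G n v" "i < n" "j < n"
  shows "v i j \<otimes>\<^sub>C 1 = (\<Sum>p<n. comult G (v i p) * (1 \<otimes>\<^sub>C star (v j p)))"
proof -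
  have "(\<Sum>p<n. comult G (v i p) * (1 \<otimes>\<^sub>C star (v j p))) = (\<Sum>p<n. \<Sum>k<n. v i k \<otimes>\<^sub>C (v k p * star (v j p)))"
    by (intro sum.cong refl) (simp add: corep_comult[OF v(1,2)] sum_distrib_right elem_tensor_mult)
  also have "\<dots> = (\<Sum>k<n. \<Sum>p<n. v i k \<otimes>\<^sub>C (v k p * star (v j p)))" by (rule sum.swap)
  also have "\<dots> = (\<Sum>k<n. v i k \<otimes>\<^sub>C (\<Sum>p<n. v k p * star (v j p)))" by (simp add: elem_tensor_sum_right)
  also have "\<dots> = (\<Sum>k<n. if k = j then v i k \<otimes>\<^sub>C 1 else 0)"
    by (intro sum.cong refl) (auto simp: corep_star_right[OF v(1) _ v(3)] elem_tensor_simps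
        clinear_0[OF cbilinear_clinear(1)[OF cbilinear_elem_tensor]])
  finally show ?thesis using v(3) by simp
qed

lemma corner_entry:
  assumes v: "unitary_corep G n v" "i < n" "j < n" and w: "unitary_corep G m w" "k < m" "l < m"
  shows "corner (v i j) (w k l) c =
    (\<Sum>q<m. \<Sum>p<n. hr (star (w k q) * (c * v i p)) *\<^sub>C (w l q * star (v j p)))"
proof -
  have "star (w k l \<otimes>\<^sub>C 1) = (\<Sum>q<m. (1 \<otimes>\<^sub>C w l q) * star (comult G (w k q)))"
    unfolding entry_tensor_one[OF w] by (simp add: star_sum star_mult elem_tensor_star star_star)
  hence "(star (w k l) \<otimes>\<^sub>C 1) * comult G c * (v i j \<otimes>\<^sub>C 1) =
      (\<Sum>q<m. (1 \<otimes>\<^sub>C w l q) * star (comult G (w k q))) * comult G c *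
      (\<Sum>p<n. comult G (v i p) * (1 \<otimes>\<^sub>C star (v j p)))"
    by (simp add: elem_tensor_star entry_tensor_one[OF v])
  also have "\<dots> = (\<Sum>q<m. \<Sum>p<n. (1 \<otimes>\<^sub>C w l q) * comult G (star (w k q) * (c * v i p)) * (1 \<otimes>\<^sub>C star (v j p)))"
    by (simp add: sum_distrib_left sum_distrib_right comult_mult comult_star mult.assoc) (rule sum.swap)
  finally show ?thesis
    by (simp add: corner_def slice_left_simps haar_clinear slice_left_sandwich haar_left mult_scaleC_left mult_scaleC_right)
qed

text \<open>The constant depends on \<open>\<xi>\<close> and \<open>\<eta>\<close>. It only serves to pass to limits in \<open>corner_pos\<close>; the bound that
  matters, \<open>corner_le\<close>, comes from positivity.\<close>

lemma corner_bounded: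
  assumes N: "cstar_norm N"
  shows "\<exists>C\<ge>0. \<forall>c. N (corner \<xi> \<eta> c) \<le> C * red c"
proof -
  interpret cstar_normed N by unfold_locales fact
  show ?thesis
  proof (rule Pol_bounded_induct[of "\<lambda>\<eta> c. N (corner \<xi> \<eta> c)" red], goal_cases)
    case (3 m w k l)
    note w = this
    show ?case
    proof (rule Pol_bounded_induct[of "\<lambda>\<xi> c. N (corner \<xi> (w k l) c)" red], goal_cases)
      case entry: (3 n v i j)
      have "N (corner (v i j) (w k l) c) \<le> (\<Sum>q<m. \<Sum>p<n. N (w l q * star (v j p))) * red c" for c
      proof -
        have "N (corner (v i j) (w k l) c) \<le>
            (\<Sum>q<m. \<Sum>p<n. cmod (hr (star (w k q) * (c * v i p))) * N (w l q * star (v j p)))"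
          unfolding corner_entry[OF entry w]
          by (rule order_trans[OF N_sum sum_mono], rule order_trans[OF N_sum sum_mono]) (simp add: N_scaleC)
        also have "\<dots> \<le> (\<Sum>q<m. \<Sum>p<n. red c * N (w l q * star (v j p)))"
        proof (intro sum_mono mult_right_mono)
          fix q p assume qp: "q \<in> {..<m}" "p \<in> {..<n}"
          have "cmod (hr (star (w k q) * (c * v i p))) \<le> L2_norm G (c * v i p) * L2_norm G (w k q)"
            by (rule L2_inner_le)
          also have "\<dots> \<le> (red c * 1) * 1"
          proof (rule mult_mono)
            show "L2_norm G (c * v i p) \<le> red c * 1"
              using L2_norm_mult_le[of c "v i p"] mult_left_mono[OF L2_norm_entry_le[OF entry(1,2)] red_norm_nonneg, of p c] qp
              by simp
            show "L2_norm G (w k q) \<le> 1" using L2_norm_entry_le[OF w(1,2)] qp by simp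
          qed (simp_all add: red_norm_nonneg)
          finally show "cmod (hr (star (w k q) * (c * v i p))) \<le> red c" by simp
        qed simp
        finally show ?thesis by (simp add: sum_distrib_left mult.commute[of _ "red c"])
      qed
      thus ?case by (intro exI[of _ "\<Sum>q<m. \<Sum>p<n. N (w l q * star (v j p))"]) (simp add: sum_nonneg)
    qed (simp_all add: corner_simps N_add N_scaleC)
  qed (simp_all add: corner_simps N_add N_scaleC)
qed

lemma slice_haar_star: "slice_left hr (star t) = star (slice_left hr t)"
proof -
  have "hr (star a) = cnj (hr a)" for a using hf.hermitian[of 1 a] by simp
  thus ?thesis
    by (induction t rule: tensor_induct)
      (simp_all add: slice_left_simps haar_clinear star_add elem_tensor_star star_scaleC)
qed

lemma corner_star: "corner \<xi> \<xi> (star c) = star (corner \<xi> \<xi> c)"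
  unfolding corner_def slice_haar_star[symmetric]
  by (simp add: star_mult elem_tensor_star comult_star star_star mult.assoc)

text \<open>After orthonormalizing the first legs, \<open>T = \<Sum> e\<^sub>l \<otimes> B\<^sub>l\<close> and \<open>(h \<otimes> id)(T\<^sup>* T) = \<Sum> B\<^sub>l\<^sup>* B\<^sub>l\<close>.\<close>

lemma slice_haar_pos:
  assumes N: "cstar_norm N"
  shows "cstar_normed.pos N (slice_left hr (star T * T))"
proof -
  interpret cstar_normed N by unfold_locales fact
  obtain k :: nat and a b where T: "T = (\<Sum>i<k. a i \<otimes>\<^sub>C b i)"
    by (rule tensor_indexed_rep[of T])
  obtain es where es: "hf.orthonormal es"
    "\<And>x. x \<in> CV.span (a ` {..<k}) \<Longrightarrow> Re (hr (star (x - hf.proj es x) * (x - hf.proj es x))) = 0"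
    using hf.Gram_Schmidt[OF CV.subspace_UNIV, of "a ` {..<k}"] by auto
  have a: "a i = (\<Sum>l<length es. hr (star (es ! l) * a i) *\<^sub>C es ! l)" if "i < k" for i
  proof -
    have "Re (hr (star (a i - hf.proj es (a i)) * (a i - hf.proj es (a i)))) = 0"
      by (rule es(2), rule CV.span_base) (use that in auto)
    hence "L2_norm G (a i - hf.proj es (a i)) = 0" by (simp add: L2_norm_def)
    thus ?thesis by (simp add: L2_norm_eq_0 hf.proj_def)
  qed
  define B where "B = (\<lambda>l. \<Sum>i<k. hr (star (es ! l) * a i) *\<^sub>C b i)"
  have "T = (\<Sum>i<k. (\<Sum>l<length es. hr (star (es ! l) * a i) *\<^sub>C es ! l) \<otimes>\<^sub>C b i)"
    unfolding T by (intro sum.cong refl arg_cong2[of _ _ _ _ "(\<otimes>\<^sub>C)"] a) simp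
  also have "\<dots> = (\<Sum>i<k. \<Sum>l<length es. es ! l \<otimes>\<^sub>C (hr (star (es ! l) * a i) *\<^sub>C b i))"
    by (simp add: elem_tensor_sum_left elem_tensor_simps)
  also have "\<dots> = (\<Sum>l<length es. es ! l \<otimes>\<^sub>C B l)"
    unfolding B_def elem_tensor_sum_right by (rule sum.swap)
  finally have "star T * T = (\<Sum>l<length es. \<Sum>m<length es. (star (es ! l) * es ! m) \<otimes>\<^sub>C (star (B l) * B m))"
    by (simp add: star_sum elem_tensor_star sum_product elem_tensor_mult)
  hence "slice_left hr (star T * T) = (\<Sum>l<length es. \<Sum>m<length es. hr (star (es ! l) * es ! m) *\<^sub>C (star (B l) * B m))"
    by (simp add: slice_left_simps haar_clinear)
  also have "\<dots> = (\<Sum>l<length es. \<Sum>m<length es. if m = l then star (B l) * B m else 0)"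
    by (intro sum.cong refl) (use es(1) in \<open>simp add: hf.orthonormal_def scaleC_one\<close>)
  also have "\<dots> = (\<Sum>l<length es. star (B l) * B l)" by simp
  also have "pos \<dots>" by (intro pos_sum pos_star_mult)
  finally show ?thesis .
qed

lemma corner_pos:
  assumes N: "cstar_norm N" and c: "cstar_normed.pos red c"
  shows "cstar_normed.pos N (corner \<xi> \<xi> c)"
proof -
  interpret cstar_normed N by unfold_locales fact
  interpret R: cstar_normed red by unfold_locales (rule cstar_norm_red_norm)
  obtain C where C: "C \<ge> 0" "\<And>c. N (corner \<xi> \<xi> c) \<le> C * red c" using corner_bounded[OF N] by blast
  show ?thesis
  proof (rule pos_closed)
    show "star (corner \<xi> \<xi> c) = corner \<xi> \<xi> c" using R.pos_sa[OF c] corner_star[of \<xi> c] by simp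
    fix e :: real assume e: "e > 0"
    hence d: "e / (C + 1) > 0" using C(1) by simp
    obtain y where y: "star y = y" "red (y * y - c) < e / (C + 1)" "\<forall>z. z * c = c * z \<longrightarrow> z * y = y * z"
      by (rule R.pos_sqrt_approx[OF c d])
    have "corner \<xi> \<xi> (y * y) = slice_left hr (star (comult G y * (\<xi> \<otimes>\<^sub>C 1)) * (comult G y * (\<xi> \<otimes>\<^sub>C 1)))"
      by (simp add: corner_def comult_mult star_mult elem_tensor_star mult.assoc y(1) flip: comult_star)
    hence "pos (corner \<xi> \<xi> (y * y))" by (simp add: slice_haar_pos[OF N])
    moreover have "N (corner \<xi> \<xi> c - corner \<xi> \<xi> (y * y)) < e"
    proof -
      have "N (corner \<xi> \<xi> c - corner \<xi> \<xi> (y * y)) = N (corner \<xi> \<xi> (c - y * y))"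
        by (simp add: clinear_diff[OF corner_clinear])
      also have "\<dots> \<le> C * red (c - y * y)" by (rule C(2))
      also have "\<dots> \<le> C * (e / (C + 1))"
        using y(2) C(1) R.N_minus_commute[of c "y * y"] by (intro mult_left_mono) auto
      also have "\<dots> < e" using e C(1) by (simp add: field_simps)
      finally show ?thesis .
    qed
    ultimately show "\<exists>p. pos p \<and> N (corner \<xi> \<xi> c - p) < e" by blast
  qed
qed

lemma corner_contractive_sa:
  assumes N: "cstar_norm N" and \<xi>: "L2_norm G \<xi> = 1" and c: "star c = c"
  shows "N (corner \<xi> \<xi> c) \<le> red c"
proof -
  interpret cstar_normed N by unfold_locales fact
  interpret R: cstar_normed red by unfold_locales (rule cstar_norm_red_norm)
  have one: "corner \<xi> \<xi> 1 = 1"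
  proof -
    have "hr (star \<xi> * \<xi>) = 1"
      using \<xi> L2_norm_square[of \<xi>] haar_form_real[of \<xi>] by (simp add: complex_eq_iff)
    thus ?thesis by (simp add: corner_def elem_tensor_mult slice_left_simps haar_clinear scaleC_one)
  qed
  have "R.pos (of_real (red c) *\<^sub>C 1 - c)" by (rule R.pos_N_minus[OF c])
  from corner_pos[OF N this, of \<xi>] have 1: "pos (of_real (red c) *\<^sub>C 1 - corner \<xi> \<xi> c)"
    by (simp add: clinear_diff[OF corner_clinear] clinear_scaleC[OF corner_clinear] one)
  have "R.pos (of_real (red (- c)) *\<^sub>C 1 - - c)" by (rule R.pos_N_minus) (simp add: star_minus c)
  hence "R.pos (of_real (red c) *\<^sub>C 1 + c)" by (simp add: R.N_minus)
  from corner_pos[OF N this, of \<xi>] have 2: "pos (of_real (red c) *\<^sub>C 1 + corner \<xi> \<xi> c)"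
    by (simp add: clinear_add[OF corner_clinear] clinear_scaleC[OF corner_clinear] one)
  show ?thesis by (rule N_le_of_pos_pm[OF 1 2]) simp
qed

lemma corner_le:
  assumes N: "cstar_norm N" and \<xi>: "L2_norm G \<xi> = 1"
  shows "N (corner \<xi> \<xi> c) \<le> 2 * red c"
proof -
  interpret cstar_normed N by unfold_locales fact
  interpret R: cstar_normed red by unfold_locales (rule cstar_norm_red_norm)
  define p where "p = (1 / 2) *\<^sub>C (c + star c)"
  define q where "q = (\<i> / 2) *\<^sub>C (star c - c)"
  have sa: "star p = p" "star q = q" by (simp_all add: p_def q_def star_simps alg_simps)
  have "\<i> *\<^sub>C q = (1 / 2) *\<^sub>C (c - star c)"
    by (simp add: q_def scaleC_scaleC) (simp add: alg_simps)
  hence "p + \<i> *\<^sub>C q = (1 / 2) *\<^sub>C (c + c)" by (simp add: p_def flip: scaleC_add_right)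
  also have "\<dots> = c" by (simp add: scaleC_add_right scaleC_one flip: scaleC_add_left)
  finally have cpq: "c = p + \<i> *\<^sub>C q" by simp
  have "red p \<le> red c" "red q \<le> red c"
    using R.N_add[of c "star c"] R.N_diff[of "star c" c] by (simp_all add: p_def q_def R.N_scaleC norm_divide)
  moreover have "N (corner \<xi> \<xi> c) \<le> N (corner \<xi> \<xi> p) + N (corner \<xi> \<xi> q)"
    using N_add[of "corner \<xi> \<xi> p" "\<i> *\<^sub>C corner \<xi> \<xi> q"]
    by (subst cpq) (simp add: clinear_add[OF corner_clinear] clinear_scaleC[OF corner_clinear] N_scaleC)
  ultimately show ?thesis
    using corner_contractive_sa[OF N \<xi> sa(1)] corner_contractive_sa[OF N \<xi> sa(2)] by linarith
qed

text \<open>For almost invariant \<open>\<xi>\<close> the map \<open>corner \<xi> \<xi>\<close> nearly fixes \<open>c = \<Sum> \<epsilon>(c\<^sub>1) c\<^sub>2\<close>.\<close>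

lemma norm_le_red_norm:
  assumes K: "\<And>a. cmod (cou a) \<le> K * red a" and N: "cstar_norm N"
  shows "N c \<le> 2 * red c"
proof (rule field_le_epsilon)
  fix e :: real assume e: "e > 0"
  interpret cstar_normed N by unfold_locales fact
  obtain k :: nat and a b where T: "comult G c = (\<Sum>i<k. a i \<otimes>\<^sub>C b i)"
    by (rule tensor_indexed_rep[of "comult G c"])
  define S where "S = (\<Sum>i<k. N (b i))"
  have S: "S \<ge> 0" by (simp add: S_def sum_nonneg)
  define d where "d = e / (S + 1)"
  have d: "d > 0" using e S by (simp add: d_def)
  obtain \<xi> where \<xi>: "L2_norm G \<xi> = 1" "\<And>i. i < k \<Longrightarrow> (L2_norm G (a i * \<xi> - cou (a i) *\<^sub>C \<xi>))\<^sup>2 \<le> d\<^sup>2"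
    using almost_invariant_in_L2[OF K, of "a ` {..<k}" "d\<^sup>2"] d by auto
  have \<xi>1: "hr (star \<xi> * \<xi>) = 1"
    using \<xi>(1) L2_norm_square[of \<xi>] haar_form_real[of \<xi>] by (simp add: complex_eq_iff)
  have cl: "clinear (\<lambda>x. hr (star \<xi> * x * \<xi>))"
    by (simp add: clinear_def distrib_left distrib_right mult_scaleC_left mult_scaleC_right haar_simps scaleC_complex_def)
  have "corner \<xi> \<xi> c = (\<Sum>i<k. hr (star \<xi> * a i * \<xi>) *\<^sub>C b i)"
    unfolding corner_def slice_left_corner[OF haar_clinear] T by (simp add: slice_left_simps cl)
  moreover have "c = (\<Sum>i<k. cou (a i) *\<^sub>C b i)"
    using counit_left[of c] by (simp add: T slice_left_simps counit_clinear)
  ultimately have "c - corner \<xi> \<xi> c = (\<Sum>i<k. (cou (a i) - hr (star \<xi> * a i * \<xi>)) *\<^sub>C b i)"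
    by (simp add: CV.scale_left_diff_distrib sum_subtractf)
  hence "N (c - corner \<xi> \<xi> c) \<le> (\<Sum>i<k. cmod (cou (a i) - hr (star \<xi> * a i * \<xi>)) * N (b i))"
    using N_sum[of "\<lambda>i. (cou (a i) - hr (star \<xi> * a i * \<xi>)) *\<^sub>C b i" "{..<k}"] by (simp add: N_scaleC)
  also have "\<dots> \<le> (\<Sum>i<k. d * N (b i))"
  proof (intro sum_mono mult_right_mono)
    fix i assume "i \<in> {..<k}"
    hence i: "i < k" by simp
    have eq: "hr (star \<xi> * a i * \<xi>) - cou (a i) = hr (star \<xi> * (a i * \<xi> - cou (a i) *\<^sub>C \<xi>))"
      by (simp add: right_diff_distrib mult_scaleC_right haar_simps \<xi>1 mult.assoc)
    have "cmod (hr (star \<xi> * a i * \<xi>) - cou (a i)) \<le> L2_norm G (a i * \<xi> - cou (a i) *\<^sub>C \<xi>)"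
      using L2_inner_le[of \<xi> "a i * \<xi> - cou (a i) *\<^sub>C \<xi>"] \<xi>(1) by (simp only: eq mult_1_right)
    also have "\<dots> \<le> d"
      by (rule power2_le_imp_le[OF \<xi>(2)[OF i]]) (use d in simp)
    finally show "cmod (cou (a i) - hr (star \<xi> * a i * \<xi>)) \<le> d" by (subst norm_minus_commute)
  qed simp
  also have "\<dots> = d * S" by (simp add: S_def sum_distrib_left)
  also have "\<dots> \<le> d * (S + 1)" using d by simp
  also have "\<dots> = e" using S by (simp add: d_def)
  finally have "N (c - corner \<xi> \<xi> c) \<le> e" .
  thus "N c \<le> 2 * red c + e" using N_diff_le[of c "corner \<xi> \<xi> c"] corner_le[OF N \<xi>(1), of c] by linarith
qed

lemma coamenable_of_bounded_counit:
  assumes "\<And>a. cmod (cou a) \<le> K * red a"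
  shows "coamenable G"
proof -
  interpret cstar_dominated "max_norm :: 'a \<Rightarrow> real" red 1
    by unfold_locales
      (rule cstar_norm_max_norm[OF cstar_norm_red_norm], rule cstar_norm_red_norm,
        simp_all add: le_max_norm cstar_norm_red_norm)
  show ?thesis
    unfolding coamenable_def
    by (rule canonical_iso_equivalent[of 2])
      (rule max_norm_le[OF cstar_norm_red_norm], erule norm_le_red_norm[OF assms], simp)
qed

end

theorem mainTheorem9:
  fixes G :: "('a::complex_star_algebra, 'i) cqg"
  assumes "compact_quantum_group G"
  shows
    "(\<forall>N. quantum_group_norm G N \<longrightarrow> sa_separable (cstar_completion N) \<longrightarrow>
        \<not> canonical_iso (tilde_norm G N) N \<longrightarrow>
        canonical_iso (max_norm :: 'a \<Rightarrow> real) (tilde_norm G N) \<longrightarrow>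
        dual_property_T G) \<and>
     (sa_separable (cstar_completion (red_norm G)) \<longrightarrow> \<not> coamenable G \<longrightarrow> \<not> dual_property_T G \<longrightarrow>
        \<not> canonical_iso (max_norm :: 'a \<Rightarrow> real) (tilde_norm G (red_norm G)) \<and>
        \<not> canonical_iso (tilde_norm G (red_norm G)) (red_norm G))"
proof (intro conjI allI impI)
  interpret cqg G by unfold_locales fact
  fix N assume "quantum_group_norm G N" and niso: "\<not> canonical_iso (tilde_norm G N) N"
    and iso: "canonical_iso (max_norm :: 'a \<Rightarrow> real) (tilde_norm G N)"
  hence N: "cstar_norm N" by (simp add: quantum_group_norm_def)
  show "dual_property_T G"
    using property_T_of_unbounded_counit[OF N _ iso] tilde_iso_of_bounded_counit[OF N] niso by blast
next
  interpret cqg G by unfold_locales fact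
  assume "\<not> coamenable G" and nT: "\<not> dual_property_T G"
  hence unb: "\<not> (\<exists>K. \<forall>a. cmod (counit G a) \<le> K * red_norm G a)"
    using coamenable_of_bounded_counit by blast
  show "\<not> canonical_iso (max_norm :: 'a \<Rightarrow> real) (tilde_norm G (red_norm G))"
    using property_T_of_unbounded_counit[OF cstar_norm_red_norm unb] nT by blast
  show "\<not> canonical_iso (tilde_norm G (red_norm G)) (red_norm G)"
    using bounded_counit_of_tilde_iso[OF cstar_norm_red_norm] unb by blast
qed

end
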